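(* Let $\mathbf{B}$ be a finite relational structure with universe $B$, and let $F$ be an encoding for $\mathbf{B}$ over a finite set $D$ that contains all constants, i.e. for each $b\in B$ there is $f_b\in F$ with $f_b(e)=b$ for every $e$ in the domain of $f_b$. Suppose that $\mathbf{B}$ is $F$-stable and that $\mathbf{D}$ is an $F$-induced template of $\mathbf{B}$. Then $\mathsf{CSP}(\mathbf{D})$ polynomial-time many-one reduces to $\mathsf{COND}(\mathbf{B})$.
   Context: Structures have a finite signature of relation symbols with arities and a finite universe. A $\wedge$-formula is a conjunction of atoms $R(v_1,\dots,v_k)$ and variable equalities with the usual satisfaction. $\mathsf{CSP}(\mathbf{D})$: given a $\wedge$-formula over the signature of $\mathbf{D}$, decide whether it has a satisfying assignment into $D$. $\mathsf{COND}(\mathbf{B})$: instances are pairs $(U,\phi)$, $U$ a finite set of variables and $\phi$ a $\wedge$-formula over the signature of $\mathbf{B}$ with variables from $U$; it is a yes-instance iff there is a surjective map $f: U\to B$ satisfying $\phi$ over $\mathbf{B}$ such that for every relation symbol $R$ and every tuple $(b_1,\dots,b_k)\in R^{\mathbf{B}}$ there is an atom $R(u_1,\dots,u_k)$ of $\phi$ with $(f(u_1),\dots,f(u_k))=(b_1,\dots,b_k)$. For a finite set $S$, a set of maps $S\to B$ is $\wedge$-definable if it is the set of satisfying assignments $S\to B$ of a $\wedge$-formula with variables from $S$; $\langle T\rangle_{\mathbf{B}}$ is the smallest $\wedge$-definable set containing $T$. An automorphism is a bijection of $B$ preserving each relation in both directions. A set $T$ of maps $I\to B$ is surjectively closed if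 every surjective map in $\langle T\rangle_{\mathbf{B}}$ equals $\gamma\circ t$ with $\gamma$ an automorphism and $t\in T$. An encoding over $D$: a finite set $F$ of maps $f: D^k\to B$ ($k\ge0$ the arity; $D^0=\{\text{empty tuple}\}$). For a finite set $V$: $G_{V,D}$ = maps $V\to D$; a $(V,F)$-application is $(\bar v,f)$, $f\in F$, $\bar v$ a tuple over $V$ of length the arity of $f$; $A_{V,F}$ the set of them; $\alpha[g]=f(g(v_1),\dots,g(v_k))$ for $\alpha=((v_1,\dots,v_k),f)$; $t[g]:\alpha\mapsto\alpha[g]$; $T_V=\{t[g]\mid g\in G_{V,D}\}$. $\mathbf{B}$ is $F$-stable if for every non-empty finite $V$, every map in $T_V$ is surjective and $T_V$ is surjectively closed. An $F$-induced relation is $Q'\subseteq D^s$ ($s\ge1$) such that, for pairwise distinct variables $U=\{u_1,\dots,u_s\}$, there are $Q\subseteq B^r$ (a relation of $\mathbf{B}$ or equality on $B$) and $(\alpha_1,\dots,\alpha_r)\in A_{U,F}^r$ with $Q'=\{(g(u_1),\dots,g(u_s))\mid g\in G_{U,D},\ (t[g](\alpha_1),\dots,t[g](\alpha_r))\in Q\}$. An $F$-induced template of $\mathbf{B}$ is a structure with universe $D$ and finite signature all of whose relations are $F$-induced relations of $\mathbf{B}$. *)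

theory Defs
  imports "HOL-Library.FuncSet" "HOL-Computational_Algebra.Polynomial"
begin

section \<open>Polynomial-time many-one reductions\<close>

text \<open>
  Deterministic Turing machines with finitely many two-way infinite tapes. Tape symbols are
  natural numbers: 0 is the blank, 1 and 2 represent the bits \<open>False\<close> and \<open>True\<close>,
  larger numbers are auxiliary symbols. States are natural numbers; the initial state is 0 and
  the machine halts exactly when its state is \<open>num_states\<close>.
\<close>

datatype move = Move_Left | Move_None | Move_Right

record tm =
  num_tapes :: nat
  num_symbols :: nat
  num_states :: nat
  delta :: "nat \<Rightarrow> nat list \<Rightarrow> nat \<times> (nat \<times> move) list"

definition wf_tm :: "tm \<Rightarrow> bool" where
  "wf_tm M \<longleftrightarrow> 1 \<le> num_tapes M \<and> 3 \<le> num_symbols M \<and>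
     (\<forall>q < num_states M. \<forall>ss. length ss = num_tapes M \<and> set ss \<subseteq> {..<num_symbols M} \<longrightarrow>
        fst (delta M q ss) \<le> num_states M \<and>
        length (snd (delta M q ss)) = num_tapes M \<and>
        fst ` set (snd (delta M q ss)) \<subseteq> {..<num_symbols M})"

text \<open>A tape is its contents together with the head position.\<close>

type_synonym tape = "(int \<Rightarrow> nat) \<times> int"
type_synonym config = "nat \<times> tape list"

fun head_shift :: "move \<Rightarrow> int" where
  "head_shift Move_Left = -1"
| "head_shift Move_None = 0"
| "head_shift Move_Right = 1"

fun read_tape :: "tape \<Rightarrow> nat" where
  "read_tape (c, i) = c i"

fun act_tape :: "nat \<times> move \<Rightarrow> tape \<Rightarrow> tape" where
  "act_tape (s, m) (c, i) = (c(i := s), i + head_shift m)"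

fun tm_step :: "tm \<Rightarrow> config \<Rightarrow> config" where
  "tm_step M (q, ts) =
     (if q < num_states M
      then (let (q', as) = delta M q (map read_tape ts) in (q', map2 act_tape as ts))
      else (q, ts))"

definition word_contents :: "bool list \<Rightarrow> int \<Rightarrow> nat" where
  "word_contents w i =
     (if 0 \<le> i \<and> i < int (length w) then (if w ! nat i then 2 else 1) else 0)"

text \<open>The input is on the first tape, the output is on the last one; all other cells of these two
  tapes are blank at the start and at the end, respectively.\<close>

definition init_config :: "tm \<Rightarrow> bool list \<Rightarrow> config" where
  "init_config M w =
     (0, (word_contents w, 0) # replicate (num_tapes M - 1) (word_contents [], 0))"

definition tm_outputs_within :: "tm \<Rightarrow> bool list \<Rightarrow> bool list \<Rightarrow> nat \<Rightarrow> bool" where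
  "tm_outputs_within M w v n \<longleftrightarrow>
     (\<exists>t \<le> n. \<exists>ts. (tm_step M ^^ t) (init_config M w) = (num_states M, ts) \<and>
        fst (last ts) = word_contents v)"

definition polytime_computable :: "(bool list \<Rightarrow> bool list) \<Rightarrow> bool" where
  "polytime_computable f \<longleftrightarrow>
     (\<exists>M. wf_tm M \<and> (\<exists>p :: nat poly. \<forall>w. tm_outputs_within M w (f w) (poly p (length w))))"

definition polytime_reducible :: "bool list set \<Rightarrow> bool list set \<Rightarrow> bool"  (infix "\<le>\<^sub>p" 50) where
  "L \<le>\<^sub>p L' \<longleftrightarrow> (\<exists>f. polytime_computable f \<and> (\<forall>w. w \<in> L \<longleftrightarrow> f w \<in> L'))"


section \<open>Structures and conjunctive formulas\<close>

definition tuples :: "'a set \<Rightarrow> nat \<Rightarrow> 'a list set" where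
  "tuples A k = {xs. set xs \<subseteq> A \<and> length xs = k}"

text \<open>Relation symbols are named by natural numbers; \<open>arity\<close> and \<open>rel\<close> are only
  relevant on \<open>symbols\<close>.\<close>

record 'a rel_struct =
  universe :: "'a set"
  symbols :: "nat set"
  arity :: "nat \<Rightarrow> nat"
  rel :: "nat \<Rightarrow> 'a list set"

definition wf_struct :: "'a rel_struct \<Rightarrow> bool" where
  "wf_struct \<B> \<longleftrightarrow> finite (universe \<B>) \<and> finite (symbols \<B>) \<and>
     (\<forall>R \<in> symbols \<B>. rel \<B> R \<subseteq> tuples (universe \<B>) (arity \<B> R))"

datatype 'v atom = Rel nat "'v list" | Eq 'v 'v

text \<open>A list of atoms stands for their conjunction.\<close>

type_synonym 'v formula = "'v atom list"

definition vars :: "'v formula \<Rightarrow> 'v set" where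
  "vars \<phi> = (\<Union>a \<in> set \<phi>. set_atom a)"

fun atom_over :: "'a rel_struct \<Rightarrow> 'v atom \<Rightarrow> bool" where
  "atom_over \<B> (Rel R vs) \<longleftrightarrow> R \<in> symbols \<B> \<and> length vs = arity \<B> R"
| "atom_over \<B> (Eq u v) \<longleftrightarrow> True"

definition formula_over :: "'a rel_struct \<Rightarrow> 'v formula \<Rightarrow> bool" where
  "formula_over \<B> \<phi> \<longleftrightarrow> (\<forall>a \<in> set \<phi>. atom_over \<B> a)"

fun sat_atom :: "'a rel_struct \<Rightarrow> ('v \<Rightarrow> 'a) \<Rightarrow> 'v atom \<Rightarrow> bool" where
  "sat_atom \<B> h (Rel R vs) \<longleftrightarrow> map h vs \<in> rel \<B> R"
| "sat_atom \<B> h (Eq u v) \<longleftrightarrow> h u = h v"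

definition sat :: "'a rel_struct \<Rightarrow> ('v \<Rightarrow> 'a) \<Rightarrow> 'v formula \<Rightarrow> bool" where
  "sat \<B> h \<phi> \<longleftrightarrow> (\<forall>a \<in> set \<phi>. sat_atom \<B> h a)"


section \<open>The decision problems\<close>

text \<open>Variables of problem instances are binary words. The encoding of instances by binary words is
  self-delimiting: every list entry is announced by \<open>True\<close>, and \<open>False\<close> ends the
  list. A relation symbol is written in unary; since signatures are fixed, it has constant
  length.\<close>

type_synonym var = "bool list"

fun enc_list :: "('x \<Rightarrow> bool list) \<Rightarrow> 'x list \<Rightarrow> bool list" where
  "enc_list e [] = [False]"
| "enc_list e (x # xs) = True # e x @ enc_list e xs"

definition enc_var :: "var \<Rightarrow> bool list" where
  "enc_var = enc_list (\<lambda>b. [b])"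

fun enc_atom :: "var atom \<Rightarrow> bool list" where
  "enc_atom (Rel R vs) = True # replicate R True @ [False] @ enc_list enc_var vs"
| "enc_atom (Eq u v) = False # enc_var u @ enc_var v"

definition enc_formula :: "var formula \<Rightarrow> bool list" where
  "enc_formula = enc_list enc_atom"

text \<open>The finite variable set of an instance of the second problem is presented by a list of its
  elements, in any order and possibly with repetitions.\<close>

definition enc_cond_instance :: "var list \<Rightarrow> var formula \<Rightarrow> bool list" where
  "enc_cond_instance us \<phi> = enc_list enc_var us @ enc_formula \<phi>"

definition CSP_yes :: "'a rel_struct \<Rightarrow> 'v formula \<Rightarrow> bool" where
  "CSP_yes \<D> \<phi> \<longleftrightarrow> (\<exists>h \<in> vars \<phi> \<rightarrow>\<^sub>E universe \<D>. sat \<D> h \<phi>)"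

definition COND_yes :: "'a rel_struct \<Rightarrow> 'v set \<Rightarrow> 'v formula \<Rightarrow> bool" where
  "COND_yes \<B> U \<phi> \<longleftrightarrow>
     (\<exists>h \<in> U \<rightarrow>\<^sub>E universe \<B>. h ` U = universe \<B> \<and> sat \<B> h \<phi> \<and>
        (\<forall>R \<in> symbols \<B>. \<forall>bs \<in> rel \<B> R. \<exists>us. Rel R us \<in> set \<phi> \<and> map h us = bs))"

definition CSP :: "'a rel_struct \<Rightarrow> bool list set" where
  "CSP \<D> = {enc_formula \<phi> | \<phi>. formula_over \<D> \<phi> \<and> CSP_yes \<D> \<phi>}"

definition COND :: "'a rel_struct \<Rightarrow> bool list set" where
  "COND \<B> = {enc_cond_instance us \<phi> | us \<phi>.
     formula_over \<B> \<phi> \<and> vars \<phi> \<subseteq> set us \<and> COND_yes \<B> (set us) \<phi>}"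

text \<open>The encodings are uniquely decodable.\<close>

definition self_delimiting :: "('x \<Rightarrow> bool list) \<Rightarrow> bool" where
  "self_delimiting e \<longleftrightarrow> (\<forall>x y r s. e x @ r = e y @ s \<longrightarrow> x = y \<and> r = s)"

lemma self_delimiting_enc_list:
  assumes "self_delimiting e"
  shows "self_delimiting (enc_list e)"
proof -
  have "xs = ys \<and> r = s" if "enc_list e xs @ r = enc_list e ys @ s" for xs ys r s
    using that
  proof (induction xs arbitrary: ys)
    case Nil
    then show ?case by (cases ys) auto
  next
    case (Cons x xs)
    then obtain y ys' where ys: "ys = y # ys'" by (cases ys) auto
    from Cons.prems have "e x @ (enc_list e xs @ r) = e y @ (enc_list e ys' @ s)"
      by (simp add: ys)
    then have "x = y" "enc_list e xs @ r = enc_list e ys' @ s"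
      using assms unfolding self_delimiting_def by blast+
    then show ?case using Cons.IH ys by blast
  qed
  then show ?thesis unfolding self_delimiting_def by blast
qed

lemma self_delimiting_enc_var: "self_delimiting enc_var"
  unfolding enc_var_def
  by (rule self_delimiting_enc_list) (simp add: self_delimiting_def)

lemma replicate_True_append_False_eq:
  "replicate m True @ False # r = replicate n True @ False # s \<Longrightarrow> m = n \<and> r = s"
proof (induction m arbitrary: n)
  case 0
  then show ?case by (cases n) auto
next
  case (Suc m)
  then show ?case by (cases n) auto
qed

lemma self_delimiting_enc_atom: "self_delimiting enc_atom"
proof -
  have sd_var: "enc_var u @ r = enc_var v @ s \<Longrightarrow> u = v \<and> r = s" for u v r s
    using self_delimiting_enc_var unfolding self_delimiting_def by blast
  have sd_vars: "enc_list enc_var us @ r = enc_list enc_var vs @ s \<Longrightarrow> us = vs \<and> r = s"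
    for us vs r s
    using self_delimiting_enc_list[OF self_delimiting_enc_var]
    unfolding self_delimiting_def by blast
  have "a = b \<and> r = s" if "enc_atom a @ r = enc_atom b @ s" for a b r s
  proof (cases a; cases b)
    fix R us R' us' assume "a = Rel R us" "b = Rel R' us'"
    then show ?thesis
      using that replicate_True_append_False_eq
        [of R "enc_list enc_var us @ r" R' "enc_list enc_var us' @ s"] sd_vars by auto
  next
    fix u v u' v' assume "a = Eq u v" "b = Eq u' v'"
    then show ?thesis using that by (auto dest!: sd_var)
  qed (use that in auto)
  then show ?thesis unfolding self_delimiting_def by blast
qed

lemma inj_enc_formula: "inj enc_formula"
proof -
  have "self_delimiting enc_formula"
    unfolding enc_formula_def by (rule self_delimiting_enc_list[OF self_delimiting_enc_atom])
  then show ?thesis unfolding self_delimiting_def inj_def by (metis append_Nil2)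
qed

lemma enc_cond_instance_inject:
  "enc_cond_instance us \<phi> = enc_cond_instance vs \<psi> \<longleftrightarrow> us = vs \<and> \<phi> = \<psi>"
  using self_delimiting_enc_list[OF self_delimiting_enc_var] inj_enc_formula
  unfolding enc_cond_instance_def self_delimiting_def inj_def by blast


section \<open>Definable sets of maps and surjective closedness\<close>

definition conj_definable :: "'a rel_struct \<Rightarrow> 'v set \<Rightarrow> ('v \<Rightarrow> 'a) set \<Rightarrow> bool" where
  "conj_definable \<B> S M \<longleftrightarrow>
     (\<exists>\<phi>. formula_over \<B> \<phi> \<and> vars \<phi> \<subseteq> S \<and> M = {h \<in> S \<rightarrow>\<^sub>E universe \<B>. sat \<B> h \<phi>})"

definition conj_closure :: "'a rel_struct \<Rightarrow> 'v set \<Rightarrow> ('v \<Rightarrow> 'a) set \<Rightarrow> ('v \<Rightarrow> 'a) set" where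
  "conj_closure \<B> S T = conj_definable \<B> S hull T"

lemma conj_definable_Int:
  assumes "conj_definable \<B> S M" "conj_definable \<B> S N"
  shows "conj_definable \<B> S (M \<inter> N)"
proof -
  obtain \<phi> \<psi> where
    "formula_over \<B> \<phi>" "vars \<phi> \<subseteq> S" "M = {h \<in> S \<rightarrow>\<^sub>E universe \<B>. sat \<B> h \<phi>}"
    "formula_over \<B> \<psi>" "vars \<psi> \<subseteq> S" "N = {h \<in> S \<rightarrow>\<^sub>E universe \<B>. sat \<B> h \<psi>}"
    using assms unfolding conj_definable_def by blast
  then show ?thesis
    unfolding conj_definable_def
    by (intro exI[of _ "\<phi> @ \<psi>"]) (auto simp: formula_over_def vars_def sat_def)
qed

text \<open>The closure is itself definable, hence it is the smallest definable set containing \<open>T\<close>.\<close>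

lemma conj_definable_conj_closure:
  assumes "wf_struct \<B>" "finite S" "T \<subseteq> S \<rightarrow>\<^sub>E universe \<B>"
  shows "conj_definable \<B> S (conj_closure \<B> S T)"
proof -
  let ?X = "S \<rightarrow>\<^sub>E universe \<B>"
  let ?\<M> = "{M. conj_definable \<B> S M \<and> T \<subseteq> M}"
  have "finite ?X"
    using assms by (auto simp: wf_struct_def intro: finite_PiE)
  moreover have "?\<M> \<subseteq> Pow ?X"
    by (auto simp: conj_definable_def)
  ultimately have "finite ?\<M>"
    by (meson finite_Pow_iff finite_subset)
  moreover have "conj_definable \<B> S ?X"
    unfolding conj_definable_def
    by (intro exI[of _ "[]"]) (auto simp: formula_over_def vars_def sat_def)
  then have "?\<M> \<noteq> {}"
    using assms(3) by blast
  moreover have "conj_definable \<B> S (\<Inter>\<N>)"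
    if "finite \<N>" "\<N> \<noteq> {}" "\<forall>M \<in> \<N>. conj_definable \<B> S M" for \<N>
    using that by (induction \<N> rule: finite_ne_induct) (auto intro: conj_definable_Int)
  ultimately show ?thesis
    unfolding conj_closure_def hull_def by blast
qed

definition automorphism :: "'a rel_struct \<Rightarrow> ('a \<Rightarrow> 'a) \<Rightarrow> bool" where
  "automorphism \<B> \<gamma> \<longleftrightarrow> bij_betw \<gamma> (universe \<B>) (universe \<B>) \<and>
     (\<forall>R \<in> symbols \<B>. \<forall>bs \<in> tuples (universe \<B>) (arity \<B> R).
        bs \<in> rel \<B> R \<longleftrightarrow> map \<gamma> bs \<in> rel \<B> R)"

definition surj_closed :: "'a rel_struct \<Rightarrow> 'v set \<Rightarrow> ('v \<Rightarrow> 'a) set \<Rightarrow> bool" where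
  "surj_closed \<B> I T \<longleftrightarrow>
     (\<forall>h \<in> conj_closure \<B> I T. h ` I = universe \<B> \<longrightarrow>
        (\<exists>\<gamma> t. automorphism \<B> \<gamma> \<and> t \<in> T \<and> h = compose I \<gamma> t))"


section \<open>Encodings, stability and induced templates\<close>

text \<open>A map \<open>D\<^sup>k \<rightarrow> B\<close> is paired with its arity \<open>k\<close>. Maps are extensional
  functions, so that finiteness of \<open>F\<close> counts maps on \<open>D\<^sup>k\<close>.\<close>

type_synonym ('d, 'b) enc_map = "nat \<times> ('d list \<Rightarrow> 'b)"
type_synonym ('d, 'b) application = "var list \<times> ('d, 'b) enc_map"

definition encoding :: "('d, 'b) enc_map set \<Rightarrow> 'd set \<Rightarrow> 'b set \<Rightarrow> bool" where
  "encoding F D B \<longleftrightarrow> finite F \<and> (\<forall>(k, f) \<in> F. f \<in> tuples D k \<rightarrow>\<^sub>E B)"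

definition contains_constants :: "('d, 'b) enc_map set \<Rightarrow> 'd set \<Rightarrow> 'b set \<Rightarrow> bool" where
  "contains_constants F D B \<longleftrightarrow> (\<forall>b \<in> B. \<exists>(k, f) \<in> F. \<forall>e \<in> tuples D k. f e = b)"

definition applications :: "var set \<Rightarrow> ('d, 'b) enc_map set \<Rightarrow> ('d, 'b) application set" where
  "applications V F = {(vs, (k, f)) | vs k f. (k, f) \<in> F \<and> vs \<in> tuples V k}"

fun app_value :: "('d, 'b) application \<Rightarrow> (var \<Rightarrow> 'd) \<Rightarrow> 'b" where
  "app_value (vs, (k, f)) g = f (map g vs)"

definition t_map :: "var set \<Rightarrow> ('d, 'b) enc_map set \<Rightarrow> (var \<Rightarrow> 'd) \<Rightarrow> ('d, 'b) application \<Rightarrow> 'b"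
  where "t_map V F g = (\<lambda>\<alpha> \<in> applications V F. app_value \<alpha> g)"

definition T_set ::
    "'d set \<Rightarrow> ('d, 'b) enc_map set \<Rightarrow> var set \<Rightarrow> (('d, 'b) application \<Rightarrow> 'b) set" where
  "T_set D F V = {t_map V F g | g. g \<in> V \<rightarrow>\<^sub>E D}"

definition stable :: "'b rel_struct \<Rightarrow> 'd set \<Rightarrow> ('d, 'b) enc_map set \<Rightarrow> bool" where
  "stable \<B> D F \<longleftrightarrow>
     (\<forall>V. finite V \<and> V \<noteq> {} \<longrightarrow>
        (\<forall>t \<in> T_set D F V. t ` applications V F = universe \<B>) \<and>
        surj_closed \<B> (applications V F) (T_set D F V))"

definition induced_relation ::
    "'b rel_struct \<Rightarrow> 'd set \<Rightarrow> ('d, 'b) enc_map set \<Rightarrow> nat \<Rightarrow> 'd list set \<Rightarrow> bool" where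
  "induced_relation \<B> D F s Q' \<longleftrightarrow>
     1 \<le> s \<and> Q' \<subseteq> tuples D s \<and>
     (\<forall>us. distinct us \<and> length us = s \<longrightarrow>
        (\<exists>r Q \<alpha>s.
           ((\<exists>R \<in> symbols \<B>. r = arity \<B> R \<and> Q = rel \<B> R) \<or>
            (r = 2 \<and> Q = {[b, b] | b. b \<in> universe \<B>})) \<and>
           \<alpha>s \<in> tuples (applications (set us) F) r \<and>
           Q' = {map g us | g. g \<in> set us \<rightarrow>\<^sub>E D \<and> map (t_map (set us) F g) \<alpha>s \<in> Q}))"

definition induced_template ::
    "'b rel_struct \<Rightarrow> 'd set \<Rightarrow> ('d, 'b) enc_map set \<Rightarrow> 'd rel_struct \<Rightarrow> bool" where
  "induced_template \<B> D F \<D> \<longleftrightarrow>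
     wf_struct \<D> \<and> universe \<D> = D \<and>
     (\<forall>R \<in> symbols \<D>. induced_relation \<B> D F (arity \<D> R) (rel \<D> R))"

end

theory Submission
  imports Defs "HOL-Library.Countable"
begin

text \<open>
  Let \<open>V\<close> contain the variables of a \<open>CSP\<close> instance \<open>\<phi>\<close>. The variables of the \<open>COND\<close> instance are
  the applications over \<open>V\<close>, and its formula has three parts: all atoms that hold under every map
  \<open>t_map V F g\<close>; for each relational atom of \<open>\<phi>\<close>, an atom that induces it; and, for each equality
  \<open>u = v\<close>, the equality of any two applications that differ by replacing \<open>u\<close> with \<open>v\<close> at one
  position. The first part defines the closure of \<open>T_set D F V\<close>, so by stability a surjective solution is,
  up to an automorphism, some \<open>t_map V F g\<close>, and \<open>g\<close> solves \<open>\<phi>\<close> once interchangeable values are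
  identified. Conversely \<open>t_map V F g\<close> is surjective by stability, and the constant encoding maps
  supply an atom for every tuple of every relation.

  An atom mentions boundedly many variables of \<open>V\<close>. The first part is therefore obtained by
  substituting variables of \<open>V\<close> in all possible ways into finitely many templates, without comparing
  variables. So the reduction is computed by a Turing machine that copies \<open>\<phi>\<close> to
  several tapes, uses their heads as pointers to variables, and prints the templates in nested loops.
\<close>

section \<open>A while language for Turing machines\<close>

text \<open>Distinct elements of \<open>D\<close> may look alike to all encoding maps, so values of
  applications cannot enforce \<open>u = v\<close>; they can only state that exchanging
  \<open>u\<close> and \<open>v\<close> changes nothing. The assignment \<open>g\<close> read off a
  solution is therefore composed with a choice of representatives of interchangeable values. This
  leaves \<open>t_map V F g\<close> as it is, so the relational constraints, which see
  \<open>g\<close> only through it, stay true, while the equalities become true. Whether an atom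
  holds under every \<open>t_map V F g\<close> depends only on which of its variables coincide. A
  template valid for independent values of its heads stays valid under any substitution, and a valid
  atom arises from the template that renames its variables injectively to heads. Hence
  \<open>(m + 2) * K\<close> heads suffice, where \<open>m\<close> bounds the arities of
  \<open>\<B>\<close> and \<open>K\<close> those of the encoding maps. Two degenerate cases remain:
  stability speaks of non-empty \<open>V\<close> only, which is why a variable is added to every
  instance; and for \<open>D = {}\<close> there is no assignment of a non-empty \<open>V\<close>, so
  a separate small machine maps the one satisfiable formula to a fixed yes-instance.\<close>

text \<open>An action says, for each tape, what is written and how the head moves, depending on the symbol
  under that head and on the symbols under the heads of tapes 0 and 1.\<close>

datatype com =
    Act "nat \<Rightarrow> nat \<Rightarrow> nat \<Rightarrow> nat \<Rightarrow> nat \<times> move"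
  | Then com com
  | Branch nat "nat set" com com
  | Loop nat "nat set" com

definition act_all ::
    "(nat \<Rightarrow> nat \<Rightarrow> nat \<Rightarrow> nat \<Rightarrow> nat \<times> move) \<Rightarrow> (nat \<Rightarrow> tape) \<Rightarrow> nat \<Rightarrow> tape" where
  "act_all g T i = act_tape (g i (read_tape (T i)) (read_tape (T 0)) (read_tape (T 1))) (T i)"

text \<open>The step counts anticipate the compiled code: a test takes one step, and so does the
  jump that skips the second branch or returns to the loop test. Tapes are indexed by all natural
  numbers; a machine keeps the first \<open>N\<close> of them.\<close>

inductive exec :: "com \<Rightarrow> (nat \<Rightarrow> tape) \<Rightarrow> nat \<Rightarrow> (nat \<Rightarrow> tape) \<Rightarrow> bool" where
  Act: "exec (Act g) T 1 (act_all g T)"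
| Then: "exec c T t T' \<Longrightarrow> exec d T' t' T'' \<Longrightarrow> exec (Then c d) T (t + t') T''"
| Branch_True: "read_tape (T j) \<in> A \<Longrightarrow> exec c T t T' \<Longrightarrow> exec (Branch j A c d) T (t + 2) T'"
| Branch_False: "read_tape (T j) \<notin> A \<Longrightarrow> exec d T t T' \<Longrightarrow> exec (Branch j A c d) T (t + 1) T'"
| Loop_False: "read_tape (T j) \<notin> A \<Longrightarrow> exec (Loop j A c) T 1 T"
| Loop_True: "read_tape (T j) \<in> A \<Longrightarrow> exec c T t T' \<Longrightarrow> exec (Loop j A c) T' t' T'' \<Longrightarrow>
    exec (Loop j A c) T (t + t' + 2) T''"

fun wf_com :: "nat \<Rightarrow> nat \<Rightarrow> com \<Rightarrow> bool" where
  "wf_com N S (Act g) \<longleftrightarrow> (\<forall>i<N. \<forall>a<S. \<forall>b<S. \<forall>c<S. fst (g i a b c) < S)"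
| "wf_com N S (Then c d) \<longleftrightarrow> wf_com N S c \<and> wf_com N S d"
| "wf_com N S (Branch j A c d) \<longleftrightarrow> j < N \<and> wf_com N S c \<and> wf_com N S d"
| "wf_com N S (Loop j A c) \<longleftrightarrow> j < N \<and> wf_com N S c"

fun csize :: "com \<Rightarrow> nat" where
  "csize (Act g) = 1"
| "csize (Then c d) = csize c + csize d"
| "csize (Branch j A c d) = csize c + csize d + 2"
| "csize (Loop j A c) = csize c + 2"

definition jump :: "nat \<Rightarrow> nat list \<Rightarrow> nat \<times> (nat \<times> move) list" where
  "jump q ss = (q, map (\<lambda>s. (s, Move_None)) ss)"

text \<open>The second argument is the state in which the compiled code starts; it is left in the state
  following its last one.\<close>

fun compile :: "com \<Rightarrow> nat \<Rightarrow> (nat list \<Rightarrow> nat \<times> (nat \<times> move) list) list" where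
  "compile (Act g) q = [\<lambda>ss. (q + 1, map (\<lambda>i. g i (ss ! i) (ss ! 0) (ss ! 1)) [0..<length ss])]"
| "compile (Then c d) q = compile c q @ compile d (q + csize c)"
| "compile (Branch j A c d) q =
     [\<lambda>ss. jump (if ss ! j \<in> A then q + 1 else q + csize c + 2) ss] @ compile c (q + 1) @
     [jump (q + csize c + csize d + 2)] @ compile d (q + csize c + 2)"
| "compile (Loop j A c) q =
     [\<lambda>ss. jump (if ss ! j \<in> A then q + 1 else q + csize c + 2) ss] @ compile c (q + 1) @ [jump q]"

lemma length_compile [simp]: "length (compile c q) = csize c"
  by (induction c arbitrary: q) auto

definition code_at :: "tm \<Rightarrow> nat \<Rightarrow> (nat list \<Rightarrow> nat \<times> (nat \<times> move) list) list \<Rightarrow> bool" where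
  "code_at M q is \<longleftrightarrow>
     (\<forall>i<length is. q + i < num_states M \<and> delta M (q + i) = is ! i)"

lemma code_at_Nil [simp]: "code_at M q []"
  by (simp add: code_at_def)

lemma code_at_Cons [simp]:
  "code_at M q (x # is) \<longleftrightarrow> q < num_states M \<and> delta M q = x \<and> code_at M (Suc q) is"
  unfolding code_at_def by (auto simp: less_Suc_eq_0_disj all_conj_distrib)

lemma code_at_append [simp]:
  "code_at M q (xs @ ys) \<longleftrightarrow> code_at M q xs \<and> code_at M (q + length xs) ys"
  by (induction xs arbitrary: q) auto

lemma act_tape_stay: "act_tape (read_tape t, Move_None) t = t"
  by (cases t) auto

lemma tm_step_jump:
  assumes "q < num_states M" "delta M q = jump q'"
  shows "tm_step M (q, ts) = (q', ts)"
proof -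
  have "map2 act_tape (map (\<lambda>s. (s, Move_None)) (map read_tape ts)) ts = ts"
    by (induction ts) (auto simp: act_tape_stay simp del: act_tape.simps)
  then show ?thesis using assms by (simp add: jump_def)
qed

lemma tm_step_test:
  assumes "q < num_states M" "delta M q = (\<lambda>ss. jump (if ss ! j \<in> A then q1 else q2) ss)"
    and "j < length ts"
  shows "tm_step M (q, ts) = (if read_tape (ts ! j) \<in> A then q1 else q2, ts)"
proof -
  have "map2 act_tape (map (\<lambda>s. (s, Move_None)) (map read_tape ts)) ts = ts"
    by (induction ts) (auto simp: act_tape_stay simp del: act_tape.simps)
  then show ?thesis using assms by (simp add: jump_def)
qed

text \<open>By induction on the execution, because the number of rounds of a loop is visible only
  there. \<open>wf_com\<close> puts every tested tape below \<open>N\<close>, and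
  \<open>2 \<le> N\<close> provides the two tapes that every action reads besides its own.\<close>

lemma exec_compile:
  assumes "exec c T t T'" "wf_com N S c" "2 \<le> N" "code_at M q (compile c q)"
  shows "(tm_step M ^^ t) (q, map T [0..<N]) = (q + csize c, map T' [0..<N])"
  using assms
proof (induction arbitrary: q)
  case (Act g T)
  let ?ss = "map read_tape (map T [0..<N])"
  have "map2 act_tape (map (\<lambda>i. g i (?ss ! i) (?ss ! 0) (?ss ! 1)) [0..<N]) (map T [0..<N]) =
    map (act_all g T) [0..<N]"
    using Act.prems by (intro nth_equalityI) (auto simp: act_all_def)
  then show ?case using Act.prems by (simp del: map_map)
next
  case (Then c T t T' d t' T'')
  then show ?case by (auto simp: add.commute[of t] funpow_add add.assoc)
next
  case (Branch_True T j A c t T' d)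
  have "tm_step M (q, map T [0..<N]) = (q + 1, map T [0..<N])"
    using Branch_True.prems Branch_True.hyps by (subst tm_step_test) auto
  moreover have "(tm_step M ^^ t) (q + 1, map T [0..<N]) = (q + 1 + csize c, map T' [0..<N])"
    using Branch_True.prems by (intro Branch_True.IH) auto
  moreover have "tm_step M (q + 1 + csize c, map T' [0..<N]) =
      (q + csize (Branch j A c d), map T' [0..<N])"
    using Branch_True.prems by (subst tm_step_jump) (auto simp: add.assoc)
  ultimately show ?case by (simp add: funpow_swap1 del: tm_step.simps)
next
  case (Branch_False T j A d t T' c)
  have "tm_step M (q, map T [0..<N]) = (q + csize c + 2, map T [0..<N])"
    using Branch_False.prems Branch_False.hyps by (subst tm_step_test) auto
  moreover have "(tm_step M ^^ t) (q + csize c + 2, map T [0..<N]) =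
      (q + csize c + 2 + csize d, map T' [0..<N])"
    using Branch_False.prems by (intro Branch_False.IH) (auto simp: add.assoc)
  ultimately show ?case by (simp add: funpow_swap1 algebra_simps del: tm_step.simps)
next
  case (Loop_False T j A c)
  then show ?case using tm_step_test[of q M j A "q + 1" "q + csize c + 2" "map T [0..<N]"]
    by (auto simp del: tm_step.simps)
next
  case (Loop_True T j A c t T' t' T'')
  have "tm_step M (q, map T [0..<N]) = (q + 1, map T [0..<N])"
    using Loop_True.prems Loop_True.hyps by (subst tm_step_test) auto
  moreover have "(tm_step M ^^ t) (q + 1, map T [0..<N]) = (q + 1 + csize c, map T' [0..<N])"
    using Loop_True.prems by (intro Loop_True.IH) auto
  moreover have "tm_step M (q + 1 + csize c, map T' [0..<N]) = (q, map T' [0..<N])"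
    using Loop_True.prems by (subst tm_step_jump) auto
  moreover have "(tm_step M ^^ t') (q, map T' [0..<N]) = (q + csize (Loop j A c), map T'' [0..<N])"
    using Loop_True.prems by (intro Loop_True.IH) auto
  moreover have split: "(f ^^ (t + t' + 2)) x = (f ^^ t') (f ((f ^^ t) (f x)))"
    for f :: "config \<Rightarrow> config" and x
    using funpow_add[of t' "Suc (t + 1)" f] funpow_add[of t 1 f] by (simp add: algebra_simps)
  ultimately show ?case unfolding split by simp
qed

text \<open>This is what \<open>wf_tm\<close> asks of a transition function. A subprogram ends no
  later than the program around it, so bounds on its target states only have to be weakened.\<close>

lemma compile_bounds:
  assumes "wf_com N S c" "2 \<le> N" "i < csize c" "length ss = N" "set ss \<subseteq> {..<S}"
  shows "fst ((compile c q ! i) ss) \<le> q + csize c \<and> length (snd ((compile c q ! i) ss)) = N \<and>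
    fst ` set (snd ((compile c q ! i) ss)) \<subseteq> {..<S}"
proof -
  define ok where "ok b x \<longleftrightarrow> fst (x ss) \<le> b \<and> length (snd (x ss)) = N \<and>
    fst ` set (snd (x ss)) \<subseteq> {..<S}" for b and x :: "nat list \<Rightarrow> nat \<times> (nat \<times> move) list"
  have ok_mono: "ok b x \<Longrightarrow> b \<le> b' \<Longrightarrow> ok b' x" for b b' x
    by (auto simp: ok_def)
  have ok_jump: "ok b (jump q)" if "q \<le> b" for b q
    using assms(4,5) that by (auto simp: ok_def jump_def)
  have ok_test: "ok b (\<lambda>ss. jump (if P ss then q else q') ss)" if "q \<le> b" "q' \<le> b" for b q q' P
    using assms(4,5) that by (auto simp: ok_def jump_def)
  have nth: "ss ! i < S" if "i < N" for i
    using assms(4,5) that by (meson lessThan_iff nth_mem subsetD)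
  have "\<forall>x \<in> set (compile c q). ok (q + csize c) x"
    using assms(1)
  proof (induction c arbitrary: q)
    case (Act g)
    then have "fst (g i (ss ! i) (ss ! 0) (ss ! 1)) < S" if "i < N" for i
      using nth assms(2) that by simp
    then show ?case using assms(4) by (auto simp: ok_def)
  next
    case (Then c d)
    then show ?case by (fastforce elim: ok_mono simp: add.assoc)
  next
    case (Branch j A c d)
    have "\<forall>x \<in> set (compile c (q + 1)). ok (q + csize (Branch j A c d)) x"
      using Branch.IH(1)[of "q + 1"] Branch.prems by (auto elim!: ok_mono)
    moreover have "\<forall>x \<in> set (compile d (q + csize c + 2)). ok (q + csize (Branch j A c d)) x"
      using Branch.IH(2)[of "q + csize c + 2"] Branch.prems by (auto elim!: ok_mono)
    ultimately show ?case by (auto intro!: ok_jump ok_test)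
  next
    case (Loop j A c)
    have "\<forall>x \<in> set (compile c (q + 1)). ok (q + csize (Loop j A c)) x"
      using Loop.IH[of "q + 1"] Loop.prems by (auto elim!: ok_mono)
    then show ?case by (auto intro!: ok_jump ok_test)
  qed
  then show ?thesis using assms(3) by (simp add: ok_def)
qed

definition init_tapes :: "bool list \<Rightarrow> nat \<Rightarrow> tape" where
  "init_tapes w i = (word_contents (if i = 0 then w else []), 0)"

theorem polytime_computable_com:
  fixes p :: "nat poly"
  assumes wf: "wf_com N S c" "2 \<le> N" "3 \<le> S"
    and run: "\<And>w. \<exists>t T. t \<le> poly p (length w) \<and> exec c (init_tapes w) t T \<and>
      fst (T (N - 1)) = word_contents (f w)"
  shows "polytime_computable f"
proof -
  \<comment> \<open>The code starts in state 0 and ends in state \<open>csize c\<close>, which is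
    thereby the halting state.\<close>
  define M where "M = \<lparr>num_tapes = N, num_symbols = S, num_states = csize c,
    delta = (\<lambda>q. compile c 0 ! q)\<rparr>"
  have "wf_tm M"
    unfolding wf_tm_def using wf compile_bounds[OF wf(1,2), where q = 0] by (auto simp: M_def)
  moreover have "tm_outputs_within M w (f w) (poly p (length w))" for w
  proof -
    obtain t T where t: "t \<le> poly p (length w)" "exec c (init_tapes w) t T"
      "fst (T (N - 1)) = word_contents (f w)"
      using run by blast
    have "init_config M w = (0, map (init_tapes w) [0..<N])"
      using wf(2)
      by (auto simp: init_config_def M_def init_tapes_def nth_Cons intro!: nth_equalityI
          split: nat.split)
    moreover have "code_at M 0 (compile c 0)"
      by (simp add: code_at_def M_def)
    ultimately have "(tm_step M ^^ t) (init_config M w) = (num_states M, map T [0..<N])"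
      using exec_compile[OF t(2) wf(1,2)] by (simp add: M_def)
    moreover have "last (map T [0..<N]) = T (N - 1)"
      using wf(2) by (simp add: last_map)
    ultimately show ?thesis
      unfolding tm_outputs_within_def using t by auto
  qed
  ultimately show ?thesis
    unfolding polytime_computable_def by blast
qed


section \<open>Printing programs\<close>

definition cell :: "nat list \<Rightarrow> int \<Rightarrow> nat" where
  "cell W i = (if 0 \<le> i \<and> i < int (length W) then W ! nat i else 0)"

text \<open>Tapes 0 and 1 are ignored, tapes \<open>2, \<dots>, L - 1\<close> are copies of the word \<open>W\<close> whose heads serve
  as pointers into \<open>W\<close>, and tape \<open>L\<close> collects the output.\<close>

definition store ::
    "nat \<Rightarrow> (nat \<Rightarrow> tape) \<Rightarrow> nat list \<Rightarrow> (nat \<Rightarrow> int) \<Rightarrow> bool list \<Rightarrow> nat \<Rightarrow> tape" where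
  "store L X W ps out i =
     (if i < 2 then X i else if i < L then (cell W, ps i)
      else (word_contents out, int (length out)))"

definition move_head :: "nat \<Rightarrow> move \<Rightarrow> com" where
  "move_head j m = Act (\<lambda>i a _ _. (a, if i = j then m else Move_None))"

text \<open>All tapes from \<open>L\<close> on are written alike, in agreement with
  \<open>store\<close>, which assigns the output to each of them; the machine itself will have
  \<open>Suc L\<close> tapes.\<close>

definition put :: "nat \<Rightarrow> bool \<Rightarrow> com" where
  "put L b = Act (\<lambda>i a _ _.
     if L \<le> i then (if b then 2 else 1, Move_Right) else (a, Move_None))"

definition skip :: com where
  "skip = Act (\<lambda>i a _ _. (a, Move_None))"

lemma wf_basic [simp]:
  "wf_com N S (move_head j m)" "3 \<le> S \<Longrightarrow> wf_com N S (put L b)" "wf_com N S skip"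
  by (auto simp: move_head_def put_def skip_def)

lemma exec_Act_eq: "act_all g T = T' \<Longrightarrow> exec (Act g) T 1 T'"
  using exec.Act by auto

lemma exec_move_head:
  assumes "2 \<le> j" "j < L"
  shows "exec (move_head j m) (store L X W ps out) 1
    (store L X W (ps(j := ps j + head_shift m)) out)"
proof -
  have "act_all (\<lambda>i a _ _. (a, if i = j then m else Move_None)) (store L X W ps out) =
    store L X W (ps(j := ps j + head_shift m)) out"
  proof
    fix i
    show "act_all (\<lambda>i a _ _. (a, if i = j then m else Move_None)) (store L X W ps out) i =
      store L X W (ps(j := ps j + head_shift m)) out i"
      using assms by (cases "X i") (auto simp: act_all_def store_def)
  qed
  then show ?thesis
    unfolding move_head_def by (rule exec_Act_eq)
qed

lemma word_contents_snoc:
  "(word_contents out)(int (length out) := if b then 2 else 1) = word_contents (out @ [b])"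
  by (auto simp: word_contents_def fun_eq_iff nth_append)

lemma exec_put:
  assumes "2 \<le> L"
  shows "exec (put L b) (store L X W ps out) 1 (store L X W ps (out @ [b]))"
proof -
  have "act_all (\<lambda>i a _ _. if L \<le> i then (if b then 2 else 1, Move_Right) else (a, Move_None))
      (store L X W ps out) = store L X W ps (out @ [b])" (is "act_all ?g ?T = ?T'")
  proof
    fix i
    show "act_all ?g ?T i = ?T' i"
      using assms word_contents_snoc[of out b]
      by (cases "X i") (auto simp: act_all_def store_def)
  qed
  then show ?thesis
    unfolding put_def by (rule exec_Act_eq)
qed

lemma exec_skip: "exec skip T 1 T"
proof -
  have "act_all (\<lambda>i a _ _. (a, Move_None)) T = T"
    by (rule ext) (simp add: act_all_def act_tape_stay del: act_tape.simps)
  then show ?thesis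
    unfolding skip_def by (rule exec_Act_eq)
qed

lemma read_store [simp]: "2 \<le> j \<Longrightarrow> j < L \<Longrightarrow> read_tape (store L X W ps out j) = cell W (ps j)"
  by (simp add: store_def)

lemma cell_nth [simp]: "i < length W \<Longrightarrow> cell W (int i) = W ! i"
  by (simp add: cell_def)

text \<open>A round costs three steps: one for the move, two for the test and the jump back.\<close>

lemma exec_scan:
  assumes j: "2 \<le> j" "j < L"
    and "\<And>k. k < d \<Longrightarrow> cell W (ps j + int k * head_shift m) \<in> A"
    and "cell W (ps j + int d * head_shift m) \<notin> A"
  shows "exec (Loop j A (move_head j m)) (store L X W ps out) (3 * d + 1)
    (store L X W (ps(j := ps j + int d * head_shift m)) out)"
  using assms(3,4)
proof (induction d arbitrary: ps)
  case 0
  then show ?case using exec.Loop_False[of "store L X W ps out" j A] j by simp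
next
  case (Suc d)
  let ?ps = "ps(j := ps j + head_shift m)"
  have "exec (Loop j A (move_head j m)) (store L X W ?ps out) (3 * d + 1)
    (store L X W (?ps(j := ?ps j + int d * head_shift m)) out)"
  proof (rule Suc.IH)
    fix k assume "k < d"
    then show "cell W (?ps j + int k * head_shift m) \<in> A"
      using Suc.prems(1)[of "Suc k"] by (simp add: algebra_simps)
  next
    show "cell W (?ps j + int d * head_shift m) \<notin> A"
      using Suc.prems(2) by (simp add: algebra_simps)
  qed
  then have step: "exec (Loop j A (move_head j m)) (store L X W ps out) (1 + (3 * d + 1) + 2)
    (store L X W (?ps(j := ?ps j + int d * head_shift m)) out)"
    using Suc.prems(1)[of 0] j exec_move_head[OF j] by (intro exec.Loop_True) auto
  have "?ps(j := ?ps j + int d * head_shift m) = ps(j := ps j + int (Suc d) * head_shift m)"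
    by (simp add: algebra_simps)
  moreover have "1 + (3 * d + 1) + 2 = 3 * Suc d + 1"
    by simp
  ultimately show ?case using step by metis
qed

text \<open>A Hoare triple with a time bound: \<open>G\<close> is the effect on the heads and
  \<open>S\<close> the word appended to the output. The polynomial is fixed before tapes and heads
  are given, which is what makes the triples compose in loops. Excluding 0 from \<open>W\<close>
  lets a blank cell mark both ends of the word.\<close>

definition runs ::
    "nat \<Rightarrow> (nat list \<Rightarrow> (nat \<Rightarrow> int) \<Rightarrow> bool) \<Rightarrow> com \<Rightarrow>
     (nat list \<Rightarrow> (nat \<Rightarrow> int) \<Rightarrow> nat \<Rightarrow> int) \<Rightarrow> (nat list \<Rightarrow> (nat \<Rightarrow> int) \<Rightarrow> bool list) \<Rightarrow> bool" where
  "runs L P c G S \<longleftrightarrow> (\<exists>p :: nat poly. \<forall>X W ps out. 0 \<notin> set W \<and> P W ps \<longrightarrow>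
     (\<exists>t \<le> poly p (length W). exec c (store L X W ps out) t (store L X W (G W ps) (out @ S W ps))))"

abbreviation prints where
  "prints L P c S \<equiv> runs L P c (\<lambda>W ps. ps) S"

lemma runsI:
  assumes "\<And>X W ps out. 0 \<notin> set W \<Longrightarrow> P W ps \<Longrightarrow>
    \<exists>t \<le> poly p (length W). exec c (store L X W ps out) t (store L X W (G W ps) (out @ S W ps))"
  shows "runs L P c G S"
  unfolding runs_def using assms by blast

lemma runs_cong:
  assumes "runs L P c G S"
    and "\<And>W ps. 0 \<notin> set W \<Longrightarrow> Q W ps \<Longrightarrow> P W ps \<and> G' W ps = G W ps \<and> S' W ps = S W ps"
  shows "runs L Q c G' S'"
  using assms unfolding runs_def by (metis (no_types, lifting))

lemma runs_Then:
  assumes "runs L P c G S" "runs L Q d G' S'" "\<And>W ps. P W ps \<Longrightarrow> Q W (G W ps)"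
  shows "runs L P (Then c d) (\<lambda>W ps. G' W (G W ps)) (\<lambda>W ps. S W ps @ S' W (G W ps))"
proof -
  obtain p where p: "\<And>X W ps out. 0 \<notin> set W \<Longrightarrow> P W ps \<Longrightarrow>
    \<exists>t \<le> poly p (length W). exec c (store L X W ps out) t (store L X W (G W ps) (out @ S W ps))"
    using assms(1) unfolding runs_def by blast
  obtain q where q: "\<And>X W ps out. 0 \<notin> set W \<Longrightarrow> Q W ps \<Longrightarrow>
    \<exists>t \<le> poly q (length W). exec d (store L X W ps out) t (store L X W (G' W ps) (out @ S' W ps))"
    using assms(2) unfolding runs_def by blast
  show ?thesis
  proof (rule runsI[where p = "p + q"])
    fix X W ps out assume *: "0 \<notin> set W" "P W ps"
    obtain t where t: "t \<le> poly p (length W)"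
      "exec c (store L X W ps out) t (store L X W (G W ps) (out @ S W ps))"
      using p[OF *] by blast
    obtain t' where t': "t' \<le> poly q (length W)"
      "exec d (store L X W (G W ps) (out @ S W ps)) t'
        (store L X W (G' W (G W ps)) ((out @ S W ps) @ S' W (G W ps)))"
      using q[OF *(1) assms(3)[OF *(2)]] by blast
    show "\<exists>t \<le> poly (p + q) (length W). exec (Then c d) (store L X W ps out) t
        (store L X W (G' W (G W ps)) (out @ S W ps @ S' W (G W ps)))"
      using exec.Then[OF t(2) t'(2)] t(1) t'(1) by (intro exI[of _ "t + t'"]) auto
  qed
qed

lemma prints_Then:
  assumes "prints L P c S" "prints L P d S'"
  shows "prints L P (Then c d) (\<lambda>W ps. S W ps @ S' W ps)"
  using runs_Then[OF assms] by simp

lemma runs_move_head: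
  assumes "2 \<le> j" "j < L"
  shows "runs L P (move_head j m) (\<lambda>W ps. ps(j := ps j + head_shift m)) (\<lambda>W ps. [])"
  using exec_move_head[OF assms] by (intro runsI[where p = 1]) auto

lemma prints_put: "2 \<le> L \<Longrightarrow> prints L P (put L b) (\<lambda>W ps. [b])"
  using exec_put by (intro runsI[where p = 1]) auto

lemma prints_skip: "prints L P skip (\<lambda>W ps. [])"
  using exec_skip by (intro runsI[where p = 1]) auto

primrec put_word :: "nat \<Rightarrow> bool list \<Rightarrow> com" where
  "put_word L [] = skip"
| "put_word L (b # bs) = Then (put L b) (put_word L bs)"

lemma wf_put_word [simp]: "3 \<le> S \<Longrightarrow> wf_com N S (put_word L bs)"
  by (induction bs) auto

lemma prints_put_word:
  assumes "2 \<le> L"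
  shows "prints L P (put_word L bs) (\<lambda>W ps. bs)"
proof (induction bs)
  case Nil
  then show ?case by (simp add: prints_skip)
next
  case (Cons b bs)
  then show ?case using prints_Then[OF prints_put[OF assms] Cons] by simp
qed

lemma runs_scan:
  assumes j: "2 \<le> j" "j < L"
    and "\<And>W ps. 0 \<notin> set W \<Longrightarrow> P W ps \<Longrightarrow> \<exists>d \<le> length W + 1.
      (\<forall>k<d. cell W (ps j + int k * head_shift m) \<in> A) \<and>
      cell W (ps j + int d * head_shift m) \<notin> A \<and> q W ps = ps j + int d * head_shift m"
  shows "runs L P (Loop j A (move_head j m)) (\<lambda>W ps. ps(j := q W ps)) (\<lambda>W ps. [])"
\<comment> \<open>The scan takes \<open>3 * d + 1\<close> steps, and \<open>d\<close> is at most
  \<open>length W + 1\<close>.\<close>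
proof (rule runsI[where p = "[:4, 3:]"])
  fix X W and ps :: "nat \<Rightarrow> int" and out assume *: "0 \<notin> set W" "P W ps"
  obtain d where d: "d \<le> length W + 1" "\<forall>k<d. cell W (ps j + int k * head_shift m) \<in> A"
      "cell W (ps j + int d * head_shift m) \<notin> A" "q W ps = ps j + int d * head_shift m"
    using assms(3)[OF *] by blast
  show "\<exists>t \<le> poly [:4, 3:] (length W). exec (Loop j A (move_head j m)) (store L X W ps out) t
      (store L X W (ps(j := q W ps)) (out @ []))"
    using exec_scan[OF j, of d W ps m A X out] d by (intro exI[of _ "3 * d + 1"]) auto
qed


subsection \<open>Printing a variable\<close>

definition bit_sym :: "bool \<Rightarrow> nat" where
  "bit_sym b = (if b then 2 else 1)"

text \<open>In \<open>W\<close>, a variable is written as its bits followed by the symbol 3.\<close>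

definition var_at :: "nat list \<Rightarrow> nat \<Rightarrow> var" where
  "var_at W i = map (\<lambda>s. s = 2) (rev (takeWhile (\<lambda>s. s \<le> 2) (rev (take i W))))"

text \<open>This is \<open>enc_var\<close> without its final \<open>False\<close>. The name of an
  application contains encoded variables and is itself encoded as a variable, hence the words
  \<open>double (enc_var v)\<close> in the output.\<close>

definition double :: "bool list \<Rightarrow> bool list" where
  "double v = concat (map (\<lambda>b. [True, b]) v)"

lemma double_simps [simp]:
  "double [] = []" "double (b # v) = True # b # double v" "double (u @ v) = double u @ double v"
  by (auto simp: double_def)

lemma enc_var_eq: "enc_var v = double v @ [False]"
  unfolding enc_var_def by (induction v) auto

text \<open>The condition on \<open>last xs\<close> expresses maximality: walking left from the 3
  over bits, the head leaves the variable at a symbol above 2 or at the left end of the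
  word.\<close>

lemma var_at_split:
  assumes "i < length W" "W ! i = 3" "0 \<notin> set W"
  obtains xs ys where "W = xs @ map bit_sym (var_at W i) @ 3 # ys" "xs = [] \<or> 2 < last xs"
    "length xs + length (var_at W i) = i"
proof -
  define us where "us = rev (takeWhile (\<lambda>s. s \<le> 2) (rev (take i W)))"
  define xs where "xs = rev (dropWhile (\<lambda>s. s \<le> 2) (rev (take i W)))"
  have take: "take i W = xs @ us"
    unfolding us_def xs_def by (metis rev_append rev_rev_ident takeWhile_dropWhile_id)
  have "\<forall>s \<in> set us. s \<le> 2"
    unfolding us_def by (auto dest: set_takeWhileD)
  moreover have "\<forall>s \<in> set us. s \<noteq> 0"
    using take assms(3) by (metis in_set_takeD in_set_conv_decomp append_assoc append_Cons)
  ultimately have "map bit_sym (map (\<lambda>s. s = 2) us) = us"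
    by (induction us) (auto simp: bit_sym_def le_Suc_eq numeral_2_eq_2)
  then have us: "map bit_sym (var_at W i) = us"
    by (simp add: var_at_def us_def)
  have "W = take i W @ W ! i # drop (Suc i) W"
    using assms(1) by (simp add: id_take_nth_drop)
  then have "W = xs @ map bit_sym (var_at W i) @ 3 # drop (Suc i) W"
    using us take assms(2) by simp
  moreover have "xs = [] \<or> 2 < last xs"
    unfolding xs_def by (metis hd_dropWhile last_rev not_le rev_is_Nil_conv)
  moreover have "length xs + length (var_at W i) = i"
    using take us assms(1)
    by (metis length_append length_map length_take min.absorb4)
  ultimately show thesis using that by blast
qed

lemma var_at_append:
  assumes "xs = [] \<or> 2 < last xs"
  shows "var_at (xs @ map bit_sym v @ ys) (length xs + length v) = v"
proof -
  have "\<forall>s \<in> set (rev (map bit_sym v)). s \<le> 2"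
    by (auto simp: bit_sym_def)
  then have "takeWhile (\<lambda>s. s \<le> 2) (rev (map bit_sym v) @ rev xs) =
      rev (map bit_sym v) @ takeWhile (\<lambda>s. s \<le> 2) (rev xs)"
    by (intro takeWhile_append2) auto
  moreover have "takeWhile (\<lambda>s. s \<le> 2) (rev xs) = []"
    using assms by (cases xs rule: rev_cases) auto
  ultimately show ?thesis
    by (simp add: var_at_def rev_map[symmetric] comp_def bit_sym_def cong: if_cong)
qed

text \<open>Doubling \<open>[b]\<close> twice gives \<open>[True, True, True, b]\<close>, so only
  the fourth symbol depends on the tape.\<close>

definition put_bit :: "nat \<Rightarrow> nat \<Rightarrow> com" where
  "put_bit L j = Then (put_word L [True, True, True])
     (Then (Branch j {2} (put L True) (put L False)) (move_head j Move_Right))"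

lemma exec_put_bit:
  assumes "2 \<le> j" "j < L" "cell W (ps j) = bit_sym b"
  shows "\<exists>t \<le> 8. exec (put_bit L j) (store L X W ps out) t
    (store L X W (ps(j := ps j + 1)) (out @ [True, True, True, b]))"
proof -
  have L: "2 \<le> L" using assms by simp
  have 1: "exec (put_word L [True, True, True]) (store L X W ps out) (1 + (1 + (1 + 1)))
    (store L X W ps (((out @ [True]) @ [True]) @ [True]))" (is "exec _ _ _ (store L X W ps ?out)")
    unfolding put_word.simps
    by (rule exec.Then[OF exec_put[OF L] exec.Then[OF exec_put[OF L]
          exec.Then[OF exec_put[OF L] exec_skip]]])
  have 2: "\<exists>t \<le> 3. exec (Branch j {2} (put L True) (put L False)) (store L X W ps ?out) t
    (store L X W ps (?out @ [b]))"
  proof (cases b)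
    case True
    then have "exec (Branch j {2} (put L True) (put L False)) (store L X W ps ?out) (1 + 2)
        (store L X W ps (?out @ [True]))"
      using assms by (intro exec.Branch_True exec_put[OF L]) (auto simp: bit_sym_def)
    then show ?thesis using True by (intro exI[of _ "1 + 2"]) simp
  next
    case False
    then have "exec (Branch j {2} (put L True) (put L False)) (store L X W ps ?out) (1 + 1)
        (store L X W ps (?out @ [False]))"
      using assms by (intro exec.Branch_False exec_put[OF L]) (auto simp: bit_sym_def)
    then show ?thesis using False by (intro exI[of _ "1 + 1"]) simp
  qed
  then obtain t where t: "t \<le> 3" "exec (Branch j {2} (put L True) (put L False))
    (store L X W ps ?out) t (store L X W ps (?out @ [b]))" by blast
  have "exec (put_bit L j) (store L X W ps out) ((1 + (1 + (1 + 1))) + (t + 1))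
    (store L X W (ps(j := ps j + head_shift Move_Right)) (?out @ [b]))"
    unfolding put_bit_def by (intro exec.Then[OF 1] exec.Then[OF t(2)] exec_move_head assms(1,2))
  then show ?thesis using t(1) by (intro exI[of _ "(1 + (1 + (1 + 1))) + (t + 1)"]) auto
qed

text \<open>Each bit costs at most 8 steps for \<open>put_bit\<close> and 2 for the round of the
  loop.\<close>

lemma exec_put_bits:
  assumes j: "2 \<le> j" "j < L"
    and "W = xs @ map bit_sym v @ 3 # ys" "ps j = int (length xs)"
  shows "\<exists>t \<le> 10 * length v + 1. exec (Loop j {1, 2} (put_bit L j)) (store L X W ps out) t
    (store L X W (ps(j := int (length xs + length v))) (out @ double (double v)))"
  using assms(3,4)
proof (induction v arbitrary: xs ps out)
  case Nil
  have "cell W (ps j) = 3"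
    using Nil by simp
  then show ?case
    using Nil exec.Loop_False[of "store L X W ps out" j "{1, 2}"] j
    by (intro exI[of _ 1]) (simp add: fun_upd_idem)
next
  case (Cons b v)
  let ?ps = "ps(j := ps j + 1)"
  have cell: "cell W (ps j) = bit_sym b"
    using Cons.prems by (simp add: nth_append)
  obtain t where t: "t \<le> 8" "exec (put_bit L j) (store L X W ps out) t
    (store L X W ?ps (out @ [True, True, True, b]))"
    using exec_put_bit[where X = X and ps = ps and out = out, OF j cell] by blast
  have "W = (xs @ [bit_sym b]) @ map bit_sym v @ 3 # ys" "?ps j = int (length (xs @ [bit_sym b]))"
    using Cons.prems by simp_all
  from Cons.IH[of "xs @ [bit_sym b]" ?ps "out @ [True, True, True, b]", OF this]
  obtain t' where t': "t' \<le> 10 * length v + 1"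
    "exec (Loop j {1, 2} (put_bit L j)) (store L X W ?ps (out @ [True, True, True, b])) t'
      (store L X W (?ps(j := int (length (xs @ [bit_sym b]) + length v)))
        ((out @ [True, True, True, b]) @ double (double v)))"
    by blast
  have step: "exec (Loop j {1, 2} (put_bit L j)) (store L X W ps out) (t + t' + 2)
      (store L X W (?ps(j := int (length (xs @ [bit_sym b]) + length v)))
        ((out @ [True, True, True, b]) @ double (double v)))"
    using cell j by (intro exec.Loop_True[OF _ t(2) t'(2)]) (auto simp: bit_sym_def)
  have "?ps(j := int (length (xs @ [bit_sym b]) + length v)) = ps(j := int (length xs + length (b # v)))"
    "(out @ [True, True, True, b]) @ double (double v) = out @ double (double (b # v))"
    by auto
  note step = step[unfolded this]
  show ?case
  proof (intro exI conjI)
    show "t + t' + 2 \<le> 10 * length (b # v) + 1"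
      using t(1) t'(1) by simp
  qed (rule step)
qed

text \<open>The bits have to be printed from left to right, whereas the variable is found from its
  end. So the head goes back first and prints while it returns, which also restores its position on
  the 3. The last two symbols are the doubled end mark \<open>False\<close>.\<close>

definition put_var :: "nat \<Rightarrow> nat \<Rightarrow> com" where
  "put_var L j =
     Then (Then (move_head j Move_Left) (Loop j {1, 2} (move_head j Move_Left)))
      (Then (move_head j Move_Right)
        (Then (Loop j {1, 2} (put_bit L j)) (put_word L [True, False])))"

definition on_var :: "nat \<Rightarrow> nat list \<Rightarrow> (nat \<Rightarrow> int) \<Rightarrow> bool" where
  "on_var j W ps \<longleftrightarrow> (\<exists>i<length W. ps j = int i \<and> W ! i = 3)"

lemma prints_put_var:
  assumes j: "2 \<le> j" "j < L"
  shows "prints L (on_var j) (put_var L j) (\<lambda>W ps. double (enc_var (var_at W (nat (ps j)))))"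
proof (rule runsI[where p = "[:20, 20:]"])
  fix X W and ps :: "nat \<Rightarrow> int" and out assume *: "0 \<notin> set W" "on_var j W ps"
  then obtain i where i: "i < length W" "ps j = int i" "W ! i = 3"
    by (auto simp: on_var_def)
  define v where "v = var_at W i"
  obtain xs ys where W: "W = xs @ map bit_sym v @ 3 # ys" "xs = [] \<or> 2 < last xs"
    "length xs + length v = i"
    unfolding v_def using var_at_split[OF i(1,3) *(1)] by blast
  have L: "2 \<le> L" using j by simp
  have 1: "exec (move_head j Move_Left) (store L X W ps out) 1
      (store L X W (ps(j := int i - 1)) out)"
    using exec_move_head[OF j, of Move_Left X W ps] i by simp
  have 2: "exec (Loop j {1, 2} (move_head j Move_Left)) (store L X W (ps(j := int i - 1)) out)
      (3 * length v + 1) (store L X W (ps(j := int (length xs) - 1)) out)"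
  proof -
    have "cell W (int i - 1 - int k) \<in> {1, 2}" if "k < length v" for k
    proof -
      have "W ! (i - Suc k) = bit_sym (v ! (length v - Suc k))"
        using W that by (auto simp: nth_append)
      moreover have "int i - 1 - int k = int (i - Suc k)" "i - Suc k < length W"
        using W that i by auto
      ultimately show ?thesis by (simp only: cell_nth) (simp add: bit_sym_def)
    qed
    \<comment> \<open>For empty \<open>xs\<close> the head stands at -1, on a blank cell.\<close>
    moreover have "cell W (int (length xs) - 1) \<notin> {1, 2}"
    proof (cases xs rule: rev_cases)
      case Nil
      then show ?thesis by (simp add: cell_def)
    next
      case (snoc xs' x)
      then show ?thesis using W by (simp add: cell_def nth_append)
    qed
    moreover have "int i - 1 - int (length v) = int (length xs) - 1"
      using W by simp
    ultimately show ?thesis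
      using exec_scan[OF j, of "length v" W "ps(j := int i - 1)" Move_Left "{1, 2}" X out]
      by (simp add: W(3)[symmetric])
  qed
  have 3: "exec (move_head j Move_Right) (store L X W (ps(j := int (length xs) - 1)) out) 1
      (store L X W (ps(j := int (length xs))) out)"
    using exec_move_head[OF j, of Move_Right X W "ps(j := int (length xs) - 1)"] by simp
  obtain t where t: "t \<le> 10 * length v + 1" "exec (Loop j {1, 2} (put_bit L j))
      (store L X W (ps(j := int (length xs))) out) t (store L X W ps (out @ double (double v)))"
    using exec_put_bits[OF j W(1), of "ps(j := int (length xs))" X out] W(3) i(2)
    by (auto simp: fun_upd_idem)
  have 5: "exec (put_word L [True, False]) (store L X W ps (out @ double (double v))) (1 + (1 + 1))
      (store L X W ps (((out @ double (double v)) @ [True]) @ [False]))"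
    unfolding put_word.simps
    by (rule exec.Then[OF exec_put[OF L] exec.Then[OF exec_put[OF L] exec_skip]])
  have "exec (put_var L j) (store L X W ps out) ((1 + (3 * length v + 1)) + (1 + (t + (1 + (1 + 1)))))
      (store L X W ps (((out @ double (double v)) @ [True]) @ [False]))"
    unfolding put_var_def by (intro exec.Then[OF exec.Then[OF 1 2]] exec.Then[OF 3] exec.Then[OF t(2)] 5)
  moreover have "length v \<le> length W"
    using W(1) by simp
  ultimately show "\<exists>t \<le> poly [:20, 20:] (length W). exec (put_var L j) (store L X W ps out) t
      (store L X W ps (out @ double (enc_var (var_at W (nat (ps j))))))"
    using t(1) i(2) by (intro exI[of _ "(1 + (3 * length v + 1)) + (1 + (t + (1 + (1 + 1))))"])
      (auto simp: enc_var_eq v_def)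
qed


subsection \<open>Printing an argument of an atom\<close>

text \<open>In \<open>W\<close>, an atom is written as a marker greater than 3 followed by its arguments.\<close>

definition next3 :: "nat list \<Rightarrow> nat \<Rightarrow> nat" where
  "next3 W i = Suc i + length (takeWhile (\<lambda>s. s \<noteq> 3) (drop (Suc i) W))"

definition arg_pos :: "nat list \<Rightarrow> nat \<Rightarrow> nat \<Rightarrow> nat" where
  "arg_pos W i k = (next3 W ^^ Suc k) i"

text \<open>Besides the existence of the argument this says that \<open>i\<close> carries the last
  symbol above 3 before its end. A head that has moved to the argument can thus find the way back to
  its atom.\<close>

definition has_arg :: "nat list \<Rightarrow> nat \<Rightarrow> nat \<Rightarrow> bool" where
  "has_arg W i k \<longleftrightarrow> i < arg_pos W i k \<and> arg_pos W i k < length W \<and> 3 < W ! i \<and>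
     (\<forall>l. i < l \<and> l \<le> arg_pos W i k \<longrightarrow> W ! l \<le> 3)"

definition advance :: "nat \<Rightarrow> com" where
  "advance j = Then (move_head j Move_Right) (Loop j (- {0, 3}) (move_head j Move_Right))"

lemma next3_nth:
  assumes "next3 W i < length W"
  shows "W ! next3 W i = 3" "\<And>l. i < l \<Longrightarrow> l < next3 W i \<Longrightarrow> W ! l \<noteq> 3"
proof -
  let ?t = "takeWhile (\<lambda>s. s \<noteq> 3) (drop (Suc i) W)"
  have "length ?t < length (drop (Suc i) W)"
    using assms by (auto simp: next3_def)
  then have "drop (Suc i) W ! length ?t = 3"
    using nth_length_takeWhile[of "\<lambda>s. s \<noteq> 3" "drop (Suc i) W"] by simp
  then show "W ! next3 W i = 3"
    using assms by (auto simp: next3_def)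
  fix l assume l: "i < l" "l < next3 W i"
  then have k: "l - Suc i < length ?t"
    by (auto simp: next3_def)
  then have "?t ! (l - Suc i) = drop (Suc i) W ! (l - Suc i)"
    by (rule takeWhile_nth)
  moreover have "?t ! (l - Suc i) \<noteq> 3"
    using k nth_mem set_takeWhileD by fastforce
  ultimately show "W ! l \<noteq> 3"
    using l assms by simp
qed

lemma less_next3: "i < next3 W i"
  by (simp add: next3_def)

lemma runs_advance:
  assumes j: "2 \<le> j" "j < L"
  shows "runs L (\<lambda>W ps. \<exists>i. ps j = int i \<and> next3 W i < length W) (advance j)
    (\<lambda>W ps. ps(j := int (next3 W (nat (ps j))))) (\<lambda>W ps. [])"
proof -
  define P where "P W ps \<longleftrightarrow> (\<exists>i. ps j = int (Suc i) \<and> next3 W i < length W)"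
    for W and ps :: "nat \<Rightarrow> int"
  \<comment> \<open>The scan begins after one move to the right; subtracting 1 recovers the position
    from which \<open>next3\<close> counts.\<close>
  define q where "q W ps = int (next3 W (nat (ps j) - 1))" for W and ps :: "nat \<Rightarrow> int"
  have "runs L P (Loop j (- {0, 3}) (move_head j Move_Right)) (\<lambda>W ps. ps(j := q W ps)) (\<lambda>W ps. [])"
  proof (rule runs_scan[OF j])
    fix W and ps :: "nat \<Rightarrow> int" assume *: "0 \<notin> set W" "P W ps"
    then obtain i where i: "ps j = int (Suc i)" "next3 W i < length W"
      by (auto simp: P_def)
    define d where "d = next3 W i - Suc i"
    have d: "Suc i + d = next3 W i"
      using less_next3[of i W] by (simp add: d_def)
    have "cell W (ps j + int k * head_shift Move_Right) \<in> - {0, 3}" if "k < d" for k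
    proof -
      have "Suc i + k < length W"
        using that d i(2) by simp
      moreover have "W ! (Suc i + k) \<noteq> 3"
        using next3_nth(2)[OF i(2), of "Suc i + k"] that d by simp
      moreover have "W ! (Suc i + k) \<noteq> 0"
        using * calculation by (metis nth_mem)
      moreover have "ps j + int k * head_shift Move_Right = int (Suc i + k)"
        using i by simp
      ultimately show ?thesis by (simp only: cell_nth) simp
    qed
    moreover have pos: "ps j + int d * head_shift Move_Right = int (next3 W i)"
      using i d by simp
    moreover have "cell W (int (next3 W i)) = 3"
      using next3_nth(1)[OF i(2)] i(2) by simp
    moreover have "q W ps = int (next3 W i)"
      using i(1) by (simp add: q_def nat_add_distrib)
    ultimately show "\<exists>d \<le> length W + 1.
      (\<forall>k<d. cell W (ps j + int k * head_shift Move_Right) \<in> - {0, 3}) \<and>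
      cell W (ps j + int d * head_shift Move_Right) \<notin> - {0, 3} \<and>
      q W ps = ps j + int d * head_shift Move_Right"
      using d i(2) by (intro exI[of _ d]) auto
  qed
  from runs_Then[OF runs_move_head[OF j, where m = Move_Right] this,
      where P = "\<lambda>W ps. \<exists>i. ps j = int i \<and> next3 W i < length W"]
  have "runs L (\<lambda>W ps. \<exists>i. ps j = int i \<and> next3 W i < length W) (advance j)
      (\<lambda>W ps. (ps(j := ps j + 1))(j := q W (ps(j := ps j + 1)))) (\<lambda>W ps. [])"
    unfolding advance_def by (auto simp: P_def)
  moreover have "nat (1 + int i) = Suc i" for i
    by simp
  ultimately show ?thesis
    by (elim runs_cong) (auto simp: q_def nat_add_distrib)
qed

primrec goto_arg :: "nat \<Rightarrow> nat \<Rightarrow> com" where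
  "goto_arg j 0 = advance j"
| "goto_arg j (Suc k) = Then (goto_arg j k) (advance j)"

lemma runs_goto_arg:
  assumes j: "2 \<le> j" "j < L"
  shows "runs L (\<lambda>W ps. \<exists>i. ps j = int i \<and> arg_pos W i k < length W) (goto_arg j k)
    (\<lambda>W ps. ps(j := int (arg_pos W (nat (ps j)) k))) (\<lambda>W ps. [])"
proof (induction k)
  case 0
  show ?case
    by (rule runs_cong[OF runs_advance[OF j], folded goto_arg.simps]) (auto simp: arg_pos_def)
next
  case (Suc k)
  have Suc_pos: "arg_pos W i (Suc k) = next3 W (arg_pos W i k)" for W i
    by (simp add: arg_pos_def)
  have goto: "runs L (\<lambda>W ps. \<exists>i. ps j = int i \<and> arg_pos W i (Suc k) < length W) (goto_arg j k)
      (\<lambda>W ps. ps(j := int (arg_pos W (nat (ps j)) k))) (\<lambda>W ps. [])"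
    by (rule runs_cong[OF Suc]) (auto simp: Suc_pos intro: less_trans[OF less_next3])
  show ?case
    unfolding goto_arg.simps
    by (rule runs_cong[OF runs_Then[OF goto runs_advance[OF j]]]) (auto simp: Suc_pos fun_eq_iff)
qed

definition put_arg :: "nat \<Rightarrow> nat \<Rightarrow> nat \<Rightarrow> com" where
  "put_arg L j k =
     Then (goto_arg j k) (Then (put_var L j) (Loop j {1, 2, 3} (move_head j Move_Left)))"

lemma arg_pos_nth: "arg_pos W i k < length W \<Longrightarrow> W ! arg_pos W i k = 3"
  by (simp add: arg_pos_def next3_nth)

lemma prints_put_arg:
  assumes j: "2 \<le> j" "j < L"
  shows "prints L (\<lambda>W ps. \<exists>i. ps j = int i \<and> has_arg W i k) (put_arg L j k)
    (\<lambda>W ps. double (enc_var (var_at W (arg_pos W (nat (ps j)) k))))"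
proof -
  define P where "P W ps \<longleftrightarrow> (\<exists>i. ps j = int i \<and> has_arg W i k)" for W and ps :: "nat \<Rightarrow> int"
  define Q where "Q W ps \<longleftrightarrow> (\<exists>i. ps j = int (arg_pos W i k) \<and> has_arg W i k)"
    for W and ps :: "nat \<Rightarrow> int"
  \<comment> \<open>\<open>runs\<close> wants the final position as a function of word and heads,
    without reference to the \<open>i\<close> of the precondition; it is the last marker at or
    before the head.\<close>
  define q where "q W ps = int (GREATEST i. int i \<le> ps j \<and> 3 < W ! i)"
    for W :: "nat list" and ps :: "nat \<Rightarrow> int"
  have q: "q W ps = int i" if *: "ps j = int (arg_pos W i k)" "has_arg W i k"
    for W i and ps :: "nat \<Rightarrow> int"
  proof -
    have "(GREATEST i. int i \<le> ps j \<and> 3 < W ! i) = i"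
    proof (rule Greatest_equality)
      show "int i \<le> ps j \<and> 3 < W ! i"
        using that by (auto simp: has_arg_def)
      show "l \<le> i" if "int l \<le> ps j \<and> 3 < W ! l" for l
        using that * by (auto simp: has_arg_def not_less[symmetric])
    qed
    then show ?thesis by (simp add: q_def)
  qed
  have goto: "runs L P (goto_arg j k) (\<lambda>W ps. ps(j := int (arg_pos W (nat (ps j)) k))) (\<lambda>W ps. [])"
    by (rule runs_cong[OF runs_goto_arg[OF j]]) (auto simp: P_def has_arg_def)
  have var: "prints L Q (put_var L j) (\<lambda>W ps. double (enc_var (var_at W (nat (ps j)))))"
    by (rule runs_cong[OF prints_put_var[OF j]])
      (auto simp: Q_def on_var_def has_arg_def arg_pos_nth)
  have return: "runs L Q (Loop j {1, 2, 3} (move_head j Move_Left))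
      (\<lambda>W ps. ps(j := q W ps)) (\<lambda>W ps. [])"
  proof (rule runs_scan[OF j])
    fix W and ps :: "nat \<Rightarrow> int" assume *: "0 \<notin> set W" "Q W ps"
    then obtain i where i: "ps j = int (arg_pos W i k)" "has_arg W i k"
      by (auto simp: Q_def)
    define d where "d = arg_pos W i k - i"
    have d: "d + i = arg_pos W i k" "arg_pos W i k < length W"
      using i(2) by (auto simp: d_def has_arg_def)
    have "cell W (ps j + int l * head_shift Move_Left) \<in> {1, 2, 3}" if "l < d" for l
    proof -
      have l: "i < d + i - l" "d + i - l < length W" "d + i - l \<le> arg_pos W i k"
        using that d by auto
      then have "W ! (d + i - l) \<le> 3"
        using i(2) unfolding has_arg_def by blast
      moreover have "W ! (d + i - l) \<noteq> 0"
        using * l by (metis nth_mem)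
      moreover have "ps j + int l * head_shift Move_Left = int (d + i - l)"
        using i(1) d that by auto
      ultimately show ?thesis using l by (simp only: cell_nth) auto
    qed
    moreover have pos: "ps j + int d * head_shift Move_Left = int i"
      using i(1) d by simp
    moreover have "cell W (int i) \<notin> {1, 2, 3}"
      using i(2) by (auto simp: has_arg_def)
    moreover have "q W ps = int i"
      using q[of ps W i, OF i] .
    ultimately show "\<exists>d \<le> length W + 1.
      (\<forall>k<d. cell W (ps j + int k * head_shift Move_Left) \<in> {1, 2, 3}) \<and>
      cell W (ps j + int d * head_shift Move_Left) \<notin> {1, 2, 3} \<and>
      q W ps = ps j + int d * head_shift Move_Left"
      using d by (intro exI[of _ d]) auto
  qed
  have "runs L P (put_arg L j k)
     (\<lambda>W ps. (ps(j := int (arg_pos W (nat (ps j)) k)))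
        (j := q W (ps(j := int (arg_pos W (nat (ps j)) k)))))
     (\<lambda>W ps. [] @ double (enc_var (var_at W (nat ((ps(j := int (arg_pos W (nat (ps j)) k))) j)))) @ [])"
    unfolding put_arg_def
    by (rule runs_Then[OF goto runs_Then[OF var return]]) (auto simp: P_def Q_def)
  then show ?thesis
  proof (rule runs_cong)
    fix W and ps :: "nat \<Rightarrow> int" assume "\<exists>i. ps j = int i \<and> has_arg W i k"
    then obtain i where i: "ps j = int i" "has_arg W i k" by blast
    then show "P W ps \<and> ps = (ps(j := int (arg_pos W (nat (ps j)) k)))
        (j := q W (ps(j := int (arg_pos W (nat (ps j)) k)))) \<and>
      double (enc_var (var_at W (arg_pos W (nat (ps j)) k))) =
        [] @ double (enc_var (var_at W (nat ((ps(j := int (arg_pos W (nat (ps j)) k))) j)))) @ []"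
      using q[of "ps(j := int (arg_pos W i k))" W i] by (auto simp: P_def fun_upd_idem)
  qed
qed


subsection \<open>Loops over the positions of a word\<close>

definition positions :: "nat set \<Rightarrow> nat list \<Rightarrow> nat list" where
  "positions A W = filter (\<lambda>i. W ! i \<in> A) [0..<length W]"

definition rewind :: "nat \<Rightarrow> com" where
  "rewind j = Then (move_head j Move_Left)
     (Then (Loop j (- {0}) (move_head j Move_Left)) (move_head j Move_Right))"

definition each :: "nat \<Rightarrow> nat set \<Rightarrow> com \<Rightarrow> com" where
  "each j A c =
     Then (Loop j (- {0}) (Then (Branch j A c skip) (move_head j Move_Right))) (rewind j)"

lemma runs_rewind:
  assumes j: "2 \<le> j" "j < L"
  shows "runs L (\<lambda>W ps. ps j = int (length W)) (rewind j) (\<lambda>W ps. ps(j := 0)) (\<lambda>W ps. [])"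
proof -
  define P where "P W ps \<longleftrightarrow> ps j = int (length W) - 1" for W :: "nat list" and ps :: "nat \<Rightarrow> int"
  have scan: "runs L P (Loop j (- {0}) (move_head j Move_Left)) (\<lambda>W ps. ps(j := - 1)) (\<lambda>W ps. [])"
  proof (rule runs_scan[OF j])
    fix W and ps :: "nat \<Rightarrow> int" assume *: "0 \<notin> set W" "P W ps"
    have "cell W (ps j + int k * head_shift Move_Left) \<in> - {0}" if "k < length W" for k
    proof -
      have "ps j + int k * head_shift Move_Left = int (length W - Suc k)" "length W - Suc k < length W"
        using * that by (auto simp: P_def)
      then have "cell W (ps j + int k * head_shift Move_Left) = W ! (length W - Suc k)"
        by (simp only: cell_nth)
      then show ?thesis
        using \<open>length W - Suc k < length W\<close> * by (metis ComplI nth_mem singletonD)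
    qed
    then show "\<exists>d \<le> length W + 1. (\<forall>k<d. cell W (ps j + int k * head_shift Move_Left) \<in> - {0}) \<and>
      cell W (ps j + int d * head_shift Move_Left) \<notin> - {0} \<and>
      - 1 = ps j + int d * head_shift Move_Left"
      using * by (intro exI[of _ "length W"]) (auto simp: P_def cell_def)
  qed
  show ?thesis
    unfolding rewind_def
    by (rule runs_cong[OF runs_Then[OF runs_move_head[OF j, where P = "\<lambda>W ps. ps j = int (length W)"]
            runs_Then[OF scan runs_move_head[OF j, where P = "\<lambda>_ _. True"]]]])
      (auto simp: P_def)
qed

text \<open>The body has to restore all heads, so that each round differs from the previous one only
  in head \<open>j\<close>. The condition \<open>ps j = 0\<close> makes the final rewinding restore
  that head as well.\<close>

lemma prints_each:
  assumes j: "2 \<le> j" "j < L"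
    and c: "prints L Q c S"
    and PQ: "\<And>W ps i. P W ps \<Longrightarrow> i < length W \<Longrightarrow> W ! i \<in> A \<Longrightarrow> Q W (ps(j := int i))"
    and P0: "\<And>W ps. P W ps \<Longrightarrow> ps j = 0"
  shows "prints L P (each j A c)
    (\<lambda>W ps. concat (map (\<lambda>i. S W (ps(j := int i))) (positions A W)))"
proof -
  obtain p where p: "\<And>X W ps out. 0 \<notin> set W \<Longrightarrow> Q W ps \<Longrightarrow>
    \<exists>t \<le> poly p (length W). exec c (store L X W ps out) t (store L X W ps (out @ S W ps))"
    using c unfolding runs_def by blast
  let ?body = "Then (Branch j A c skip) (move_head j Move_Right)"
  let ?S = "\<lambda>W ps. concat (map (\<lambda>i. S W (ps(j := int i))) (positions A W))"
  have loop: "runs L P (Loop j (- {0}) ?body) (\<lambda>W ps. ps(j := int (length W))) ?S"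
  \<comment> \<open>One round per cell. Beyond the time of the body it takes at most 2 steps for the
    branch, 1 for the move and 2 for the loop.\<close>
  proof (rule runsI[where p = "[:0, 1:] * (p + [:5:]) + 1"])
    fix X W ps out assume *: "0 \<notin> set W" "P W ps"
    let ?s = "\<lambda>i out. store L X W (ps(j := int i)) out"
    have "\<exists>t \<le> d * (poly p (length W) + 5) + 1. exec (Loop j (- {0}) ?body) (?s i out) t
      (?s (length W) (out @ concat (map (\<lambda>i. S W (ps(j := int i)))
        (filter (\<lambda>i. W ! i \<in> A) [i..<length W]))))" if "i + d = length W" for i d out
      using that
    proof (induction d arbitrary: i out)
      case 0
      then show ?case
        using exec.Loop_False[of "?s i out" j "- {0}" ?body] j
        by (intro exI[of _ 1]) (simp add: cell_def fun_upd_def)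
    next
      case (Suc d)
      let ?o = "if W ! i \<in> A then S W (ps(j := int i)) else []"
      have i: "i < length W" using Suc.prems by simp
      have "\<exists>t \<le> poly p (length W) + 2. exec (Branch j A c skip) (?s i out) t (?s i (out @ ?o))"
      proof (cases "W ! i \<in> A")
        case True
        obtain t where t: "t \<le> poly p (length W)" "exec c (?s i out) t (?s i (out @ ?o))"
          using p[OF *(1) PQ[OF *(2) i True]] True by auto
        show ?thesis
          using exec.Branch_True[of "?s i out" j A c t _ skip, OF _ t(2)] t(1) True j i
          by (intro exI[of _ "t + 2"]) simp
      next
        case False
        then show ?thesis
          using exec.Branch_False[of "?s i out" j A skip 1 _ c, OF _ exec_skip] j i
          by (intro exI[of _ "1 + 1"]) simp
      qed
      then obtain t where t: "t \<le> poly p (length W) + 2"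
        "exec (Branch j A c skip) (?s i out) t (?s i (out @ ?o))" by blast
      have move: "exec (move_head j Move_Right) (?s i (out @ ?o)) 1 (?s (Suc i) (out @ ?o))"
        using exec_move_head[OF j, of Move_Right X W "ps(j := int i)" "out @ ?o"]
        by (simp add: add.commute)
      obtain t' where t': "t' \<le> d * (poly p (length W) + 5) + 1"
        "exec (Loop j (- {0}) ?body) (?s (Suc i) (out @ ?o)) t' (?s (length W) ((out @ ?o) @
          concat (map (\<lambda>i. S W (ps(j := int i))) (filter (\<lambda>i. W ! i \<in> A) [Suc i..<length W]))))"
        using Suc.IH[of "Suc i" "out @ ?o"] Suc.prems
        by (metis add_Suc_right add_Suc)
      have "read_tape (?s i out j) \<in> - {0}"
        using j i * by (auto simp: in_set_conv_nth)
      note step = exec.Loop_True[OF this exec.Then[OF t(2) move] t'(2)]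
      have "(out @ ?o) @ concat (map (\<lambda>i. S W (ps(j := int i)))
          (filter (\<lambda>i. W ! i \<in> A) [Suc i..<length W])) =
        out @ concat (map (\<lambda>i. S W (ps(j := int i))) (filter (\<lambda>i. W ! i \<in> A) [i..<length W]))"
        using i by (simp add: upt_conv_Cons)
      note step = step[unfolded this]
      show ?case
      proof (intro exI conjI)
        show "t + 1 + t' + 2 \<le> Suc d * (poly p (length W) + 5) + 1"
          using t(1) t'(1) by simp
      qed (rule step)
    qed
    from this[of 0 "length W" out]
    show "\<exists>t \<le> poly ([:0, 1:] * (p + [:5:]) + 1) (length W).
      exec (Loop j (- {0}) ?body) (store L X W ps out) t
        (store L X W (ps(j := int (length W))) (out @ ?S W ps))"
      using P0[OF *(2)] by (simp add: positions_def fun_upd_idem)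
  qed
  show ?thesis
    unfolding each_def
    by (rule runs_cong[OF runs_Then[OF loop runs_rewind[OF j]]]) (auto dest: P0 simp: fun_upd_idem)
qed

lemma wf_each [simp]: "wf_com N S c \<Longrightarrow> j < N \<Longrightarrow> wf_com N S (each j A c)"
  by (simp add: each_def rewind_def)

primrec nest :: "nat list \<Rightarrow> nat list \<Rightarrow> ((nat \<Rightarrow> int) \<Rightarrow> 'x list) \<Rightarrow> (nat \<Rightarrow> int) \<Rightarrow> 'x list" where
  "nest W [] f ps = f ps"
| "nest W (j # js) f ps = concat (map (\<lambda>i. nest W js f (ps(j := int i))) (positions {3} W))"

primrec each_list :: "nat list \<Rightarrow> com \<Rightarrow> com" where
  "each_list [] c = c"
| "each_list (j # js) c = each j {3} (each_list js c)"

lemma wf_each_list [simp]: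
  "wf_com N S c \<Longrightarrow> set js \<subseteq> {..<N} \<Longrightarrow> wf_com N S (each_list js c)"
  by (induction js) auto

text \<open>Each loop multiplies the running time by a factor linear in \<open>length W\<close>. The
  list \<open>js\<close> belongs to the program, so the bound remains polynomial.\<close>

lemma prints_each_list:
  assumes "distinct js" "set js \<subseteq> {2..<L}" "prints L Q c S"
    and "\<And>W ps. P W ps \<Longrightarrow> \<forall>j \<in> set js. ps j = 0"
    and "\<And>W ps \<sigma>. P W ps \<Longrightarrow> \<forall>j \<in> set js. \<sigma> j \<in> set (positions {3} W) \<Longrightarrow>
      Q W (\<lambda>j. if j \<in> set js then int (\<sigma> j) else ps j)"
  shows "prints L P (each_list js c) (\<lambda>W. nest W js (S W))"
  using assms
proof (induction js arbitrary: P)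
  case Nil
  then show ?case by (auto elim: runs_cong)
next
  case (Cons j js)
  \<comment> \<open>\<open>R\<close> describes the heads inside the outermost loop, where head
    \<open>j\<close> has left its start and the heads in \<open>js\<close> are still at 0.\<close>
  define R where "R W ps' \<longleftrightarrow> (\<exists>ps. \<exists>i \<in> set (positions {3} W). P W ps \<and> ps' = ps(j := int i))"
    for W and ps' :: "nat \<Rightarrow> int"
  have body: "prints L R (each_list js c) (\<lambda>W. nest W js (S W))"
  proof (rule Cons.IH)
    show "\<And>W ps. R W ps \<Longrightarrow> \<forall>j \<in> set js. ps j = 0"
      using Cons.prems(1,4) by (fastforce simp: R_def)
    fix W ps \<sigma>
    assume "R W ps" and \<sigma>: "\<forall>j \<in> set js. \<sigma> j \<in> set (positions {3} W)"
    then obtain ps' i where i: "i \<in> set (positions {3} W)" "P W ps'" "ps = ps'(j := int i)"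
      by (auto simp: R_def)
    have "Q W (\<lambda>k. if k \<in> set (j # js) then int ((\<sigma>(j := i)) k) else ps' k)"
      using i \<sigma> Cons.prems(1) by (intro Cons.prems(5)) auto
    also have "(\<lambda>k. if k \<in> set (j # js) then int ((\<sigma>(j := i)) k) else ps' k) =
        (\<lambda>k. if k \<in> set js then int (\<sigma> k) else ps k)"
      using i(3) Cons.prems(1) by auto
    finally show "Q W (\<lambda>k. if k \<in> set js then int (\<sigma> k) else ps k)" .
  qed (use Cons.prems in auto)
  have "prints L P (each j {3} (each_list js c)) (\<lambda>W ps. concat (map (\<lambda>i.
      nest W js (S W) (ps(j := int i))) (positions {3} W)))"
    using Cons.prems(2,4) by (intro prints_each[OF _ _ body]) (auto simp: R_def positions_def)
  then show ?case by simp
qed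

lemma concat_map_concat_map:
  "concat (map g (concat (map h xs))) = concat (map (\<lambda>x. concat (map g (h x))) xs)"
  by (induction xs) auto

lemma concat_map_nest:
  "concat (map g (nest W js f ps)) = nest W js (\<lambda>ps. concat (map g (f ps))) ps"
  by (induction js arbitrary: ps) (simp_all add: concat_map_concat_map)

text \<open>As the heads are distinct, no inner loop overwrites an outer head, and the loops range
  over all choices of a position for each head.\<close>

lemma set_nest:
  assumes "distinct js"
  shows "set (nest W js f ps) = (\<Union>\<sigma> \<in> {\<sigma>. \<forall>j \<in> set js. \<sigma> j \<in> set (positions {3} W)}.
    set (f (\<lambda>j. if j \<in> set js then int (\<sigma> j) else ps j)))"
  using assms
proof (induction js arbitrary: ps)
  case Nil
  then show ?case by auto
next
  case (Cons j js)
  have eq: "(\<lambda>k. if k \<in> set js then int (\<sigma> k) else (ps(j := int i)) k) =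
      (\<lambda>k. if k \<in> set (j # js) then int ((\<sigma>(j := i)) k) else ps k)" for \<sigma> i
    using Cons.prems by auto
  have upd: "(\<sigma>(j := i)) = \<sigma>" if "\<sigma> j = i" for \<sigma> :: "nat \<Rightarrow> nat" and i
    using that by auto
  have "set (nest W (j # js) f ps) = (\<Union>i \<in> set (positions {3} W). \<Union>\<sigma> \<in> {\<sigma>. \<forall>j \<in> set js.
      \<sigma> j \<in> set (positions {3} W)}. set (f (\<lambda>k. if k \<in> set (j # js) then int ((\<sigma>(j := i)) k) else ps k)))"
    using Cons by (simp add: eq del: set_simps)
  also have "\<dots> = (\<Union>\<sigma> \<in> {\<sigma>. \<forall>j \<in> set (j # js). \<sigma> j \<in> set (positions {3} W)}.
    set (f (\<lambda>k. if k \<in> set (j # js) then int (\<sigma> k) else ps k)))" (is "?A = ?B")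
  proof
    show "?A \<subseteq> ?B"
    proof
      fix x assume "x \<in> ?A"
      then obtain i \<sigma> where *: "i \<in> set (positions {3} W)" "\<forall>j \<in> set js. \<sigma> j \<in> set (positions {3} W)"
        "x \<in> set (f (\<lambda>k. if k \<in> set (j # js) then int ((\<sigma>(j := i)) k) else ps k))" by blast
      moreover have "\<forall>k \<in> set (j # js). (\<sigma>(j := i)) k \<in> set (positions {3} W)"
        using * by auto
      ultimately show "x \<in> ?B" by blast
    qed
    show "?B \<subseteq> ?A"
    proof
      fix x assume "x \<in> ?B"
      then obtain \<sigma> where *: "\<forall>k \<in> set (j # js). \<sigma> k \<in> set (positions {3} W)"
        "x \<in> set (f (\<lambda>k. if k \<in> set (j # js) then int (\<sigma> k) else ps k))" by blast
      then have "x \<in> set (f (\<lambda>k. if k \<in> set (j # js) then int ((\<sigma>(j := \<sigma> j)) k) else ps k))"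
        by (simp only: fun_upd_triv)
      moreover have "\<sigma> j \<in> set (positions {3} W)" "\<forall>k \<in> set js. \<sigma> k \<in> set (positions {3} W)"
        using * by auto
      ultimately show "x \<in> ?A" by blast
    qed
  qed
  finally show ?case .
qed


subsection \<open>Printing instances\<close>

text \<open>A reference denotes a variable of the input: the one that a given head points to, or an
  argument of the atom that head 2 points to.\<close>

datatype ref = Head nat | Arg nat

fun deref :: "nat list \<Rightarrow> (nat \<Rightarrow> int) \<Rightarrow> ref \<Rightarrow> var" where
  "deref W ps (Head j) = var_at W (nat (ps j))"
| "deref W ps (Arg k) = var_at W (arg_pos W (nat (ps 2)) k)"

fun ref_ok :: "nat \<Rightarrow> nat list \<Rightarrow> (nat \<Rightarrow> int) \<Rightarrow> ref \<Rightarrow> bool" where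
  "ref_ok L W ps (Head j) \<longleftrightarrow> on_var j W ps"
| "ref_ok L W ps (Arg k) \<longleftrightarrow> (\<exists>i. ps 2 = int i \<and> has_arg W i k)"

datatype seg = Const "bool list" | Ref ref

fun seg_out :: "nat list \<Rightarrow> (nat \<Rightarrow> int) \<Rightarrow> seg \<Rightarrow> bool list" where
  "seg_out W ps (Const bs) = bs"
| "seg_out W ps (Ref r) = double (enc_var (deref W ps r))"

fun put_seg :: "nat \<Rightarrow> seg \<Rightarrow> com" where
  "put_seg L (Const bs) = put_word L bs"
| "put_seg L (Ref (Head j)) = put_var L j"
| "put_seg L (Ref (Arg k)) = put_arg L 2 k"

definition heads_ok :: "nat \<Rightarrow> seg list \<Rightarrow> bool" where
  "heads_ok L ss \<longleftrightarrow> (\<forall>j. Ref (Head j) \<in> set ss \<longrightarrow> 2 \<le> j \<and> j < L)"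

primrec put_segs :: "nat \<Rightarrow> seg list \<Rightarrow> com" where
  "put_segs L [] = skip"
| "put_segs L (s # ss) = Then (put_seg L s) (put_segs L ss)"

lemma wf_put_seg [simp]:
  assumes "2 < L" "3 \<le> S" "\<forall>j. s = Ref (Head j) \<longrightarrow> j < L"
  shows "wf_com (Suc L) S (put_seg L s)"
proof -
  have var: "wf_com (Suc L) S (put_var L j)" if "j < L" for j
    using assms that by (simp add: put_var_def put_bit_def)
  have "wf_com (Suc L) S (goto_arg 2 k)" for k
    using assms by (induction k) (auto simp: advance_def)
  then show ?thesis
    using assms var by (cases "(L, s)" rule: put_seg.cases) (auto simp: put_arg_def)
qed

lemma wf_put_segs [simp]:
  "2 < L \<Longrightarrow> 3 \<le> S \<Longrightarrow> heads_ok L ss \<Longrightarrow> wf_com (Suc L) S (put_segs L ss)"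
  by (induction ss) (auto simp: heads_ok_def)

lemma prints_put_segs:
  assumes "2 < L" "heads_ok L ss"
  shows "prints L (\<lambda>W ps. \<forall>r. Ref r \<in> set ss \<longrightarrow> ref_ok L W ps r) (put_segs L ss)
    (\<lambda>W ps. concat (map (seg_out W ps) ss))"
  using assms(2)
proof (induction ss)
  case Nil
  then show ?case using prints_skip by simp
next
  case (Cons s ss)
  let ?P = "\<lambda>ss W ps. \<forall>r. Ref r \<in> set ss \<longrightarrow> ref_ok L W ps r"
  have "prints L (?P (s # ss)) (put_seg L s) (\<lambda>W ps. seg_out W ps s)"
  proof (cases "(L, s)" rule: put_seg.cases)
    case (1 L bs)
    then show ?thesis using prints_put_word assms(1) by simp
  next
    case (2 L' j)
    then have "prints L (on_var j) (put_seg L s) (\<lambda>W ps. seg_out W ps s)"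
      using prints_put_var[of j L] Cons.prems by (simp add: heads_ok_def)
    then show ?thesis
      using 2 by (elim runs_cong) auto
  next
    case (3 L' k)
    then have "prints L (\<lambda>W ps. \<exists>i. ps 2 = int i \<and> has_arg W i k) (put_seg L s)
        (\<lambda>W ps. seg_out W ps s)"
      using prints_put_arg[of 2 L] assms(1) by simp
    then show ?thesis
      using 3 by (elim runs_cong) auto
  qed
  moreover have "prints L (?P (s # ss)) (put_segs L ss) (\<lambda>W ps. concat (map (seg_out W ps) ss))"
    using Cons by (intro runs_cong[OF Cons.IH]) (auto simp: heads_ok_def)
  ultimately show ?case
    using prints_Then by fastforce
qed

definition emit :: "nat \<Rightarrow> nat set \<Rightarrow> nat list \<Rightarrow> seg list \<Rightarrow> com" where
  "emit L A js ss = each 2 A (each_list js (put_segs L ss))"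

text \<open>Blocks whose items mention no argument of an atom are run with \<open>A = {3}\<close>.
  Head 2 then walks over the variables and the items are repeated, which does no harm in a list of
  variables or a conjunction.\<close>

definition block :: "nat set \<Rightarrow> nat list \<Rightarrow> nat list \<Rightarrow> ((nat \<Rightarrow> int) \<Rightarrow> 'x list) \<Rightarrow> 'x list" where
  "block A js W f = concat (map (\<lambda>i. nest W js f ((\<lambda>_. 0)(2 := int i))) (positions A W))"

lemma concat_map_block:
  "concat (map g (block A js W f)) = block A js W (\<lambda>ps. concat (map g (f ps)))"
  by (simp add: block_def concat_map_concat_map concat_map_nest)

definition start :: "nat list \<Rightarrow> (nat \<Rightarrow> int) \<Rightarrow> bool" where
  "start W ps \<longleftrightarrow> ps = (\<lambda>_. 0)"

definition args_ok :: "nat set \<Rightarrow> seg list \<Rightarrow> nat list \<Rightarrow> bool" where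
  "args_ok A ss W \<longleftrightarrow>
     (\<forall>i \<in> set (positions A W). \<forall>k. Ref (Arg k) \<in> set ss \<longrightarrow> has_arg W i k)"

lemma prints_emit:
  assumes "2 < L" "distinct js" "set js \<subseteq> {3..<L}" "\<And>j. Ref (Head j) \<in> set ss \<Longrightarrow> j \<in> set js"
  shows "prints L (\<lambda>W ps. start W ps \<and> args_ok A ss W) (emit L A js ss)
    (\<lambda>W ps. block A js W (\<lambda>ps. concat (map (seg_out W ps) ss)))"
proof -
  define R where "R W ps \<longleftrightarrow> (\<exists>i \<in> set (positions A W). ps = (\<lambda>_. 0)(2 := int i) \<and> args_ok A ss W)"
    for W and ps :: "nat \<Rightarrow> int"
  have "heads_ok L ss"
    unfolding heads_ok_def using assms(3,4) by force
  have body: "prints L R (each_list js (put_segs L ss))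
      (\<lambda>W. nest W js (\<lambda>ps. concat (map (seg_out W ps) ss)))"
  proof (rule prints_each_list[OF assms(2) _ prints_put_segs[OF assms(1) \<open>heads_ok L ss\<close>]])
    show "set js \<subseteq> {2..<L}"
      using assms(3) by auto
    show "\<And>W ps. R W ps \<Longrightarrow> \<forall>j \<in> set js. ps j = 0"
      using assms(3) by (auto simp: R_def)
    show "\<forall>r. Ref r \<in> set ss \<longrightarrow> ref_ok L W (\<lambda>j. if j \<in> set js then int (\<sigma> j) else ps j) r"
      if *: "R W ps" "\<forall>j \<in> set js. \<sigma> j \<in> set (positions {3} W)" for W ps \<sigma>
    proof (intro allI impI)
      fix r assume r: "Ref r \<in> set ss"
      show "ref_ok L W (\<lambda>j. if j \<in> set js then int (\<sigma> j) else ps j) r"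
      proof (cases r)
        case (Head j)
        then show ?thesis using r * assms(4) by (auto simp: on_var_def positions_def)
      next
        case (Arg k)
        \<comment> \<open>The inner loops leave head 2 where it is, so it still points to the atom
          whose arguments are meant.\<close>
        have "2 \<notin> set js" using assms(3) by auto
        then show ?thesis using Arg r * by (auto simp: R_def args_ok_def)
      qed
    qed
  qed
  show ?thesis
    unfolding emit_def
    by (rule runs_cong[OF prints_each[OF _ assms(1) body,
            where P = "\<lambda>W ps. start W ps \<and> args_ok A ss W" and A = A]])
      (auto simp: R_def start_def positions_def block_def)
qed

lemma wf_emit [simp]:
  assumes "2 < L" "3 \<le> S" "set js \<subseteq> {3..<L}" "\<And>j. Ref (Head j) \<in> set ss \<Longrightarrow> j \<in> set js"
  shows "wf_com (Suc L) S (emit L A js ss)"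
proof -
  have "heads_ok L ss"
    unfolding heads_ok_def using assms(3,4) by force
  then show ?thesis
    using assms unfolding emit_def by (intro wf_each wf_each_list wf_put_segs) auto
qed


text \<open>\<open>j\<close> is the index of the encoding map.\<close>

definition app_name :: "nat \<Rightarrow> var list \<Rightarrow> var" where
  "app_name j vs = replicate j True @ False # concat (map enc_var vs)"

type_synonym fapp = "nat \<times> ref list"

definition instantiate :: "nat list \<Rightarrow> (nat \<Rightarrow> int) \<Rightarrow> fapp \<Rightarrow> var" where
  "instantiate W ps a = app_name (fst a) (map (deref W ps) (snd a))"

definition app_segs :: "fapp \<Rightarrow> seg list" where
  "app_segs a = Const (double (replicate (fst a) True @ [False])) # map Ref (snd a) @ [Const [False]]"

fun atom_segs :: "fapp atom \<Rightarrow> seg list" where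
  "atom_segs (Rel R as) = Const (True # replicate R True @ [False]) #
     concat (map (\<lambda>a. Const [True] # app_segs a) as) @ [Const [False]]"
| "atom_segs (Eq a b) = Const [False] # app_segs a @ app_segs b"

lemma double_concat: "double (concat vs) = concat (map double vs)"
  by (induction vs) auto

lemma app_segs_out: "concat (map (seg_out W ps) (app_segs a)) = enc_var (instantiate W ps a)"
  by (simp add: app_segs_def instantiate_def app_name_def enc_var_eq double_concat comp_def)

lemma enc_list_eq: "enc_list e xs = concat (map (\<lambda>x. True # e x) xs) @ [False]"
  by (induction xs) auto

lemma atom_segs_out:
  "concat (map (seg_out W ps) (atom_segs a)) = enc_atom (map_atom (instantiate W ps) a)"
  by (cases a) (simp_all add: enc_list_eq app_segs_out concat_map_concat_map comp_def)

text \<open>Every list entry carries its own leading \<open>True\<close>. Blocks can therefore be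
  printed one after the other, and the closing \<open>False\<close> is printed once at the
  end.\<close>

definition item_segs :: "('x \<Rightarrow> seg list) \<Rightarrow> 'x list \<Rightarrow> seg list" where
  "item_segs g xs = concat (map (\<lambda>x. Const [True] # g x) xs)"

definition app_refs :: "fapp atom \<Rightarrow> ref set" where
  "app_refs a = (\<Union>x \<in> set_atom a. set (snd x))"

lemma Ref_in_item_segs: "Ref r \<in> set (item_segs g xs) \<longleftrightarrow> (\<exists>x \<in> set xs. Ref r \<in> set (g x))"
  by (auto simp: item_segs_def)

lemma Ref_in_app_segs: "Ref r \<in> set (app_segs a) \<longleftrightarrow> r \<in> set (snd a)"
  by (auto simp: app_segs_def)

lemma Ref_in_atom_segs: "Ref r \<in> set (atom_segs a) \<longleftrightarrow> r \<in> app_refs a"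
  by (cases a) (auto simp: app_refs_def Ref_in_app_segs)

primrec put_blocks :: "nat \<Rightarrow> nat list \<Rightarrow> (nat set \<times> fapp atom list) list \<Rightarrow> com" where
  "put_blocks L js [] = put L False"
| "put_blocks L js (b # bs) =
     Then (emit L (fst b) js (item_segs atom_segs (snd b))) (put_blocks L js bs)"

definition put_instance ::
    "nat \<Rightarrow> nat list \<Rightarrow> fapp list \<Rightarrow> (nat set \<times> fapp atom list) list \<Rightarrow> com" where
  "put_instance L js as bs = Then (emit L {3} js (item_segs app_segs as))
     (Then (put L False) (put_blocks L js bs))"

definition inst_vars :: "nat list \<Rightarrow> fapp list \<Rightarrow> nat list \<Rightarrow> var list" where
  "inst_vars js as W = block {3} js W (\<lambda>ps. map (instantiate W ps) as)"

definition inst_atoms ::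
    "nat list \<Rightarrow> (nat set \<times> fapp atom list) list \<Rightarrow> nat list \<Rightarrow> var formula" where
  "inst_atoms js bs W =
     concat (map (\<lambda>b. block (fst b) js W (\<lambda>ps. map (map_atom (instantiate W ps)) (snd b))) bs)"

definition block_args_ok :: "nat list \<Rightarrow> nat set \<times> fapp atom list \<Rightarrow> bool" where
  "block_args_ok W b \<longleftrightarrow> (\<forall>i \<in> set (positions (fst b) W). \<forall>a \<in> set (snd b). \<forall>k.
     Arg k \<in> app_refs a \<longrightarrow> has_arg W i k)"

lemma prints_put_blocks:
  assumes "2 < L" "distinct js" "set js \<subseteq> {3..<L}"
    and "\<And>b a j. b \<in> set bs \<Longrightarrow> a \<in> set (snd b) \<Longrightarrow> Head j \<in> app_refs a \<Longrightarrow> j \<in> set js"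
  shows "prints L (\<lambda>W ps. start W ps \<and> (\<forall>b \<in> set bs. block_args_ok W b)) (put_blocks L js bs)
    (\<lambda>W ps. enc_formula (inst_atoms js bs W))"
  using assms(4)
proof (induction bs)
  case Nil
  then show ?case
    using prints_put assms(1) by (simp add: inst_atoms_def enc_formula_def)
next
  case (Cons b bs)
  let ?P = "\<lambda>bs W ps. start W ps \<and> (\<forall>b \<in> set bs. block_args_ok W b)"
  let ?ss = "item_segs atom_segs (snd b)"
  have b: "\<And>a j. a \<in> set (snd b) \<Longrightarrow> Head j \<in> app_refs a \<Longrightarrow> j \<in> set js"
    using Cons.prems[of b] by simp
  have "prints L (\<lambda>W ps. start W ps \<and> args_ok (fst b) ?ss W) (emit L (fst b) js ?ss)
      (\<lambda>W ps. block (fst b) js W (\<lambda>ps. concat (map (seg_out W ps) ?ss)))"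
    by (intro prints_emit assms(1-3)) (auto simp: Ref_in_item_segs Ref_in_atom_segs intro: b)
  then have 1: "prints L (?P (b # bs)) (emit L (fst b) js ?ss) (\<lambda>W ps. concat (map (\<lambda>a. True # enc_atom a)
      (block (fst b) js W (\<lambda>ps. map (map_atom (instantiate W ps)) (snd b)))))"
    by (rule runs_cong)
      (auto simp: args_ok_def block_args_ok_def Ref_in_item_segs Ref_in_atom_segs item_segs_def concat_map_block
        concat_map_concat_map atom_segs_out comp_def)
  have 2: "prints L (?P (b # bs)) (put_blocks L js bs) (\<lambda>W ps. enc_formula (inst_atoms js bs W))"
    using Cons by (intro runs_cong[OF Cons.IH]) auto
  show ?case
    using prints_Then[OF 1 2] by (simp add: inst_atoms_def enc_formula_def enc_list_eq)
qed

lemma prints_put_instance: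
  assumes "2 < L" "distinct js" "set js \<subseteq> {3..<L}"
    and "\<And>a r. a \<in> set as \<Longrightarrow> r \<in> set (snd a) \<Longrightarrow> r \<in> Head ` set js"
    and "\<And>b a j. b \<in> set bs \<Longrightarrow> a \<in> set (snd b) \<Longrightarrow> Head j \<in> app_refs a \<Longrightarrow> j \<in> set js"
  shows "prints L (\<lambda>W ps. start W ps \<and> (\<forall>b \<in> set bs. block_args_ok W b)) (put_instance L js as bs)
    (\<lambda>W ps. enc_cond_instance (inst_vars js as W) (inst_atoms js bs W))"
proof -
  let ?P = "\<lambda>W ps. start W ps \<and> (\<forall>b \<in> set bs. block_args_ok W b)"
  let ?ss = "item_segs app_segs as"
  have "prints L (\<lambda>W ps. start W ps \<and> args_ok {3} ?ss W) (emit L {3} js ?ss)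
      (\<lambda>W ps. block {3} js W (\<lambda>ps. concat (map (seg_out W ps) ?ss)))"
    using assms(4) by (intro prints_emit assms(1-3)) (fastforce simp: Ref_in_item_segs Ref_in_app_segs)
  then have 1: "prints L ?P (emit L {3} js ?ss)
      (\<lambda>W ps. concat (map (\<lambda>v. True # enc_var v) (inst_vars js as W)))"
    using assms(4)
    by (elim runs_cong) (fastforce simp: args_ok_def Ref_in_item_segs Ref_in_app_segs item_segs_def concat_map_block
        concat_map_concat_map app_segs_out comp_def inst_vars_def)
  have 2: "prints L ?P (put L False) (\<lambda>W ps. [False])"
    using prints_put assms(1) by simp
  show ?thesis
    using prints_Then[OF 1 prints_Then[OF 2 prints_put_blocks[OF assms(1-3,5)]]]
    by (simp add: put_instance_def enc_cond_instance_def enc_list_eq)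
qed

lemma wf_put_instance:
  assumes "2 < L" "3 \<le> S" "set js \<subseteq> {3..<L}"
    and "\<And>a r. a \<in> set as \<Longrightarrow> r \<in> set (snd a) \<Longrightarrow> r \<in> Head ` set js"
    and "\<And>b a j. b \<in> set bs \<Longrightarrow> a \<in> set (snd b) \<Longrightarrow> Head j \<in> app_refs a \<Longrightarrow> j \<in> set js"
  shows "wf_com (Suc L) S (put_instance L js as bs)"
proof -
  have "wf_com (Suc L) S (emit L {3} js (item_segs app_segs as))"
    using assms(4) by (intro wf_emit assms(1-3)) (fastforce simp: Ref_in_item_segs Ref_in_app_segs)
  moreover have "wf_com (Suc L) S (put_blocks L js bs)"
    using assms(5)
  proof (induction bs)
    case (Cons b bs)
    have "wf_com (Suc L) S (emit L (fst b) js (item_segs atom_segs (snd b)))"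
      using Cons.prems[of b]
      by (intro wf_emit assms(1-3)) (simp_all add: Ref_in_item_segs Ref_in_atom_segs, blast)
    then show ?case using Cons by auto
  qed (use assms(2) in simp)
  ultimately show ?thesis using assms(2) by (simp add: put_instance_def)
qed


section \<open>Parsing the input\<close>

text \<open>Over a fixed finite signature the encodings of formulas form a regular language. The state
  \<open>Args k\<close> expects \<open>k\<close> more arguments of a relation symbol. In \<open>Var l k\<close> and \<open>Bit l k\<close> the
  automaton is inside a variable, after which \<open>k\<close> more follow; the flag \<open>l\<close> distinguishes argument
  lists from equalities.\<close>

datatype dst =
  Items | Stop | Fail | Kind | Symb nat | Args nat | Var bool nat | Bit bool nat

instance dst :: countable
  by countable_datatype

definition after_var :: "bool \<Rightarrow> nat \<Rightarrow> dst" where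
  "after_var l k = (if l then Args k else if k = 0 then Items else Var False (k - 1))"

text \<open>The second component is the symbol written next, 0 standing for none.\<close>

fun dfa :: "nat set \<Rightarrow> (nat \<Rightarrow> nat) \<Rightarrow> dst \<Rightarrow> bool \<Rightarrow> dst \<times> nat" where
  "dfa Rs ar Items b = (if b then Kind else Stop, 0)"
| "dfa Rs ar Stop b = (Fail, 0)"
| "dfa Rs ar Fail b = (Fail, 0)"
| "dfa Rs ar Kind b = (if b then (Symb 0, 0) else (Var False 1, 4))"
| "dfa Rs ar (Symb r) b =
     (if b then (if \<exists>R \<in> Rs. r < R then Symb (Suc r) else Fail, 0)
      else if r \<in> Rs then (Args (ar r), 5 + r) else (Fail, 0))"
| "dfa Rs ar (Args k) b =
     (if b then if k = 0 then Fail else Var True (k - 1) else if k = 0 then Items else Fail, 0)"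
| "dfa Rs ar (Var l k) b = (if b then (Bit l k, 0) else (after_var l k, 3))"
| "dfa Rs ar (Bit l k) b = (Var l k, bit_sym b)"

fun dfa_end :: "nat set \<Rightarrow> (nat \<Rightarrow> nat) \<Rightarrow> dst \<Rightarrow> bool list \<Rightarrow> dst" where
  "dfa_end Rs ar q [] = q"
| "dfa_end Rs ar q (b # w) = dfa_end Rs ar (fst (dfa Rs ar q b)) w"

definition token :: "nat \<Rightarrow> nat list" where
  "token e = (if e = 0 then [] else [e])"

fun dfa_out :: "nat set \<Rightarrow> (nat \<Rightarrow> nat) \<Rightarrow> dst \<Rightarrow> bool list \<Rightarrow> nat list" where
  "dfa_out Rs ar q [] = []"
| "dfa_out Rs ar q (b # w) = token (snd (dfa Rs ar q b)) @ dfa_out Rs ar (fst (dfa Rs ar q b)) w"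

lemma length_dfa_out: "length (dfa_out Rs ar q w) \<le> length w"
proof (induction w arbitrary: q)
  case (Cons b w)
  then show ?case using Cons[of "fst (dfa Rs ar q b)"] by (auto simp: token_def intro: le_SucI)
qed simp

lemma dfa_out_nonzero: "0 \<notin> set (dfa_out Rs ar q w)"
  by (induction w arbitrary: q) (auto simp: token_def)

definition var_tok :: "var \<Rightarrow> nat list" where
  "var_tok v = map bit_sym v @ [3]"

fun atom_tok :: "var atom \<Rightarrow> nat list" where
  "atom_tok (Rel R vs) = (5 + R) # concat (map var_tok vs)"
| "atom_tok (Eq u v) = 4 # var_tok u @ var_tok v"

text \<open>The leading 3 adds the variable \<open>[]\<close>, so that the set of variables is never empty.\<close>

definition word_of :: "var formula \<Rightarrow> nat list" where
  "word_of \<phi> = 3 # concat (map atom_tok \<phi>)"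

lemma dfa_var:
  "dfa_end Rs ar (Var l k) (enc_var v @ w) = dfa_end Rs ar (after_var l k) w"
  "dfa_out Rs ar (Var l k) (enc_var v @ w) = var_tok v @ dfa_out Rs ar (after_var l k) w"
  by (induction v) (auto simp: enc_var_def var_tok_def token_def bit_sym_def)

lemma dfa_args:
  "dfa_end Rs ar (Args (length vs)) (enc_list enc_var vs @ w) = dfa_end Rs ar Items w"
  "dfa_out Rs ar (Args (length vs)) (enc_list enc_var vs @ w) =
     concat (map var_tok vs) @ dfa_out Rs ar Items w"
  by (induction vs) (auto simp: dfa_var token_def after_var_def)

lemma dfa_symb:
  assumes "r + n \<in> Rs"
  shows "dfa_end Rs ar (Symb r) (replicate n True @ False # w) = dfa_end Rs ar (Args (ar (r + n))) w"
    and "dfa_out Rs ar (Symb r) (replicate n True @ False # w) =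
      (5 + (r + n)) # dfa_out Rs ar (Args (ar (r + n))) w"
  using assms by (induction n arbitrary: r) (auto simp: token_def)

lemma dfa_formula:
  assumes "formula_over \<D> \<phi>"
  shows "dfa_end (symbols \<D>) (arity \<D>) Items (enc_formula \<phi>) = Stop"
    and "dfa_out (symbols \<D>) (arity \<D>) Items (enc_formula \<phi>) = concat (map atom_tok \<phi>)"
proof -
  have "dfa_end (symbols \<D>) (arity \<D>) Items (enc_formula \<phi>) = Stop \<and>
    dfa_out (symbols \<D>) (arity \<D>) Items (enc_formula \<phi>) = concat (map atom_tok \<phi>)"
    using assms
  proof (induction \<phi>)
    case Nil
    then show ?case by (simp add: enc_formula_def token_def)
  next
    case (Cons a \<phi>)
    then have a: "atom_over \<D> a" by (simp add: formula_over_def)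
    have "dfa_end (symbols \<D>) (arity \<D>) Kind (enc_atom a @ w) = dfa_end (symbols \<D>) (arity \<D>) Items w
      \<and> dfa_out (symbols \<D>) (arity \<D>) Kind (enc_atom a @ w) =
        atom_tok a @ dfa_out (symbols \<D>) (arity \<D>) Items w" for w
    proof (cases a)
      case (Rel R vs)
      then have "R \<in> symbols \<D>" "arity \<D> R = length vs"
        using a by auto
      then show ?thesis
        using Rel by (simp add: dfa_symb[of 0, simplified] dfa_args token_def)
    next
      case (Eq u v)
      then show ?thesis by (simp add: dfa_var token_def after_var_def)
    qed
    then show ?case
      using Cons by (simp add: enc_formula_def formula_over_def token_def)
  qed
  then show "dfa_end (symbols \<D>) (arity \<D>) Items (enc_formula \<phi>) = Stop"
    "dfa_out (symbols \<D>) (arity \<D>) Items (enc_formula \<phi>) = concat (map atom_tok \<phi>)" by auto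
qed

lemma dfa_end_Fail [simp]: "dfa_end Rs ar Fail w = Fail"
  by (induction w) auto

lemma dfa_end_Stop: "dfa_end Rs ar Stop w = Stop \<longleftrightarrow> w = []"
  by (cases w) auto

lemma dfa_var_conv:
  assumes "dfa_end Rs ar (Var l k) w = Stop"
  shows "\<exists>v w'. w = enc_var v @ w' \<and> dfa_end Rs ar (after_var l k) w' = Stop"
  using assms
\<comment> \<open>A bit of a variable takes two symbols of the word, hence the induction on the
  length.\<close>
proof (induction w rule: length_induct)
  case (1 w)
  show ?case
  proof (cases w)
    case (Cons b u)
    show ?thesis
    proof (cases b)
      case True
      then obtain c u' where u: "u = c # u'" "dfa_end Rs ar (Var l k) u' = Stop"
        using 1(2) Cons by (cases u) auto
      then obtain v w' where "u' = enc_var v @ w'" "dfa_end Rs ar (after_var l k) w' = Stop"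
        using 1(1)[rule_format, of u'] Cons by auto
      then show ?thesis
        using Cons True u by (intro exI[of _ "c # v"] exI[of _ w']) (auto simp: enc_var_def)
    next
      case False
      then show ?thesis using 1(2) Cons by (intro exI[of _ "[]"] exI[of _ u]) (auto simp: enc_var_def)
    qed
  qed (use 1 in simp)
qed

lemma dfa_args_conv:
  assumes "dfa_end Rs ar (Args k) w = Stop"
  shows "\<exists>vs w'. length vs = k \<and> w = enc_list enc_var vs @ w' \<and> dfa_end Rs ar Items w' = Stop"
  using assms
proof (induction k arbitrary: w)
  case 0
  then show ?case by (cases w) (auto split: if_splits)
next
  case (Suc k)
  then obtain u where u: "w = True # u" "dfa_end Rs ar (Var True k) u = Stop"
    by (cases w) (auto split: if_splits)
  then obtain v u' where v: "u = enc_var v @ u'" "dfa_end Rs ar (Args k) u' = Stop"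
    using dfa_var_conv by (fastforce simp: after_var_def)
  then obtain vs w' where "length vs = k" "u' = enc_list enc_var vs @ w'" "dfa_end Rs ar Items w' = Stop"
    using Suc.IH by blast
  then show ?case using u v by (intro exI[of _ "v # vs"]) auto
qed

lemma dfa_symb_conv:
  assumes "dfa_end Rs ar (Symb r) w = Stop"
  shows "\<exists>n w'. r + n \<in> Rs \<and> w = replicate n True @ False # w' \<and>
    dfa_end Rs ar (Args (ar (r + n))) w' = Stop"
  using assms
proof (induction w arbitrary: r)
  case (Cons b w)
  show ?case
  proof (cases b)
    case True
    then have "dfa_end Rs ar (Symb (Suc r)) w = Stop"
      using Cons.prems by (auto split: if_splits)
    then obtain n w' where "Suc r + n \<in> Rs" "w = replicate n True @ False # w'"
      "dfa_end Rs ar (Args (ar (Suc r + n))) w' = Stop"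
      using Cons.IH by blast
    then show ?thesis using True by (intro exI[of _ "Suc n"]) auto
  next
    case False
    then show ?thesis
      using Cons.prems by (intro exI[of _ 0]) (auto split: if_splits)
  qed
qed simp

text \<open>With \<open>dfa_formula\<close> this makes reaching \<open>Stop\<close> an exact test
  for encodings of formulas. All other words have to be sent to a no-instance.\<close>

lemma dfa_formula_conv:
  assumes "dfa_end (symbols \<D>) (arity \<D>) Items w = Stop"
  shows "\<exists>\<phi>. formula_over \<D> \<phi> \<and> w = enc_formula \<phi>"
  using assms
proof (induction w rule: length_induct)
  case (1 w)
  let ?end = "dfa_end (symbols \<D>) (arity \<D>)"
  show ?case
  proof (cases w)
    case (Cons b u)
    show ?thesis
    proof (cases b)
      case True
      have "\<exists>a w'. atom_over \<D> a \<and> u = enc_atom a @ w' \<and> ?end Items w' = Stop"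
      proof (cases u)
        case Nil
        then show ?thesis using 1(2) Cons True by simp
      next
        case (Cons c x)
        show ?thesis
        proof (cases c)
          case True
          then have "?end (Symb 0) x = Stop"
            using 1(2) \<open>w = b # u\<close> \<open>b\<close> Cons by simp
          then obtain R y where R: "R \<in> symbols \<D>" "x = replicate R True @ False # y"
            "?end (Args (arity \<D> R)) y = Stop"
            using dfa_symb_conv by fastforce
          then obtain vs w' where "length vs = arity \<D> R" "y = enc_list enc_var vs @ w'"
            "?end Items w' = Stop"
            using dfa_args_conv by blast
          then show ?thesis
            using R Cons True by (intro exI[of _ "Rel R vs"]) auto
        next
          case False
          then have "?end (Var False 1) x = Stop"
            using 1(2) \<open>w = b # u\<close> \<open>b\<close> Cons by simp
          then obtain v y where v: "x = enc_var v @ y" "?end (Var False 0) y = Stop"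
            using dfa_var_conv by (fastforce simp: after_var_def)
          then obtain v' w' where "y = enc_var v' @ w'" "?end Items w' = Stop"
            using dfa_var_conv by (fastforce simp: after_var_def)
          then show ?thesis
            using v Cons False by (intro exI[of _ "Eq v v'"]) auto
        qed
      qed
      then obtain a w' where a: "atom_over \<D> a" "u = enc_atom a @ w'" "?end Items w' = Stop"
        by blast
      then obtain \<phi> where "formula_over \<D> \<phi>" "w' = enc_formula \<phi>"
        using 1(1)[rule_format, of w'] Cons by auto
      then show ?thesis
        using a Cons True
        by (intro exI[of _ "a # \<phi>"]) (auto simp: formula_over_def enc_formula_def)
    next
      case False
      then show ?thesis
        using 1(2) Cons
        by (intro exI[of _ "[]"]) (auto simp: formula_over_def enc_formula_def dfa_end_Stop)
    qed
  qed (use 1 in simp)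
qed

text \<open>The counters of reachable states are bounded: \<open>Symb\<close> fails beyond the
  largest symbol, and \<open>Args\<close> starts at an arity and only decreases. The bound
  \<open>S\<close> serves as the size of the tape alphabet, because a state is kept as a single
  symbol on tape 1.\<close>

lemma dfa_bounded:
  assumes "finite Rs"
  obtains S where "\<And>q w. \<exists>w'. q = dfa_end Rs ar Items w' \<Longrightarrow> to_nat q < S"
    and "\<And>q b. \<exists>w'. q = dfa_end Rs ar Items w' \<Longrightarrow> snd (dfa Rs ar q b) < S" "4 \<le> S"
proof -
  obtain m where m: "\<And>R. R \<in> Rs \<Longrightarrow> R \<le> m \<and> ar R \<le> m" "1 \<le> m"
  proof -
    have "finite (insert 1 (Rs \<union> ar ` Rs))"
      using assms by simp
    then obtain m where "\<forall>x \<in> insert 1 (Rs \<union> ar ` Rs). x \<le> m"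
      by (meson finite_nat_set_iff_bounded_le)
    then show thesis using that by auto
  qed
  define Q where "Q = {Items, Stop, Fail, Kind} \<union> Symb ` {..m} \<union> Args ` {..m} \<union>
    case_prod Var ` (UNIV \<times> {..m}) \<union> case_prod Bit ` (UNIV \<times> {..m})"
  have step: "fst (dfa Rs ar q b) \<in> Q" if "q \<in> Q" for q b
  proof -
    have var: "Var l k \<in> Q" "Bit l k \<in> Q" "Args k \<in> Q" "Symb k \<in> Q" if "k \<le> m" for l k
      using that by (auto simp: Q_def image_iff)
    have const: "Items \<in> Q" "Stop \<in> Q" "Fail \<in> Q" "Kind \<in> Q"
      by (auto simp: Q_def)
    show ?thesis
    proof (cases q)
      case (Symb r)
      have "Suc r \<le> m" if "\<exists>R \<in> Rs. r < R"
        using that m(1) by (meson Suc_leI le_trans)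
      moreover have "ar r \<le> m" if "r \<in> Rs"
        using that m(1) by blast
      ultimately show ?thesis using var const Symb by simp
    next
      case (Args k)
      then have "k - 1 \<le> m" using that by (auto simp: Q_def)
      then show ?thesis using Args var const by simp
    next
      case (Var l k)
      then have "k \<le> m" using that by (auto simp: Q_def)
      then show ?thesis using Var var const by (simp add: after_var_def)
    next
      case (Bit l k)
      then have "k \<le> m" using that by (auto simp: Q_def)
      then show ?thesis using Bit var by simp
    qed (use var const m(2) in simp_all)
  qed
  have reach: "dfa_end Rs ar q w \<in> Q" if "q \<in> Q" for q w
    using that by (induction w arbitrary: q) (auto intro: step)
  have "finite Q"
    by (simp add: Q_def)
  then have "finite (to_nat ` Q)"
    by simp
  then obtain S where S: "\<forall>q \<in> Q. to_nat q < S"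
    unfolding finite_nat_set_iff_bounded by blast
  show thesis
  proof
    fix q assume "\<exists>w'. q = dfa_end Rs ar Items w'"
    then have q: "q \<in> Q" using reach[of Items] by (auto simp: Q_def)
    then show "to_nat q < S + m + 6" using S by auto
    show "snd (dfa Rs ar q b) < S + m + 6" for b
    proof (cases q)
      case (Symb r)
      then show ?thesis using m(1)[of r] by (cases "r \<in> Rs") auto
    qed (simp_all add: bit_sym_def)
  qed simp
qed

section \<open>The parsing pass as a machine\<close>

definition all_left :: "nat \<Rightarrow> com" where
  "all_left L = Act (\<lambda>i a _ _. (a, if 2 \<le> i \<and> i < L then Move_Left else Move_None))"

definition all_right :: "nat \<Rightarrow> com" where
  "all_right L = Act (\<lambda>i a _ _. (a, if 2 \<le> i \<and> i < L then Move_Right else Move_None))"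

lemma exec_all_left:
  "exec (all_left L) (store L X W (\<lambda>_. p) out) 1 (store L X W (\<lambda>_. p - 1) out)"
proof -
  have "act_all (\<lambda>i a _ _. (a, if 2 \<le> i \<and> i < L then Move_Left else Move_None))
      (store L X W (\<lambda>_. p) out) = store L X W (\<lambda>_. p - 1) out" (is "?l = ?r")
  proof
    show "?l i = ?r i" for i
      by (cases "X i") (auto simp: act_all_def store_def)
  qed
  then show ?thesis unfolding all_left_def by (rule exec_Act_eq)
qed

lemma exec_all_right:
  "exec (all_right L) (store L X W (\<lambda>_. p) out) 1 (store L X W (\<lambda>_. p + 1) out)"
proof -
  have "act_all (\<lambda>i a _ _. (a, if 2 \<le> i \<and> i < L then Move_Right else Move_None))
      (store L X W (\<lambda>_. p) out) = store L X W (\<lambda>_. p + 1) out" (is "?l = ?r")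
  proof
    show "?l i = ?r i" for i
      by (cases "X i") (auto simp: act_all_def store_def)
  qed
  then show ?thesis unfolding all_right_def by (rule exec_Act_eq)
qed

text \<open>The copies are written in step, so a test of tape 2 alone tells when all their heads
  have arrived.\<close>

definition rewind_all :: "nat \<Rightarrow> com" where
  "rewind_all L = Then (all_left L) (Then (Loop 2 (- {0}) (all_left L)) (all_right L))"

lemma exec_rewind_all:
  assumes "2 < L" "0 \<notin> set W"
  shows "exec (rewind_all L) (store L X W (\<lambda>_. int (length W)) out)
    (3 * length W + 3) (store L X W (\<lambda>_. 0) out)"
proof -
  have "exec (Loop 2 (- {0}) (all_left L)) (store L X W (\<lambda>_. int d - 1) out)
    (3 * d + 1) (store L X W (\<lambda>_. - 1) out)" if "d \<le> length W" for d
    using that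
  proof (induction d)
    case 0
    then show ?case
      using exec.Loop_False[of "store L X W (\<lambda>_. - 1) out" 2 "- {0}"] assms(1)
      by (simp add: cell_def)
  next
    case (Suc d)
    have 1: "exec (all_left L) (store L X W (\<lambda>_. int (Suc d) - 1) out) 1
        (store L X W (\<lambda>_. int d - 1) out)"
      using exec_all_left[of L X W "int d" out] by simp
    have "read_tape (store L X W (\<lambda>_. int (Suc d) - 1) out 2) \<in> - {0}"
      using assms Suc.prems by (auto simp: in_set_conv_nth)
    moreover have "1 + (3 * d + 1) + 2 = 3 * Suc d + 1"
      by simp
    ultimately show ?case
      using exec.Loop_True[OF _ 1 Suc.IH] Suc.prems by (metis Suc_leD)
  qed
  from this[of "length W"]
  have 2: "exec (Loop 2 (- {0}) (all_left L)) (store L X W (\<lambda>_. int (length W) - 1) out)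
    (3 * length W + 1) (store L X W (\<lambda>_. - 1) out)" by simp
  have 3: "exec (all_right L) (store L X W (\<lambda>_. - 1) out) 1 (store L X W (\<lambda>_. 0) out)"
    using exec_all_right[of L X W "- 1" out] by simp
  have "1 + (3 * length W + 1 + 1) = 3 * length W + 3"
    by simp
  then show ?thesis
    using exec.Then[OF exec_all_left exec.Then[OF 2 3]] unfolding rewind_all_def by metis
qed

text \<open>Keeping the state under the head of tape 1 is the reason why actions may read the
  symbols of tapes 0 and 1: every tape then knows the current transition, which takes a single
  step.\<close>

definition parse_tapes :: "bool list \<Rightarrow> nat \<Rightarrow> dst \<Rightarrow> nat \<Rightarrow> tape" where
  "parse_tapes w i q = (\<lambda>j. if j = 0 then (word_contents w, int i) else ((\<lambda>_. 0)(0 := to_nat q), 0))"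

text \<open>The tests against \<open>S\<close> only serve well-formedness: they always succeed.\<close>

definition parse_init :: "nat \<Rightarrow> nat \<Rightarrow> com" where
  "parse_init S L = Act (\<lambda>i a _ _.
     if i = 1 then (if to_nat Items < S then to_nat Items else 0, Move_None)
     else if 2 \<le> i \<and> i < L then (3, Move_Right)
     else (a, Move_None))"

text \<open>The token goes to all pointer tapes at once, so no separate copying pass
  follows.\<close>

definition parse_step :: "nat set \<Rightarrow> (nat \<Rightarrow> nat) \<Rightarrow> nat \<Rightarrow> nat \<Rightarrow> com" where
  "parse_step Rs ar S L = Act (\<lambda>i a s t.
     let (q, e) = dfa Rs ar (from_nat t) (s = 2) in
     if i = 0 then (a, Move_Right)
     else if i = 1 then (if to_nat q < S then to_nat q else 0, Move_None)
     else if i < L \<and> e \<noteq> 0 then (if e < S then e else 0, Move_Right)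
     else (a, Move_None))"

definition parse_loop :: "nat set \<Rightarrow> (nat \<Rightarrow> nat) \<Rightarrow> nat \<Rightarrow> nat \<Rightarrow> com" where
  "parse_loop Rs ar S L = Loop 0 {1, 2} (parse_step Rs ar S L)"

lemma cell_snoc: "(cell W)(int (length W) := e) = cell (W @ [e])"
  by (auto simp: cell_def fun_eq_iff nth_append)

lemma exec_parse_init:
  assumes "2 < L" "to_nat Items < S"
  shows "exec (parse_init S L) (init_tapes w) 1
    (store L (parse_tapes w 0 Items) [3] (\<lambda>_. int (length [3 :: nat])) [])"
proof -
  have "act_all (\<lambda>i a _ _.
     if i = 1 then (if to_nat Items < S then to_nat Items else 0, Move_None)
     else if 2 \<le> i \<and> i < L then (3, Move_Right) else (a, Move_None)) (init_tapes w) =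
    store L (parse_tapes w 0 Items) [3] (\<lambda>_. int (length [3 :: nat])) []" (is "?l = ?r")
  proof
    have "(word_contents [])(0 := 3) = cell [3]" "(word_contents [])(0 := x) = (\<lambda>_. 0)(0 := x)" for x
      by (auto simp: word_contents_def cell_def fun_eq_iff)
    then show "?l i = ?r i" for i
      using assms by (auto simp: act_all_def store_def init_tapes_def parse_tapes_def)
  qed
  then show ?thesis unfolding parse_init_def by (rule exec_Act_eq)
qed

lemma exec_parse_step:
  assumes "2 < L" "i < length w" "dfa Rs ar q (w ! i) = (q', e)" "to_nat q' < S" "e < S"
  shows "exec (parse_step Rs ar S L) (store L (parse_tapes w i q) W (\<lambda>_. int (length W)) out) 1
    (store L (parse_tapes w (Suc i) q') (W @ token e) (\<lambda>_. int (length (W @ token e))) out)"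
proof -
  have "act_all (\<lambda>i a s t.
     let (q, e) = dfa Rs ar (from_nat t) (s = 2) in
     if i = 0 then (a, Move_Right)
     else if i = 1 then (if to_nat q < S then to_nat q else 0, Move_None)
     else if i < L \<and> e \<noteq> 0 then (if e < S then e else 0, Move_Right)
     else (a, Move_None)) (store L (parse_tapes w i q) W (\<lambda>_. int (length W)) out) =
    store L (parse_tapes w (Suc i) q') (W @ token e) (\<lambda>_. int (length (W @ token e))) out"
    (is "?l = ?r")
  proof
    have "(word_contents w (int i) = 2) = w ! i"
      using assms(2) by (simp add: word_contents_def)
    then show "?l j = ?r j" for j
      using assms cell_snoc[of W e]
      by (auto simp: act_all_def store_def parse_tapes_def token_def Let_def fun_upd_idem)
  qed
  then show ?thesis unfolding parse_step_def by (rule exec_Act_eq)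
qed

text \<open>The already consumed prefix \<open>u\<close> is carried along so that \<open>q\<close>
  is known to be reachable; only for reachable states is the bound \<open>S\<close>
  available.\<close>

lemma exec_parse_loop:
  assumes "2 < L" "w = u @ v"
    and "\<And>q. \<exists>w'. q = dfa_end Rs ar Items w' \<Longrightarrow> to_nat q < S"
    and "\<And>q b. \<exists>w'. q = dfa_end Rs ar Items w' \<Longrightarrow> snd (dfa Rs ar q b) < S"
    and "q = dfa_end Rs ar Items u"
  shows "exec (parse_loop Rs ar S L)
    (store L (parse_tapes w (length u) q) W (\<lambda>_. int (length W)) out) (3 * length v + 1)
    (store L (parse_tapes w (length w) (dfa_end Rs ar q v)) (W @ dfa_out Rs ar q v)
      (\<lambda>_. int (length (W @ dfa_out Rs ar q v))) out)"
  using assms(2,5)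
proof (induction v arbitrary: u q W)
  case Nil
  let ?T = "store L (parse_tapes w (length u) q) W (\<lambda>_. int (length W)) out"
  have "read_tape (?T 0) \<notin> {1, 2}"
    using Nil by (simp add: store_def parse_tapes_def word_contents_def)
  from exec.Loop_False[of ?T 0, OF this] show ?case
    using Nil by (simp add: parse_loop_def)
next
  case (Cons b v)
  have dfa_end_snoc: "dfa_end Rs ar q (u @ [b]) = fst (dfa Rs ar (dfa_end Rs ar q u) b)" for q u b
    by (induction u arbitrary: q) auto
  obtain q' e where q': "dfa Rs ar q b = (q', e)"
    by fastforce
  have "q' = dfa_end Rs ar Items (u @ [b])"
    using dfa_end_snoc[of Items u b] Cons.prems(2) q' by simp
  then have "to_nat q' < S"
    using assms(3) by blast
  moreover have "e < S"
    using assms(4)[of q b] Cons.prems(2) q' by auto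
  moreover have "w ! length u = b" "length u < length w"
    using Cons.prems by auto
  ultimately have step: "exec (parse_step Rs ar S L)
      (store L (parse_tapes w (length u) q) W (\<lambda>_. int (length W)) out) 1
      (store L (parse_tapes w (Suc (length u)) q') (W @ token e) (\<lambda>_. int (length (W @ token e))) out)"
    using assms(1) q' by (intro exec_parse_step) auto
  have rest: "exec (parse_loop Rs ar S L)
    (store L (parse_tapes w (Suc (length u)) q') (W @ token e) (\<lambda>_. int (length (W @ token e))) out)
    (3 * length v + 1)
    (store L (parse_tapes w (length w) (dfa_end Rs ar q (b # v))) (W @ dfa_out Rs ar q (b # v))
      (\<lambda>_. int (length (W @ dfa_out Rs ar q (b # v)))) out)"
    using Cons.IH[of "u @ [b]" q' "W @ token e"] Cons.prems q' \<open>q' = _\<close> by simp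
  let ?T = "store L (parse_tapes w (length u) q) W (\<lambda>_. int (length W)) out"
  have "read_tape (?T 0) \<in> {1, 2}"
    using Cons.prems by (simp add: store_def parse_tapes_def word_contents_def)
  from exec.Loop_True[of ?T 0, OF this step rest[unfolded parse_loop_def]]
  show ?case
    unfolding parse_loop_def by (rule back_subst[where P = "\<lambda>t. exec _ _ t _"]) simp
qed

lemma poly_nat_mono: "x \<le> y \<Longrightarrow> poly p x \<le> poly p y" for p :: "nat poly"
  by (induction p) (auto intro: add_mono mult_mono)

text \<open>It reduces the construction of a machine to a printing program for the parsed word. On
  inputs that are not encodings nothing is printed, which yields the empty word.\<close>

theorem polytime_computable_parse:
  assumes "finite (symbols \<D>)" "2 < L" "\<And>S. 4 \<le> S \<Longrightarrow> wf_com (Suc L) S c"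
    and c: "prints L (\<lambda>W ps. start W ps \<and> P W) c (\<lambda>W ps. f W)"
    and P: "\<And>\<phi>. formula_over \<D> \<phi> \<Longrightarrow> P (word_of \<phi>)"
  shows "\<exists>h. polytime_computable h \<and> (\<forall>\<phi>. formula_over \<D> \<phi> \<longrightarrow> h (enc_formula \<phi>) = f (word_of \<phi>)) \<and>
    (\<forall>w. (\<nexists>\<phi>. formula_over \<D> \<phi> \<and> w = enc_formula \<phi>) \<longrightarrow> h w = [])"
proof -
  let ?end = "dfa_end (symbols \<D>) (arity \<D>) Items"
  let ?out = "dfa_out (symbols \<D>) (arity \<D>) Items"
  define h where "h w = (if ?end w = Stop then f (3 # ?out w) else [])" for w
  obtain S where S: "\<And>q. \<exists>w'. q = ?end w' \<Longrightarrow> to_nat q < S"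
    "\<And>q b. \<exists>w'. q = ?end w' \<Longrightarrow> snd (dfa (symbols \<D>) (arity \<D>) q b) < S" "4 \<le> S"
    using dfa_bounded[OF assms(1)] by metis
  define prog where "prog = Then (parse_init S L) (Then (parse_loop (symbols \<D>) (arity \<D>) S L)
    (Branch 1 {to_nat Stop} (Then (rewind_all L) c) skip))"
  obtain p where p: "\<And>X W ps out. 0 \<notin> set W \<Longrightarrow> start W ps \<Longrightarrow> P W \<Longrightarrow>
    \<exists>t \<le> poly p (length W). exec c (store L X W ps out) t (store L X W ps (out @ f W))"
    using c unfolding runs_def by blast
  have "polytime_computable h"
  \<comment> \<open>The printing time is bounded in the length of \<open>W\<close>, which exceeds
    that of the input by at most one because of the leading 3; hence the composition with
    \<open>[:1, 1:]\<close>. The linear summand covers parsing and rewinding.\<close>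
  proof (rule polytime_computable_com[where N = "Suc L" and S = S and c = prog and
        p = "pcompose p [:1, 1:] + [:20, 20:]"])
    show "wf_com (Suc L) S prog"
      using assms(2,3) S(3)
      by (auto simp: prog_def parse_init_def parse_loop_def parse_step_def rewind_all_def
          all_left_def all_right_def split: prod.split)
    fix w
    define W where "W = 3 # ?out w"
    let ?T = "\<lambda>ps out. store L (parse_tapes w (length w) (?end w)) W ps out"
    have "exec (parse_loop (symbols \<D>) (arity \<D>) S L)
      (store L (parse_tapes w 0 Items) [3] (\<lambda>_. int (length [3 :: nat])) []) (3 * length w + 1)
      (?T (\<lambda>_. int (length W)) [])"
      using exec_parse_loop[OF assms(2), where u = "[]" and v = w and w = w and q = Items and
          W = "[3]" and Rs = "symbols \<D>" and ar = "arity \<D>" and S = S and out = "[]"] S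
      by (simp add: W_def)
    moreover have "exec (parse_init S L) (init_tapes w) 1
      (store L (parse_tapes w 0 Items) [3] (\<lambda>_. int (length [3 :: nat])) [])"
      using S(1)[of Items] by (intro exec_parse_init assms(2)) (metis dfa_end.simps(1))
    moreover have "\<exists>t ps. t \<le> poly p (length W) + 3 * length W + 5 \<and>
      exec (Branch 1 {to_nat Stop} (Then (rewind_all L) c) skip) (?T (\<lambda>_. int (length W)) []) t
        (?T ps (h w))"
    proof (cases "?end w = Stop")
      case True
      obtain \<phi> where \<phi>: "formula_over \<D> \<phi>" "w = enc_formula \<phi>"
        using dfa_formula_conv[OF True] by blast
      have W: "W = word_of \<phi>"
        using dfa_formula(2)[OF \<phi>(1)] \<phi>(2) by (simp add: W_def word_of_def)
      have nz: "0 \<notin> set W"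
        using dfa_out_nonzero by (auto simp: W_def)
      obtain t where t: "t \<le> poly p (length W)" "exec c (?T (\<lambda>_. 0) []) t (?T (\<lambda>_. 0) ([] @ f W))"
        using p[OF nz, of "\<lambda>_. 0" "parse_tapes w (length w) (?end w)" "[]"] P[OF \<phi>(1)] W
        by (auto simp: start_def)
      have "read_tape (?T (\<lambda>_. int (length W)) [] 1) \<in> {to_nat Stop}"
        using True by (simp add: store_def parse_tapes_def)
      from exec.Branch_True[of "?T (\<lambda>_. int (length W)) []" 1, OF this exec.Then[OF exec_rewind_all[OF assms(2) nz] t(2)], of skip]
      show ?thesis
        using t(1) True by (intro exI[of _ "3 * length W + 3 + t + 2"] exI[of _ "\<lambda>_. 0"]) (simp add: h_def W_def)
    next
      case False
      then have "read_tape (?T (\<lambda>_. int (length W)) [] 1) \<notin> {to_nat Stop}"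
        by (simp add: store_def parse_tapes_def)
      from exec.Branch_False[of "?T (\<lambda>_. int (length W)) []" 1, OF this exec_skip, of "Then (rewind_all L) c"]
      show ?thesis
        using False by (intro exI[of _ "1 + 1"] exI[of _ "\<lambda>_. int (length W)"]) (simp add: h_def)
    qed
    ultimately obtain t ps where t: "t \<le> poly p (length W) + 3 * length W + 5"
      "exec prog (init_tapes w) (1 + (3 * length w + 1 + t)) (?T ps (h w))"
      unfolding prog_def by (blast intro: exec.Then)
    have len: "length W \<le> 1 + length w"
      using length_dfa_out by (simp add: W_def)
    then have "poly p (length W) \<le> poly (pcompose p [:1, 1:]) (length w)"
      using poly_nat_mono[of _ _ p] by (simp add: poly_pcompose)
    then have "1 + (3 * length w + 1 + t) \<le> poly (pcompose p [:1, 1:] + [:20, 20:]) (length w)"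
      using t(1) len by simp
    moreover have "fst (?T ps (h w) (Suc L - 1)) = word_contents (h w)"
      using assms(2) by (simp add: store_def)
    ultimately show "\<exists>t T. t \<le> poly (pcompose p [:1, 1:] + [:20, 20:]) (length w) \<and>
      exec prog (init_tapes w) t T \<and> fst (T (Suc L - 1)) = word_contents (h w)"
      using t(2) by blast
  qed (use assms(2) S(3) in auto)
  moreover have "h (enc_formula \<phi>) = f (word_of \<phi>)" if "formula_over \<D> \<phi>" for \<phi>
    using dfa_formula[OF that] by (simp add: h_def word_of_def)
  moreover have "h w = []" if "\<nexists>\<phi>. formula_over \<D> \<phi> \<and> w = enc_formula \<phi>" for w
    using dfa_formula_conv that by (auto simp: h_def)
  ultimately show ?thesis by blast
qed


section \<open>Correctness of the reduction\<close>

lemma sat_atom_map_atom: "sat_atom \<B> h (map_atom \<nu> a) \<longleftrightarrow> sat_atom \<B> (\<lambda>x. h (\<nu> x)) a"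
  by (cases a) (auto simp: comp_def)

lemma atom_over_map_atom [simp]: "atom_over \<B> (map_atom \<nu> a) \<longleftrightarrow> atom_over \<B> a"
  by (cases a) auto

lemma sat_atom_cong: "(\<And>x. x \<in> set_atom a \<Longrightarrow> h x = h' x) \<Longrightarrow> sat_atom \<B> h a \<longleftrightarrow> sat_atom \<B> h' a"
  by (cases a) (auto cong: map_cong)

lemma COND_yesE:
  assumes "COND_yes \<B> U \<phi>"
  obtains h where "h \<in> U \<rightarrow>\<^sub>E universe \<B>" "h ` U = universe \<B>" "sat \<B> h \<phi>"
    "\<And>R bs. R \<in> symbols \<B> \<Longrightarrow> bs \<in> rel \<B> R \<Longrightarrow> \<exists>us. Rel R us \<in> set \<phi> \<and> map h us = bs"
proof -
  from assms[unfolded COND_yes_def] show thesis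
    by (elim bexE conjE) (rule that; blast)
qed

lemma COND_yesI:
  assumes "h \<in> U \<rightarrow>\<^sub>E universe \<B>" "h ` U = universe \<B>" "sat \<B> h \<phi>"
    "\<And>R bs. R \<in> symbols \<B> \<Longrightarrow> bs \<in> rel \<B> R \<Longrightarrow> \<exists>us. Rel R us \<in> set \<phi> \<and> map h us = bs"
  shows "COND_yes \<B> U \<phi>"
  unfolding COND_yes_def using assms by (intro bexI[of _ h] conjI ballI) auto

text \<open>The machine outputs words as variables, whereas stability is about maps on applications.
  An injective renaming mediates between the two: solutions are transported along
  \<open>\<nu>\<close> and its inverse.\<close>

lemma COND_yes_image:
  assumes "inj_on \<nu> U" "vars \<psi> \<subseteq> U"
  shows "COND_yes \<B> (\<nu> ` U) (map (map_atom \<nu>) \<psi>) \<longleftrightarrow> COND_yes \<B> U \<psi>"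
proof
  assume "COND_yes \<B> (\<nu> ` U) (map (map_atom \<nu>) \<psi>)"
  then obtain h where h: "h \<in> \<nu> ` U \<rightarrow>\<^sub>E universe \<B>" "h ` \<nu> ` U = universe \<B>"
    "sat \<B> h (map (map_atom \<nu>) \<psi>)" "\<And>R bs. R \<in> symbols \<B> \<Longrightarrow> bs \<in> rel \<B> R \<Longrightarrow>
      \<exists>us. Rel R us \<in> set (map (map_atom \<nu>) \<psi>) \<and> map h us = bs"
    by (rule COND_yesE) (rule that)
  let ?h = "\<lambda>x \<in> U. h (\<nu> x)"
  have eq: "?h x = h (\<nu> x)" if "x \<in> set_atom a" "a \<in> set \<psi>" for a x
    using that assms(2) by (auto simp: vars_def)
  have "?h \<in> U \<rightarrow>\<^sub>E universe \<B>" "?h ` U = universe \<B>"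
    using h(1,2) by auto
  moreover have "sat \<B> ?h \<psi>"
    unfolding sat_def
  proof
    fix a assume a: "a \<in> set \<psi>"
    then have "sat_atom \<B> (\<lambda>x. h (\<nu> x)) a"
      using h(3) by (auto simp: sat_def sat_atom_map_atom)
    then show "sat_atom \<B> ?h a"
      using sat_atom_cong[of a ?h "\<lambda>x. h (\<nu> x)"] eq a by blast
  qed
  moreover have "\<exists>us. Rel R us \<in> set \<psi> \<and> map ?h us = bs" if R: "R \<in> symbols \<B>" "bs \<in> rel \<B> R" for R bs
  proof -
    obtain us a where us: "a \<in> set \<psi>" "Rel R us = map_atom \<nu> a" "map h us = bs"
      using h(4)[OF R] by auto
    obtain us' where a: "a = Rel R us'" "us = map \<nu> us'"
      using us(2) by (cases a) auto
    have "map ?h us' = map (\<lambda>x. h (\<nu> x)) us'"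
      using eq[OF _ us(1)] a by (intro map_cong) auto
    then show ?thesis
      using us a by (intro exI[of _ us']) (auto simp: comp_def)
  qed
  ultimately show "COND_yes \<B> U \<psi>"
    by (rule COND_yesI)
next
  assume "COND_yes \<B> U \<psi>"
  then obtain h where h: "h \<in> U \<rightarrow>\<^sub>E universe \<B>" "h ` U = universe \<B>" "sat \<B> h \<psi>"
    "\<And>R bs. R \<in> symbols \<B> \<Longrightarrow> bs \<in> rel \<B> R \<Longrightarrow> \<exists>us. Rel R us \<in> set \<psi> \<and> map h us = bs"
    by (rule COND_yesE) (rule that)
  let ?h = "\<lambda>y \<in> \<nu> ` U. h (inv_into U \<nu> y)"
  have U: "?h (\<nu> x) = h x" if "x \<in> U" for x
    using that assms(1) by simp
  have eq: "?h (\<nu> x) = h x" if "x \<in> set_atom a" "a \<in> set \<psi>" for a x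
    using that assms(2) U by (auto simp: vars_def)
  have "?h \<in> \<nu> ` U \<rightarrow>\<^sub>E universe \<B>"
    using h(1) assms(1) by auto
  moreover have "?h ` \<nu> ` U = universe \<B>"
    using U h(2) by (auto simp: image_image cong: image_cong)
  moreover have "sat \<B> ?h (map (map_atom \<nu>) \<psi>)"
    unfolding sat_def
  proof
    fix b assume "b \<in> set (map (map_atom \<nu>) \<psi>)"
    then obtain a where a: "a \<in> set \<psi>" "b = map_atom \<nu> a"
      by auto
    then have "sat_atom \<B> (\<lambda>x. ?h (\<nu> x)) a"
      using h(3) sat_atom_cong[of a h "\<lambda>x. ?h (\<nu> x)"] eq by (metis sat_def)
    then show "sat_atom \<B> ?h b"
      unfolding a(2) sat_atom_map_atom .
  qed
  moreover have "\<exists>us. Rel R us \<in> set (map (map_atom \<nu>) \<psi>) \<and> map ?h us = bs"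
    if R: "R \<in> symbols \<B>" "bs \<in> rel \<B> R" for R bs
  proof -
    obtain us where us: "Rel R us \<in> set \<psi>" "map h us = bs"
      using h(4)[OF R] by auto
    have "map ?h (map \<nu> us) = map h us"
      using eq[OF _ us(1)] by simp
    moreover have "map_atom \<nu> (Rel R us) \<in> set (map (map_atom \<nu>) \<psi>)"
      using us(1) by (metis image_eqI list.set_map)
    ultimately show ?thesis
      using us by (intro exI[of _ "map \<nu> us"]) auto
  qed
  ultimately show "COND_yes \<B> (\<nu> ` U) (map (map_atom \<nu>) \<psi>)"
    by (rule COND_yesI)
qed

section \<open>Applications, and atoms that induce the relations of the template\<close>

lemma applications_iff [simp]:
  "(vs, kf) \<in> applications V F \<longleftrightarrow> kf \<in> F \<and> vs \<in> tuples V (fst kf)"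
  by (cases kf) (auto simp: applications_def)

lemma applicationsE:
  assumes "\<alpha> \<in> applications V F"
  obtains vs kf where "\<alpha> = (vs, kf)" "kf \<in> F" "vs \<in> tuples V (fst kf)"
  using assms by (cases \<alpha>) auto

lemma t_map_app:
  assumes "kf \<in> F" "vs \<in> tuples V (fst kf)"
  shows "t_map V F g (vs, kf) = snd kf (map g vs)"
  using assms by (cases kf) (simp add: t_map_def)

lemma t_map_in:
  assumes "encoding F D B" "g \<in> V \<rightarrow>\<^sub>E D"
  shows "t_map V F g \<in> applications V F \<rightarrow>\<^sub>E B"
proof (rule PiE_I)
  fix \<alpha> assume "\<alpha> \<in> applications V F"
  then obtain vs kf where \<alpha>: "\<alpha> = (vs, kf)" "kf \<in> F" "vs \<in> tuples V (fst kf)"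
    by (rule applicationsE)
  have "map g vs \<in> tuples D (fst kf)"
    using assms(2) \<alpha>(3) by (auto simp: tuples_def)
  moreover have "snd kf \<in> tuples D (fst kf) \<rightarrow>\<^sub>E B"
    using bspec[OF conjunct2[OF assms(1)[unfolded encoding_def]] \<alpha>(2)]
    by (simp add: case_prod_beta)
  ultimately show "t_map V F g \<alpha> \<in> B"
    using \<alpha> by (auto simp: t_map_app)
qed (simp add: t_map_def)

text \<open>A formal application refers to an encoding map by its index in a list \<open>Fs\<close>.\<close>

definition app_of :: "('d, 'b) enc_map list \<Rightarrow> (ref \<Rightarrow> var) \<Rightarrow> fapp \<Rightarrow> ('d, 'b) application" where
  "app_of Fs d x = (map d (snd x), Fs ! fst x)"

definition fapps :: "('d, 'b) enc_map list \<Rightarrow> ref set \<Rightarrow> fapp set" where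
  "fapps Fs rs = {(j, r). j < length Fs \<and> r \<in> tuples rs (fst (Fs ! j))}"

definition fapp_value :: "('d, 'b) enc_map list \<Rightarrow> (ref \<Rightarrow> 'd) \<Rightarrow> fapp \<Rightarrow> 'b" where
  "fapp_value Fs g x = snd (Fs ! fst x) (map g (snd x))"

text \<open>The abstract counterpart of \<open>deref\<close>: the argument list of an atom and a
  choice of variables for the heads replace the positions on the tapes.\<close>

definition context_of :: "var list \<Rightarrow> (nat \<Rightarrow> var) \<Rightarrow> ref \<Rightarrow> var" where
  "context_of vs \<sigma> r = (case r of Head j \<Rightarrow> \<sigma> j | Arg k \<Rightarrow> vs ! k)"

lemma context_of_simps [simp]:
  "context_of vs \<sigma> (Head j) = \<sigma> j" "context_of vs \<sigma> (Arg k) = vs ! k"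
  by (auto simp: context_of_def)

text \<open>Induced relations are defined with pairwise distinct variables. Here one atom has to
  serve all argument lists, including those with repetitions, as they occur in formulas.\<close>

definition represents ::
    "'b rel_struct \<Rightarrow> ('d, 'b) enc_map list \<Rightarrow> 'd rel_struct \<Rightarrow> nat \<Rightarrow> fapp atom \<Rightarrow> bool" where
  "represents \<B> Fs \<D> R a \<longleftrightarrow> atom_over \<B> a \<and> set_atom a \<subseteq> fapps Fs (Arg ` {..<arity \<D> R}) \<and>
     (\<forall>vs g \<sigma>. length vs = arity \<D> R \<and> g ` set vs \<subseteq> universe \<D> \<longrightarrow>
        (map g vs \<in> rel \<D> R \<longleftrightarrow> sat_atom \<B> (fapp_value Fs (\<lambda>r. g (context_of vs \<sigma> r))) a))"

text \<open>The value of an application depends on its variables only through the values that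
  \<open>g\<close> gives them. So the atom found for distinct variables remains correct when these
  are replaced by arbitrary arguments.\<close>

lemma ex_represents:
  fixes Fs :: "('d, 'b) enc_map list"
  assumes "wf_struct \<B>" "encoding (set Fs) D (universe \<B>)"
    and "induced_relation \<B> D (set Fs) (arity \<D> R) (rel \<D> R)" "universe \<D> = D"
  shows "\<exists>a. represents \<B> Fs \<D> R a"
proof -
  define s where "s = arity \<D> R"
  \<comment> \<open>Any \<open>s\<close> distinct words would do; with these the length of a word is
    its index, which becomes the number of the argument.\<close>
  define us where "us = map (\<lambda>i. replicate i True) [0..<s]"
  have us: "distinct us" "length us = s"
    by (auto simp: us_def distinct_map inj_on_def)
  have "distinct us \<and> length us = arity \<D> R"
    using us by (simp add: s_def)
  from assms(3)[unfolded induced_relation_def, THEN conjunct2, THEN conjunct2, THEN spec, THEN mp, OF this]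
  obtain r Q and \<alpha>s :: "('d, 'b) application list"
    where Q: "(\<exists>R \<in> symbols \<B>. r = arity \<B> R \<and> Q = rel \<B> R) \<or>
        (r = 2 \<and> Q = {[b, b] | b. b \<in> universe \<B>})"
      and \<alpha>s: "\<alpha>s \<in> tuples (applications (set us) (set Fs)) r"
      and rel: "rel \<D> R = {map g us | g. g \<in> set us \<rightarrow>\<^sub>E D \<and> map (t_map (set us) (set Fs) g) \<alpha>s \<in> Q}"
    by (elim exE conjE) (rule that)
  \<comment> \<open>\<open>Eq\<close> does not by itself confine its values to the universe, but the
    equality relation on \<open>B\<close> does; hence the condition on \<open>t\<close>.\<close>
  obtain a0 where a0: "atom_over \<B> a0" "set_atom a0 \<subseteq> set \<alpha>s"
    "\<And>t. t \<in> set \<alpha>s \<rightarrow> universe \<B> \<Longrightarrow> sat_atom \<B> t a0 \<longleftrightarrow> map t \<alpha>s \<in> Q"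
  proof (cases "\<exists>R \<in> symbols \<B>. r = arity \<B> R \<and> Q = rel \<B> R")
    case True
    then obtain R' where "R' \<in> symbols \<B>" "r = arity \<B> R'" "Q = rel \<B> R'" by blast
    then show thesis
      using \<alpha>s by (intro that[of "Rel R' \<alpha>s"]) (auto simp: tuples_def)
  next
    case False
    then have r: "r = 2" "Q = {[b, b] | b. b \<in> universe \<B>}"
      using Q by auto
    then obtain \<alpha> \<beta> where "\<alpha>s = [\<alpha>, \<beta>]"
      using \<alpha>s by (auto simp: tuples_def numeral_2_eq_2 length_Suc_conv)
    then show thesis
      using r by (intro that[of "Eq \<alpha> \<beta>"]) auto
  qed
  define idx where "idx kf = (SOME j. j < length Fs \<and> Fs ! j = kf)" for kf
  have idx: "idx kf < length Fs" "Fs ! idx kf = kf" if "kf \<in> set Fs" for kf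
    using someI_ex[of "\<lambda>j. j < length Fs \<and> Fs ! j = kf"] that
    unfolding idx_def in_set_conv_nth by auto
  define fa where "fa \<alpha> = (idx (snd \<alpha>), map (\<lambda>u. Arg (length u)) (fst \<alpha>))"
    for \<alpha> :: "('d, 'b) application"
  have app: "snd \<alpha> \<in> set Fs" "set (fst \<alpha>) \<subseteq> set us" "length (fst \<alpha>) = fst (snd \<alpha>)"
    if "\<alpha> \<in> set_atom a0" for \<alpha>
    using that a0(2) \<alpha>s by (fastforce simp: tuples_def applications_def)+
  have "represents \<B> Fs \<D> R (map_atom fa a0)"
    unfolding represents_def
  proof (intro conjI allI impI)
    show "atom_over \<B> (map_atom fa a0)"
      using a0(1) by simp
    show "set_atom (map_atom fa a0) \<subseteq> fapps Fs (Arg ` {..<arity \<D> R})"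
      using app idx by (fastforce simp: atom.set_map fapps_def fa_def tuples_def us_def s_def)
    fix vs :: "var list" and g \<sigma>
    assume *: "length vs = arity \<D> R \<and> g ` set vs \<subseteq> universe \<D>"
    \<comment> \<open>The values of the actual arguments, moved to the distinct variables.\<close>
    define g0 where "g0 = (\<lambda>u \<in> set us. g (vs ! length u))"
    have g0: "g0 \<in> set us \<rightarrow>\<^sub>E D"
      using * assms(4) by (auto simp: g0_def us_def s_def image_subset_iff)
    have map_g0: "map g0 us = map g vs"
    proof (rule nth_equalityI)
      fix i assume "i < length (map g0 us)"
      then have i: "i < s" using us by simp
      then have "us ! i = replicate i True" "us ! i \<in> set us"
        using us(2) nth_mem[of i us] by (auto simp: us_def)
      then show "map g0 us ! i = map g vs ! i"
        using i * us by (simp add: g0_def s_def)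
    qed (use us * in \<open>simp add: s_def\<close>)
    let ?t = "t_map (set us) (set Fs) g0"
    have "?t \<alpha> \<in> universe \<B>" if "\<alpha> \<in> applications (set us) (set Fs)" for \<alpha>
      using that t_map_in[OF assms(2) g0] by auto
    then have "sat_atom \<B> ?t a0 \<longleftrightarrow> map ?t \<alpha>s \<in> Q"
      using \<alpha>s by (intro a0(3)) (auto simp: tuples_def)
    moreover have "map g vs \<in> rel \<D> R \<longleftrightarrow> map ?t \<alpha>s \<in> Q"
    proof
      assume "map g vs \<in> rel \<D> R"
      then obtain g' where g': "map g vs = map g' us" "g' \<in> set us \<rightarrow>\<^sub>E D"
        "map (t_map (set us) (set Fs) g') \<alpha>s \<in> Q"
        using rel by auto
      \<comment> \<open>Both are extensional on \<open>set us\<close> and agree along the list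
        \<open>us\<close>.\<close>
      then have "g' = g0"
        using g0 map_g0 by (intro PiE_ext[of g' "set us" "\<lambda>_. D" g0]) (auto simp: map_eq_conv)
      then show "map ?t \<alpha>s \<in> Q" using g' by simp
    next
      assume "map ?t \<alpha>s \<in> Q"
      then show "map g vs \<in> rel \<D> R"
        using rel g0 map_g0 by (auto simp flip: map_g0)
    qed
    moreover have "sat_atom \<B> ?t a0 \<longleftrightarrow>
      sat_atom \<B> (\<lambda>\<alpha>. fapp_value Fs (\<lambda>r. g (context_of vs \<sigma> r)) (fa \<alpha>)) a0"
    proof (rule sat_atom_cong)
      fix \<alpha> assume \<alpha>: "\<alpha> \<in> set_atom a0"
      obtain ws k f where \<alpha>_eq: "\<alpha> = (ws, (k, f))"
        by (cases \<alpha>) auto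
      have "\<alpha> \<in> applications (set us) (set Fs)"
        using \<alpha> a0(2) \<alpha>s by (auto simp: tuples_def)
      moreover have "map g0 ws = map (\<lambda>u. g (vs ! length u)) ws"
        using app(2)[OF \<alpha>] \<alpha>_eq by (auto simp: g0_def)
      ultimately show "?t \<alpha> = fapp_value Fs (\<lambda>r. g (context_of vs \<sigma> r)) (fa \<alpha>)"
        using idx(2)[OF app(1)[OF \<alpha>]] \<alpha>_eq
        by (simp add: t_map_def fapp_value_def fa_def comp_def del: map_eq_conv)
    qed
    ultimately show "map g vs \<in> rel \<D> R \<longleftrightarrow>
        sat_atom \<B> (fapp_value Fs (\<lambda>r. g (context_of vs \<sigma> r))) (map_atom fa a0)"
      by (simp add: sat_atom_map_atom)
  qed
  then show ?thesis by blast
qed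

text \<open>Relations are preserved in both directions by definition, equalities because an
  automorphism is injective. It allows the automorphism provided by surjective closedness to be
  stripped off a solution.\<close>

lemma automorphism_sat_atom:
  assumes "automorphism \<B> \<gamma>" "t \<in> A \<rightarrow> universe \<B>" "atom_over \<B> a" "set_atom a \<subseteq> A"
  shows "sat_atom \<B> (compose A \<gamma> t) a \<longleftrightarrow> sat_atom \<B> t a"
proof (cases a)
  case (Rel R vs)
  then have vs: "set vs \<subseteq> A" "R \<in> symbols \<B>" "length vs = arity \<B> R"
    using assms(3,4) by auto
  have "map t vs \<in> tuples (universe \<B>) (arity \<B> R)"
    using vs assms(2) by (auto simp: tuples_def)
  then have "map t vs \<in> rel \<B> R \<longleftrightarrow> map \<gamma> (map t vs) \<in> rel \<B> R"
    using assms(1) vs(2) unfolding automorphism_def by blast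
  moreover have "map (compose A \<gamma> t) vs = map \<gamma> (map t vs)"
    using vs by (auto simp: compose_def)
  ultimately show ?thesis using Rel by (simp del: map_map map_eq_conv)
next
  case (Eq u v)
  have "inj_on \<gamma> (universe \<B>)"
    using assms(1) by (simp add: automorphism_def bij_betw_def)
  then show ?thesis
    using Eq assms(2,4) by (auto simp: compose_def inj_on_def)
qed

definition valid_atoms :: "'b rel_struct \<Rightarrow> 'd set \<Rightarrow> ('d, 'b) enc_map set \<Rightarrow> var set \<Rightarrow>
    ('d, 'b) application atom set" where
  "valid_atoms \<B> D F V = {a. atom_over \<B> a \<and> set_atom a \<subseteq> applications V F \<and>
     (\<forall>t \<in> T_set D F V. sat_atom \<B> t a)}"

text \<open>An equality \<open>u = v\<close> cannot be expressed on the values of the encoding maps. It is replaced by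
  the interchangeability of \<open>u\<close> and \<open>v\<close> in all applications.\<close>

definition swap_atoms :: "('d, 'b) enc_map set \<Rightarrow> var set \<Rightarrow> var \<Rightarrow> var \<Rightarrow>
    ('d, 'b) application atom set" where
  "swap_atoms F V u v = {Eq (vs[i := u], kf) (vs[i := v], kf) | vs i kf.
     kf \<in> F \<and> vs \<in> tuples V (fst kf) \<and> i < fst kf}"

lemma update_tuples: "vs \<in> tuples V k \<Longrightarrow> x \<in> V \<Longrightarrow> vs[i := x] \<in> tuples V k"
  using set_update_subset_insert[of vs i x] by (auto simp: tuples_def)

text \<open>Pass from \<open>ds\<close> to \<open>ds'\<close> through the hybrids
  \<open>take n ds' @ drop n ds\<close>. Consecutive hybrids differ in one position and have all
  entries in \<open>E\<close>.\<close>

lemma interchange: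
  assumes "set ds \<subseteq> E" "set ds' \<subseteq> E" "length ds = k" "length ds' = k"
    and "\<And>i es. i < k \<Longrightarrow> set es \<subseteq> E \<Longrightarrow> length es = k \<Longrightarrow>
      f (es[i := ds ! i]) = f (es[i := ds' ! i])"
  shows "f ds = f ds'"
proof -
  have "f (take n ds' @ drop n ds) = f ds" if "n \<le> k" for n
    using that
  proof (induction n)
    case (Suc n)
    let ?es = "take n ds' @ drop n ds"
    have n: "n < k" using Suc by simp
    have "?es[n := ds ! n] = ?es"
      using n assms(3,4) by (simp add: list_update_append flip: Cons_nth_drop_Suc)
    moreover have "?es[n := ds' ! n] = take (Suc n) ds' @ drop (Suc n) ds"
      using n assms(3,4)
      by (simp add: list_update_append take_Suc_conv_app_nth flip: Cons_nth_drop_Suc)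
    moreover have "set ?es \<subseteq> E"
      using assms(1,2) by (auto dest: in_set_takeD in_set_dropD)
    ultimately have "f ?es = f (take (Suc n) ds' @ drop (Suc n) ds)"
      using assms(5)[OF n, of ?es] assms(3,4) n by simp
    then show ?case using Suc by simp
  qed simp
  from this[of k] show ?thesis using assms(3,4) by simp
qed

text \<open>Here the variables are the applications themselves rather than the words that name them.
  Only the set of atoms is prescribed, since order and repetitions do not affect a
  conjunction.\<close>

lemma COND_iff_CSP:
  fixes \<B> :: "'b rel_struct" and \<D> :: "'d rel_struct" and Fs :: "('d, 'b) enc_map list"
  assumes wf: "wf_struct \<B>" and enc: "encoding (set Fs) D (universe \<B>)"
    and const: "contains_constants (set Fs) D (universe \<B>)" and stable: "stable \<B> D (set Fs)"
    and D: "universe \<D> = D" "D \<noteq> {}"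
    and \<tau>: "\<And>R. R \<in> symbols \<D> \<Longrightarrow> represents \<B> Fs \<D> R (\<tau> R)"
    and \<phi>: "formula_over \<D> \<phi>" and V: "finite V" "V \<noteq> {}" "vars \<phi> \<subseteq> V"
    and \<psi>: "set \<psi> = valid_atoms \<B> D (set Fs) V \<union>
      {map_atom (app_of Fs (context_of vs \<sigma>)) (\<tau> R) | R vs. Rel R vs \<in> set \<phi>} \<union>
      (\<Union>(u, v) \<in> {(u, v). Eq u v \<in> set \<phi>}. swap_atoms (set Fs) V u v)"
  shows "formula_over \<B> \<psi>" and "vars \<psi> \<subseteq> applications V (set Fs)"
    and "COND_yes \<B> (applications V (set Fs)) \<psi> \<longleftrightarrow> CSP_yes \<D> \<phi>"
proof -
  let ?F = "set Fs"
  let ?A = "applications V ?F"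
  note t_map = t_map_in[OF enc]
  have Rel_iff: "map g vs \<in> rel \<D> R \<longleftrightarrow>
      sat_atom \<B> (t_map V ?F g) (map_atom (app_of Fs (context_of vs \<sigma>)) (\<tau> R))"
    if "Rel R vs \<in> set \<phi>" "g \<in> V \<rightarrow>\<^sub>E D" for R vs g
  proof -
    have R: "R \<in> symbols \<D>" "length vs = arity \<D> R"
      using \<phi> that(1) by (auto simp: formula_over_def)
    have vs: "set vs \<subseteq> V"
      using V(3) that(1) by (force simp: vars_def)
    have "g ` set vs \<subseteq> universe \<D>"
      using vs that(2) D(1) by auto
    then have "map g vs \<in> rel \<D> R \<longleftrightarrow> sat_atom \<B> (fapp_value Fs (\<lambda>r. g (context_of vs \<sigma> r))) (\<tau> R)"
      using \<tau>[OF R(1)] R(2) unfolding represents_def by blast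
    also have "\<dots> \<longleftrightarrow> sat_atom \<B> (\<lambda>x. t_map V ?F g (app_of Fs (context_of vs \<sigma>) x)) (\<tau> R)"
    proof (rule sat_atom_cong)
      fix x assume "x \<in> set_atom (\<tau> R)"
      then have "x \<in> fapps Fs (Arg ` {..<arity \<D> R})"
        using \<tau>[OF R(1)] unfolding represents_def by blast
      then obtain j rs where x: "x = (j, rs)" "j < length Fs" "length rs = fst (Fs ! j)"
        "set rs \<subseteq> Arg ` {..<arity \<D> R}"
        by (auto simp: fapps_def tuples_def)
      moreover have "set (map (context_of vs \<sigma>) rs) \<subseteq> V"
        using x(4) vs R(2) by fastforce
      ultimately show "fapp_value Fs (\<lambda>r. g (context_of vs \<sigma> r)) x =
          t_map V ?F g (app_of Fs (context_of vs \<sigma>) x)"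
        by (simp add: fapp_value_def app_of_def t_map_app tuples_def comp_def)
    qed
    finally show ?thesis by (simp add: sat_atom_map_atom)
  qed
  have over: "atom_over \<B> a \<and> set_atom a \<subseteq> ?A" if a: "a \<in> set \<psi>" for a
  proof -
    consider "a \<in> valid_atoms \<B> D ?F V"
      | R vs where "a = map_atom (app_of Fs (context_of vs \<sigma>)) (\<tau> R)" "Rel R vs \<in> set \<phi>"
      | u v where "Eq u v \<in> set \<phi>" "a \<in> swap_atoms ?F V u v"
      using a \<psi> by auto
    then show ?thesis
    proof cases
      case 1
      then show ?thesis by (simp add: valid_atoms_def)
    next
      case 2
      have R: "R \<in> symbols \<D>" "length vs = arity \<D> R"
        using \<phi> 2(2) by (auto simp: formula_over_def)
      have vs: "set vs \<subseteq> V"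
        using V(3) 2(2) by (force simp: vars_def)
      have \<tau>R: "atom_over \<B> (\<tau> R)" "set_atom (\<tau> R) \<subseteq> fapps Fs (Arg ` {..<arity \<D> R})"
        using \<tau>[OF R(1)] by (auto simp: represents_def)
      have "app_of Fs (context_of vs \<sigma>) x \<in> ?A" if "x \<in> fapps Fs (Arg ` {..<arity \<D> R})" for x
      proof -
        obtain j rs where x: "x = (j, rs)" "j < length Fs" "length rs = fst (Fs ! j)"
          "set rs \<subseteq> Arg ` {..<arity \<D> R}"
          using \<open>x \<in> _\<close> by (auto simp: fapps_def tuples_def)
        moreover have "set (map (context_of vs \<sigma>) rs) \<subseteq> V"
          using x(4) vs R(2) by fastforce
        ultimately show ?thesis
          by (simp add: app_of_def tuples_def)
      qed
      then show ?thesis using \<tau>R 2(1) by (auto simp: atom.set_map)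
    next
      case 3
      then have "{u, v} \<subseteq> V"
        using V(3) by (force simp: vars_def)
      then show ?thesis
        using 3(2) by (auto simp: swap_atoms_def update_tuples)
    qed
  qed
  then show "formula_over \<B> \<psi>" "vars \<psi> \<subseteq> ?A"
    by (auto simp: formula_over_def vars_def)
  show "COND_yes \<B> ?A \<psi> \<longleftrightarrow> CSP_yes \<D> \<phi>"
  proof
    assume "CSP_yes \<D> \<phi>"
    then obtain h where h: "h \<in> vars \<phi> \<rightarrow>\<^sub>E D" "sat \<D> h \<phi>"
      using D(1) by (auto simp: CSP_yes_def)
    obtain d0 where d0: "d0 \<in> D" using D(2) by blast
    \<comment> \<open>\<open>V\<close> may contain variables that do not occur in
      \<open>\<phi>\<close>; they receive \<open>d0\<close>.\<close>
    define g where "g = (\<lambda>v \<in> V. if v \<in> vars \<phi> then h v else d0)"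
    have g: "g \<in> V \<rightarrow>\<^sub>E D"
      using h(1) d0 by (auto simp: g_def)
    have gh: "g v = h v" if "v \<in> vars \<phi>" for v
      using that V(3) by (auto simp: g_def)
    let ?t = "t_map V ?F g"
    have T: "?t \<in> T_set D ?F V"
      using g by (auto simp: T_set_def)
    then have "?t ` ?A = universe \<B>"
      using stable V(1,2) unfolding stable_def by blast
    moreover have "sat \<B> ?t \<psi>"
      unfolding sat_def
    proof
      fix a assume "a \<in> set \<psi>"
      then consider "a \<in> valid_atoms \<B> D ?F V"
        | R vs where "a = map_atom (app_of Fs (context_of vs \<sigma>)) (\<tau> R)" "Rel R vs \<in> set \<phi>"
        | u v where "Eq u v \<in> set \<phi>" "a \<in> swap_atoms ?F V u v"
        using \<psi> by auto
      then show "sat_atom \<B> ?t a"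
      proof cases
        case 1
        then show ?thesis using T by (simp add: valid_atoms_def)
      next
        case 2
        have "map h vs \<in> rel \<D> R"
          using h(2) 2(2) by (auto simp: sat_def)
        moreover have "map h vs = map g vs"
          using gh 2(2) by (force simp: vars_def)
        ultimately show ?thesis
          using Rel_iff[OF 2(2) g] 2(1) by simp
      next
        case 3
        then have uv: "u \<in> vars \<phi>" "v \<in> vars \<phi>" "h u = h v"
          using h(2) by (force simp: vars_def sat_def)+
        then have "g u = g v" using gh by simp
        obtain vs i kf where a: "a = Eq (vs[i := u], kf) (vs[i := v], kf)"
          "kf \<in> ?F" "vs \<in> tuples V (fst kf)" "i < fst kf"
          using 3(2) by (auto simp: swap_atoms_def)
        moreover have "u \<in> V" "v \<in> V"
          using uv V(3) by auto
        ultimately show ?thesis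
          using \<open>g u = g v\<close> by (simp add: t_map_app update_tuples map_update)
      qed
    qed
    moreover have "\<exists>us. Rel R us \<in> set \<psi> \<and> map ?t us = bs"
      if R: "R \<in> symbols \<B>" "bs \<in> rel \<B> R" for R bs
    proof -
      have bs: "set bs \<subseteq> universe \<B>" "length bs = arity \<B> R"
        using wf R by (auto simp: wf_struct_def tuples_def)
      obtain v0 where v0: "v0 \<in> V" using V(2) by blast
      have "\<exists>\<alpha> \<in> ?A. \<forall>t \<in> T_set D ?F V. t \<alpha> = b" if "b \<in> universe \<B>" for b
      proof -
        obtain k f where kf: "(k, f) \<in> ?F" "\<forall>e \<in> tuples D k. f e = b"
          using const \<open>b \<in> universe \<B>\<close> by (fastforce simp: contains_constants_def)
        have "(replicate k v0, (k, f)) \<in> ?A"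
          using kf v0 by (auto simp: tuples_def)
        moreover have "t (replicate k v0, (k, f)) = b" if t: "t \<in> T_set D ?F V" for t
        proof -
          obtain g where g: "g \<in> V \<rightarrow>\<^sub>E D" "t = t_map V ?F g"
            using t by (auto simp: T_set_def)
          then have "map g (replicate k v0) \<in> tuples D k"
            using v0 by (auto simp: tuples_def)
          moreover have "replicate k v0 \<in> tuples V k"
            using v0 by (auto simp: tuples_def)
          ultimately show ?thesis
            using g(2) kf t_map_app[OF kf(1), of "replicate k v0" V g] by simp
        qed
        ultimately show ?thesis by blast
      qed
      then obtain c where c: "\<And>b. b \<in> universe \<B> \<Longrightarrow> c b \<in> ?A"
        "\<And>b t. b \<in> universe \<B> \<Longrightarrow> t \<in> T_set D ?F V \<Longrightarrow> t (c b) = b"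
        by metis
      have map_c: "map t (map c bs) = bs" if "t \<in> T_set D ?F V" for t
        using that bs(1) c(2) by (auto simp: comp_def intro: map_idI)
      \<comment> \<open>The applications \<open>c b\<close> have the value \<open>b\<close> under
        every map in \<open>T_set D ?F V\<close>, so this atom always evaluates to the tuple
        \<open>bs\<close> of \<open>R\<close>. Being valid, it belongs to the first part of
        \<open>\<psi>\<close>.\<close>
      then have "Rel R (map c bs) \<in> valid_atoms \<B> D ?F V"
        using R bs c(1) by (auto simp: valid_atoms_def simp del: map_map)
      then show ?thesis
        using map_c[OF T] \<psi> by blast
    qed
    ultimately show "COND_yes \<B> ?A \<psi>"
      by (rule COND_yesI[OF t_map[OF g]])
  next
    assume "COND_yes \<B> ?A \<psi>"
    then obtain h where h: "h \<in> ?A \<rightarrow>\<^sub>E universe \<B>" "h ` ?A = universe \<B>" "sat \<B> h \<psi>"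
      by (rule COND_yesE)
    have "h \<in> conj_closure \<B> ?A (T_set D ?F V)"
      unfolding conj_closure_def hull_def
    proof (rule InterI)
      fix M assume "M \<in> {M. conj_definable \<B> ?A M \<and> T_set D ?F V \<subseteq> M}"
      then obtain \<chi> where \<chi>: "formula_over \<B> \<chi>" "vars \<chi> \<subseteq> ?A"
        "M = {h \<in> ?A \<rightarrow>\<^sub>E universe \<B>. sat \<B> h \<chi>}" "T_set D ?F V \<subseteq> M"
        by (auto simp: conj_definable_def)
      \<comment> \<open>A definable set containing \<open>T_set D ?F V\<close> is defined by atoms
        that hold under all its maps, and \<open>h\<close> satisfies every such atom.\<close>
      have "set \<chi> \<subseteq> valid_atoms \<B> D ?F V"
        using \<chi> by (fastforce simp: valid_atoms_def formula_over_def vars_def sat_def)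
      then have "sat \<B> h \<chi>"
        using h(3) \<psi> by (auto simp: sat_def)
      then show "h \<in> M" using \<chi>(3) h(1) by simp
    qed
    moreover have "surj_closed \<B> ?A (T_set D ?F V)"
      using stable V(1,2) by (simp add: stable_def)
    ultimately obtain \<gamma> g where \<gamma>: "automorphism \<B> \<gamma>" and g: "g \<in> V \<rightarrow>\<^sub>E D"
      and h_eq: "h = compose ?A \<gamma> (t_map V ?F g)"
      using h(2) unfolding surj_closed_def T_set_def by blast
    have sat_t: "sat_atom \<B> (t_map V ?F g) a" if "a \<in> set \<psi>" for a
    proof -
      have "t_map V ?F g \<in> ?A \<rightarrow> universe \<B>"
        using t_map[OF g] by auto
      then show ?thesis
        using automorphism_sat_atom[OF \<gamma>, of "t_map V ?F g" ?A a] over[OF that] h(3) that h_eq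
        by (simp add: sat_def)
    qed
    \<comment> \<open>The remaining entries are limited to \<open>g\<close>
      V\<open>, since the atoms in\<close>\<psi>\<open>can only test values taken by\<close>g\<open>. Representatives are chosen in the same set, so\<close>interchange\<open>applies with\<close>E
      = g \<open>V\<close>.\<close>
    define similar where "similar d d' \<longleftrightarrow> (\<forall>(k, f) \<in> ?F. \<forall>es i. set es \<subseteq> g ` V \<longrightarrow>
      length es = k \<longrightarrow> i < k \<longrightarrow> f (es[i := d]) = f (es[i := d']))" for d d'
    define \<rho> where "\<rho> d = (SOME e. e \<in> g ` V \<and> similar d e)" for d
    have \<rho>: "\<rho> d \<in> g ` V \<and> similar d (\<rho> d)" if "d \<in> g ` V" for d
      unfolding \<rho>_def by (rule someI[of _ d]) (use that in \<open>auto simp: similar_def\<close>)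
    \<comment> \<open>The choice depends only on the set of values similar to \<open>d\<close>, and
      similar elements share this set.\<close>
    have \<rho>_eq: "\<rho> d = \<rho> d'" if "similar d d'" for d d'
    proof -
      have "similar d e \<longleftrightarrow> similar d' e" for e
        using that by (fastforce simp: similar_def)
      then show ?thesis by (simp add: \<rho>_def)
    qed
    define g' where "g' = (\<lambda>v \<in> V. \<rho> (g v))"
    have g'_V: "g' v \<in> g ` V" if "v \<in> V" for v
      using \<rho> that by (simp add: g'_def)
    then have g': "g' \<in> V \<rightarrow>\<^sub>E D"
      using g by (fastforce simp: g'_def)
    have same: "t_map V ?F g' = t_map V ?F g"
    proof
      fix \<alpha> show "t_map V ?F g' \<alpha> = t_map V ?F g \<alpha>"
      proof (cases "\<alpha> \<in> ?A")
        case True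
        then obtain vs k f where \<alpha>: "\<alpha> = (vs, (k, f))" "(k, f) \<in> ?F" "vs \<in> tuples V k"
          by (auto elim: applicationsE)
        have "f (map g vs) = f (map g' vs)"
        proof (rule interchange[where E = "g ` V" and k = k])
          show "f (es[i := map g vs ! i]) = f (es[i := map g' vs ! i])"
            if "i < k" "set es \<subseteq> g ` V" "length es = k" for i es
          proof -
            have "vs ! i \<in> V" "i < length vs"
              using \<alpha>(3) that(1) by (auto simp: tuples_def)
            then have "similar (map g vs ! i) (map g' vs ! i)"
              using \<rho> by (simp add: g'_def)
            then show ?thesis using that \<alpha>(2) by (fastforce simp: similar_def)
          qed
        qed (use \<alpha>(3) g'_V in \<open>auto simp: tuples_def\<close>)
        then show ?thesis using \<alpha> t_map_app[of "(k, f)" ?F vs V] by simp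
      qed (simp add: t_map_def)
    qed
    have "sat_atom \<D> g' a" if a: "a \<in> set \<phi>" for a
    proof (cases a)
      case (Rel R vs)
      then have "Rel R vs \<in> set \<phi>" using a by simp
      moreover have "map_atom (app_of Fs (context_of vs \<sigma>)) (\<tau> R) \<in> set \<psi>"
        using \<psi> calculation by blast
      ultimately show ?thesis
        using Rel_iff[of R vs g'] g' sat_t same Rel by simp
    next
      case (Eq u v)
      then have uv: "u \<in> V" "v \<in> V"
        using a V(3) by (force simp: vars_def)+
      have "similar (g u) (g v)"
        unfolding similar_def case_prod_beta
      proof (intro ballI allI impI)
        fix kf es i
        assume *: "kf \<in> ?F" "set es \<subseteq> g ` V" "length es = fst kf" "i < fst kf"
        then have "es \<in> map g ` lists V"
          by (simp flip: lists_image add: in_lists_conv_set subset_eq)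
        then obtain vs where vs: "es = map g vs" "set vs \<subseteq> V"
          by auto
        then have tup: "vs \<in> tuples V (fst kf)"
          using *(3) by (simp add: tuples_def)
        then have "Eq (vs[i := u], kf) (vs[i := v], kf) \<in> swap_atoms ?F V u v"
          using *(1,4) unfolding swap_atoms_def by blast
        then have "Eq (vs[i := u], kf) (vs[i := v], kf) \<in> set \<psi>"
          using \<psi> a Eq by auto
        from sat_t[OF this] show "snd kf (es[i := g u]) = snd kf (es[i := g v])"
          using *(1) tup uv vs(1) by (simp add: t_map_app update_tuples map_update)
      qed
      then show ?thesis
        using \<rho>_eq uv Eq by (simp add: g'_def)
    qed
    moreover have "sat_atom \<D> (restrict g' (vars \<phi>)) a \<longleftrightarrow> sat_atom \<D> g' a" if "a \<in> set \<phi>" for a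
      using that by (intro sat_atom_cong) (auto simp: vars_def)
    moreover have "restrict g' (vars \<phi>) \<in> vars \<phi> \<rightarrow>\<^sub>E D"
      using g' V(3) by auto
    ultimately show "CSP_yes \<D> \<phi>"
      using D(1) unfolding CSP_yes_def sat_def by blast
  qed
qed


section \<open>The reduction\<close>

subsection \<open>Positions in the word of a formula\<close>

fun atom_mark :: "'v atom \<Rightarrow> nat" where
  "atom_mark (Rel R vs) = 5 + R"
| "atom_mark (Eq u v) = 4"

fun atom_args :: "'v atom \<Rightarrow> 'v list" where
  "atom_args (Rel R vs) = vs"
| "atom_args (Eq u v) = [u, v]"

lemma atom_tok_eq: "atom_tok a = atom_mark a # concat (map var_tok (atom_args a))"
  by (cases a) auto

lemma set_atom_args [simp]: "set (atom_args a) = set_atom a"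
  by (cases a) auto

lemma atom_mark_gt: "3 < atom_mark a"
  by (cases a) auto

lemma bit_sym_less: "bit_sym b < 3" "bit_sym b \<noteq> 3"
  by (auto simp: bit_sym_def)

lemma concat_split:
  assumes "concat xss = xs @ s # ys"
  obtains us zs zs' vs where "xss = us @ (zs @ s # zs') # vs" "xs = concat us @ zs"
    "ys = zs' @ concat vs"
proof -
  have "\<exists>us zs zs' vs. xss = us @ (zs @ s # zs') # vs \<and> xs = concat us @ zs \<and> ys = zs' @ concat vs"
    using assms
  proof (induction xss arbitrary: xs)
    case (Cons x xss)
    then have "x @ concat xss = xs @ s # ys" by simp
    then consider z where "x = xs @ s # z" "ys = z @ concat xss"
      | z where "xs = x @ z" "concat xss = z @ s # ys"
      by (auto simp: append_eq_append_conv2 Cons_eq_append_conv append_eq_Cons_conv)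
    then show ?case
    proof cases
      case 1
      then show ?thesis
        by (intro exI[of _ "[]"] exI[of _ xs] exI[of _ z] exI[of _ xss]) simp
    next
      case 2
      obtain us zs zs' vs where "xss = us @ (zs @ s # zs') # vs" "z = concat us @ zs"
        "ys = zs' @ concat vs"
        using Cons.IH[OF 2(2)] by blast
      then show ?thesis
        using 2(1) by (intro exI[of _ "x # us"] exI[of _ zs] exI[of _ zs'] exI[of _ vs]) simp
    qed
  qed simp
  then show thesis using that by blast
qed

lemma map_eq_split:
  assumes "map f xs = us @ z # vs"
  obtains us' x vs' where "xs = us' @ x # vs'" "map f us' = us" "f x = z" "map f vs' = vs"
  using assms by (auto simp: map_eq_append_conv map_eq_Cons_conv)

lemma positions_iff:
  "i \<in> set (positions A W) \<longleftrightarrow> (\<exists>xs s ys. W = xs @ s # ys \<and> s \<in> A \<and> length xs = i)"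
proof
  assume "i \<in> set (positions A W)"
  then have "i < length W" "W ! i \<in> A"
    by (auto simp: positions_def)
  then show "\<exists>xs s ys. W = xs @ s # ys \<and> s \<in> A \<and> length xs = i"
    by (intro exI[of _ "take i W"] exI[of _ "W ! i"] exI[of _ "drop (Suc i) W"])
      (simp add: id_take_nth_drop[symmetric])
qed (auto simp: positions_def)

lemma length_var_tok [simp]: "length (var_tok v) = Suc (length v)"
  by (simp add: var_tok_def)

lemma last_concat_var_tok: "vs \<noteq> [] \<Longrightarrow> last (concat (map var_tok vs)) = 3 \<and> concat (map var_tok vs) \<noteq> []"
  by (induction vs rule: rev_induct) (auto simp: var_tok_def)

text \<open>The bits of an argument are preceded by the marker of the atom or by the 3 that ends the
  previous argument, so \<open>var_at\<close> stops exactly at their beginning.\<close>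

lemma word_of_var:
  assumes "\<phi> = \<phi>1 @ a # \<phi>2" "atom_args a = as1 @ v # as2"
  defines "xs \<equiv> 3 # concat (map atom_tok \<phi>1) @ atom_mark a # concat (map var_tok as1)"
  shows "word_of \<phi> = (xs @ map bit_sym v) @ 3 # concat (map var_tok as2) @ concat (map atom_tok \<phi>2)"
    and "var_at (word_of \<phi>) (length xs + length v) = v"
proof -
  show eq: "word_of \<phi> = (xs @ map bit_sym v) @ 3 # concat (map var_tok as2) @ concat (map atom_tok \<phi>2)"
    using assms by (simp add: word_of_def atom_tok_eq var_tok_def)
  have "2 < last xs"
    using atom_mark_gt[of a] last_concat_var_tok[of as1] by (cases "as1 = []") (auto simp: xs_def)
  then show "var_at (word_of \<phi>) (length xs + length v) = v"
    unfolding eq using var_at_append[of xs v] by simp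
qed

text \<open>Neither bits nor markers equal 3. So the occurrences of 3 are the leading one, which
  contributes \<open>[]\<close>, and the ends of the variables in the atoms.\<close>

lemma word_of_vars: "var_at (word_of \<phi>) ` set (positions {3} (word_of \<phi>)) = insert [] (vars \<phi>)"
proof
  show "insert [] (vars \<phi>) \<subseteq> var_at (word_of \<phi>) ` set (positions {3} (word_of \<phi>))"
  proof
    fix v assume "v \<in> insert [] (vars \<phi>)"
    then consider "v = []" | a where "a \<in> set \<phi>" "v \<in> set_atom a"
      by (auto simp: vars_def)
    then show "v \<in> var_at (word_of \<phi>) ` set (positions {3} (word_of \<phi>))"
    proof cases
      case 1
      then show ?thesis
        by (intro image_eqI[of _ _ 0]) (simp_all add: positions_iff var_at_def word_of_def)
    next
      case 2
      then obtain \<phi>1 \<phi>2 as1 as2 where *: "\<phi> = \<phi>1 @ a # \<phi>2" "atom_args a = as1 @ v # as2"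
        by (metis split_list set_atom_args)
      let ?xs = "3 # concat (map atom_tok \<phi>1) @ atom_mark a # concat (map var_tok as1)"
      have "length ?xs + length v \<in> set (positions {3} (word_of \<phi>))"
        unfolding positions_iff by (intro exI conjI, rule word_of_var(1)[OF *]) simp_all
      then show ?thesis
        by (rule image_eqI[rotated]) (rule word_of_var(2)[OF *, symmetric])
    qed
  qed
  show "var_at (word_of \<phi>) ` set (positions {3} (word_of \<phi>)) \<subseteq> insert [] (vars \<phi>)"
  proof
    fix v assume "v \<in> var_at (word_of \<phi>) ` set (positions {3} (word_of \<phi>))"
    then obtain xs ys where *: "word_of \<phi> = xs @ 3 # ys" "v = var_at (word_of \<phi>) (length xs)"
      by (auto simp: positions_iff)
    show "v \<in> insert [] (vars \<phi>)"
    proof (cases xs)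
      case Nil
      then show ?thesis using * by (simp add: var_at_def)
    next
      case (Cons x xs')
      then have "concat (map atom_tok \<phi>) = xs' @ 3 # ys"
        using * by (simp add: word_of_def)
      then obtain us zs zs' vs where 1: "map atom_tok \<phi> = us @ (zs @ 3 # zs') # vs"
        "xs' = concat us @ zs" by (rule concat_split)
      obtain \<phi>1 a \<phi>2 where 2: "\<phi> = \<phi>1 @ a # \<phi>2" "map atom_tok \<phi>1 = us" "atom_tok a = zs @ 3 # zs'"
        using 1(1) by (rule map_eq_split)
      obtain zs2 where 3: "zs = atom_mark a # zs2"
        "concat (map var_tok (atom_args a)) = zs2 @ 3 # zs'"
        using 2(3) atom_mark_gt[of a] by (cases zs) (auto simp: atom_tok_eq)
      obtain us2 z z' vs2 where 4: "map var_tok (atom_args a) = us2 @ (z @ 3 # z') # vs2"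
        "zs2 = concat us2 @ z" using 3(2) by (rule concat_split)
      obtain as1 u as2 where 5: "atom_args a = as1 @ u # as2" "map var_tok as1 = us2"
        "var_tok u = z @ 3 # z'"
        using 4(1) by (rule map_eq_split)
      \<comment> \<open>Bits differ from 3, so the 3 found in \<open>var_tok u\<close> is its last
        entry.\<close>
      have "z = map bit_sym u"
        using 5(3) bit_sym_less(2) unfolding var_tok_def
        by (cases z' rule: rev_cases) (auto simp: map_eq_append_conv map_eq_Cons_conv)
      then have "length xs = length (3 # concat (map atom_tok \<phi>1) @ atom_mark a # concat (map var_tok as1)) + length u"
        using Cons 1(2) 2(2) 3(1) 4(2) 5(2) by simp
      then have "v = u"
        using word_of_var(2)[OF 2(1) 5(1)] *(2) by metis
      moreover have "u \<in> set_atom a"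
        using 5(1) by (metis in_set_conv_decomp set_atom_args)
      ultimately show ?thesis using 2(1) by (auto simp: vars_def)
    qed
  qed
qed

lemma next3_append:
  assumes "length xs = Suc i"
  shows "next3 (xs @ map bit_sym v @ 3 # ys) i = length xs + length v"
proof -
  have "takeWhile (\<lambda>s. s \<noteq> 3) (map bit_sym v @ 3 # ys) = map bit_sym v"
    using bit_sym_less(2) by (subst takeWhile_append2) auto
  then show ?thesis using assms by (simp add: next3_def)
qed

lemma arg_pos_word:
  assumes "W = xs @ m # concat (map var_tok vs) @ ys" "k < length vs"
  shows "arg_pos W (length xs) k = length xs + length (concat (map var_tok (take (Suc k) vs)))"
  using assms(2)
proof (induction k)
  case 0
  then obtain v vs' where "vs = v # vs'" by (cases vs) auto
  then show ?case
    using next3_append[of "xs @ [m]" "length xs" v "concat (map var_tok vs') @ ys"] assms(1)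
    by (simp add: arg_pos_def var_tok_def)
next
  case (Suc k)
  let ?p = "length xs + length (concat (map var_tok (take (Suc k) vs)))"
  let ?xs = "xs @ m # concat (map var_tok (take (Suc k) vs))"
  have "vs = take (Suc k) vs @ vs ! Suc k # drop (Suc (Suc k)) vs"
    using Suc.prems by (simp add: id_take_nth_drop)
  then have "concat (map var_tok vs) = concat (map var_tok (take (Suc k) vs)) @
      map bit_sym (vs ! Suc k) @ 3 # concat (map var_tok (drop (Suc (Suc k)) vs))"
    by (metis (no_types, lifting) append.assoc append_Cons append_Nil concat.simps(2) concat_append
        list.simps(9) map_append var_tok_def)
  then have "W = ?xs @ map bit_sym (vs ! Suc k) @ 3 # concat (map var_tok (drop (Suc (Suc k)) vs)) @ ys"
    using assms(1) by simp
  then have "next3 W ?p = length ?xs + length (vs ! Suc k)"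
    using next3_append[of ?xs ?p] by simp
  moreover have "arg_pos W (length xs) (Suc k) = next3 W (arg_pos W (length xs) k)"
    by (simp add: arg_pos_def)
  moreover have "take (Suc (Suc k)) vs = take (Suc k) vs @ [vs ! Suc k]"
    using Suc.prems by (simp add: take_Suc_conv_app_nth)
  ultimately show ?case
    using Suc by simp
qed

lemma word_of_arg:
  assumes \<phi>: "\<phi> = \<phi>1 @ a # \<phi>2" and k: "k < length (atom_args a)"
  defines "i \<equiv> length (3 # concat (map atom_tok \<phi>1))"
  shows "has_arg (word_of \<phi>) i k"
    and "var_at (word_of \<phi>) (arg_pos (word_of \<phi>) i k) = atom_args a ! k"
proof -
  let ?vs = "atom_args a" and ?W = "word_of \<phi>"
  let ?xs = "3 # concat (map atom_tok \<phi>1)"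
  have split: "?vs = take k ?vs @ ?vs ! k # drop (Suc k) ?vs"
    using k by (simp add: id_take_nth_drop)
  have W: "?W = ?xs @ atom_mark a # concat (map var_tok ?vs) @ concat (map atom_tok \<phi>2)"
    using \<phi> by (simp add: word_of_def atom_tok_eq)
  have pos: "arg_pos ?W i k = i + length (concat (map var_tok (take (Suc k) ?vs)))"
    unfolding i_def by (rule arg_pos_word[OF W k])
  also have "take (Suc k) ?vs = take k ?vs @ [?vs ! k]"
    using k by (simp add: take_Suc_conv_app_nth)
  finally have "arg_pos ?W i k = length (3 # concat (map atom_tok \<phi>1) @ atom_mark a #
      concat (map var_tok (take k ?vs))) + length (?vs ! k)"
    by (simp add: i_def)
  then show "var_at ?W (arg_pos ?W i k) = ?vs ! k"
    using word_of_var(2)[OF \<phi> split] by simp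
  have C: "\<forall>s \<in> set (concat (map var_tok ?vs)). s \<le> 3"
    using bit_sym_less(1) by (auto simp: var_tok_def intro: less_imp_le)
  have le: "length (concat (map var_tok (take (Suc k) ?vs))) \<le> length (concat (map var_tok ?vs))"
    using concat_append[of "map var_tok (take (Suc k) ?vs)" "map var_tok (drop (Suc k) ?vs)"]
    by (metis append_take_drop_id le_add1 length_append map_append)
  have "0 < length (concat (map var_tok (take (Suc k) ?vs)))"
    using k by (cases ?vs) (auto simp: var_tok_def)
  moreover have "?W ! i = atom_mark a"
    unfolding W i_def by simp
  moreover have "?W ! l \<le> 3" if "i < l" "l \<le> arg_pos ?W i k" for l
  proof -
    have "l - Suc i < length (concat (map var_tok ?vs))"
      using that pos le by linarith
    moreover have "?W ! l = concat (map var_tok ?vs) ! (l - Suc i)"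
      using that(1) calculation unfolding W i_def by (auto simp: nth_append nth_Cons')
    ultimately show ?thesis
      using C by (metis nth_mem)
  qed
  moreover have "arg_pos ?W i k < length ?W"
    using pos le unfolding W by (simp add: i_def)
  ultimately show "has_arg ?W i k"
    unfolding has_arg_def using pos atom_mark_gt[of a] by simp
qed

text \<open>Variables are written with symbols up to 3, so a larger symbol can only open an
  atom.\<close>

lemma word_of_marks:
  assumes "3 < m"
  shows "i \<in> set (positions {m} (word_of \<phi>)) \<longleftrightarrow> (\<exists>\<phi>1 a \<phi>2. \<phi> = \<phi>1 @ a # \<phi>2 \<and> atom_mark a = m \<and>
    i = length (3 # concat (map atom_tok \<phi>1)))"
proof
  assume "i \<in> set (positions {m} (word_of \<phi>))"
  then obtain xs ys where *: "word_of \<phi> = xs @ m # ys" "length xs = i"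
    by (auto simp: positions_iff)
  then obtain xs' where xs: "xs = 3 # xs'" "concat (map atom_tok \<phi>) = xs' @ m # ys"
    using assms by (cases xs) (auto simp: word_of_def)
  obtain us zs zs' vs where 1: "map atom_tok \<phi> = us @ (zs @ m # zs') # vs" "xs' = concat us @ zs"
    using xs(2) by (rule concat_split)
  obtain \<phi>1 a \<phi>2 where 2: "\<phi> = \<phi>1 @ a # \<phi>2" "map atom_tok \<phi>1 = us" "atom_tok a = zs @ m # zs'"
    using 1(1) by (rule map_eq_split)
  have "\<forall>s \<in> set (concat (map var_tok (atom_args a))). s \<le> 3"
    using bit_sym_less(1) by (auto simp: var_tok_def intro: less_imp_le)
  then have "m \<notin> set (concat (map var_tok (atom_args a)))"
    using assms by (metis not_le)
  then have "zs = []"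
    using 2(3) by (cases zs) (simp_all add: atom_tok_eq del: set_concat)
  then show "\<exists>\<phi>1 a \<phi>2. \<phi> = \<phi>1 @ a # \<phi>2 \<and> atom_mark a = m \<and> i = length (3 # concat (map atom_tok \<phi>1))"
    using * xs 1 2 by (intro exI[of _ \<phi>1] exI[of _ a] exI[of _ \<phi>2]) (simp add: atom_tok_eq)
next
  assume "\<exists>\<phi>1 a \<phi>2. \<phi> = \<phi>1 @ a # \<phi>2 \<and> atom_mark a = m \<and> i = length (3 # concat (map atom_tok \<phi>1))"
  then obtain \<phi>1 a \<phi>2 where *: "\<phi> = \<phi>1 @ a # \<phi>2" "atom_mark a = m"
    "i = length (3 # concat (map atom_tok \<phi>1))" by blast
  have "word_of \<phi> = (3 # concat (map atom_tok \<phi>1)) @ m #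
      concat (map var_tok (atom_args a)) @ concat (map atom_tok \<phi>2)"
    using * by (simp add: word_of_def atom_tok_eq)
  then show "i \<in> set (positions {m} (word_of \<phi>))"
    using *(3) unfolding positions_iff by blast
qed


subsection \<open>Output blocks\<close>

lemma map_block: "map g (block A js W f) = block A js W (\<lambda>ps. map g (f ps))"
proof -
  have "map g (nest W js f ps) = nest W js (\<lambda>ps. map g (f ps)) ps" for ps
    by (induction js arbitrary: ps) (simp_all add: map_concat comp_def)
  then show ?thesis by (simp add: block_def map_concat comp_def)
qed

text \<open>\<open>C\<close> collects the argument lists of the atoms with a marker in \<open>A\<close>.\<close>

lemma set_block_vars:
  assumes js: "distinct js" "2 \<notin> set js"
    and V: "var_at W ` set (positions {3} W) = V"
    and C1: "\<And>i. i \<in> set (positions A W) \<Longrightarrow> \<exists>c \<in> C. \<forall>k \<in> K. var_at W (arg_pos W i k) = c ! k"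
    and C2: "\<And>c. c \<in> C \<Longrightarrow> \<exists>i \<in> set (positions A W). \<forall>k \<in> K. var_at W (arg_pos W i k) = c ! k"
    and H: "\<And>x d d'. x \<in> set xs \<Longrightarrow> (\<And>r. r \<in> Head ` set js \<union> Arg ` K \<Longrightarrow> d r = d' r) \<Longrightarrow> H d x = H d' x"
  shows "set (block A js W (\<lambda>ps. map (H (deref W ps)) xs)) =
    {H (context_of c \<sigma>) x | c \<sigma> x. c \<in> C \<and> (\<forall>j \<in> set js. \<sigma> j \<in> V) \<and> x \<in> set xs}"
    (is "?L = ?R")
proof
  let ?ps = "\<lambda>i p j. if j \<in> set js then int (p j) else ((\<lambda>_. 0)(2 := int i)) j"
  have L: "?L = (\<Union>i \<in> set (positions A W). \<Union>p \<in> {p. \<forall>j \<in> set js. p j \<in> set (positions {3} W)}.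
      H (deref W (?ps i p)) ` set xs)"
    by (simp add: block_def set_nest[OF js(1)])
  \<comment> \<open>By the congruence assumption on \<open>H\<close> only heads in \<open>js\<close>
    and arguments in \<open>K\<close> have to be compared; since 2 is not in \<open>js\<close>, head
    2 is at \<open>i\<close> throughout the inner loops.\<close>
  have deref: "H (deref W (?ps i p)) x = H (context_of c \<sigma>) x"
    if "x \<in> set xs" "\<forall>k \<in> K. var_at W (arg_pos W i k) = c ! k" "\<forall>j \<in> set js. var_at W (p j) = \<sigma> j"
    for i p x c \<sigma>
    using that js(2) by (intro H) auto
  show "?L \<subseteq> ?R"
  proof
    fix y assume "y \<in> ?L"
    then obtain i p x where i: "i \<in> set (positions A W)" and p: "\<forall>j \<in> set js. p j \<in> set (positions {3} W)"
      and x: "x \<in> set xs" "y = H (deref W (?ps i p)) x"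
      unfolding L by blast
    obtain c where c: "c \<in> C" "\<forall>k \<in> K. var_at W (arg_pos W i k) = c ! k"
      using C1[OF i] by blast
    have "y = H (context_of c (\<lambda>j. var_at W (p j))) x"
      using deref[OF x(1) c(2)] x(2) by simp
    moreover have "\<forall>j \<in> set js. var_at W (p j) \<in> V"
      using p V by blast
    ultimately show "y \<in> ?R" using c(1) x(1) by blast
  qed
  show "?R \<subseteq> ?L"
  proof
    fix y assume "y \<in> ?R"
    then obtain c \<sigma> x where c: "c \<in> C" and \<sigma>: "\<forall>j \<in> set js. \<sigma> j \<in> V" and x: "x \<in> set xs"
      "y = H (context_of c \<sigma>) x" by blast
    obtain i where i: "i \<in> set (positions A W)" "\<forall>k \<in> K. var_at W (arg_pos W i k) = c ! k"
      using C2[OF c] by blast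
    have "\<forall>j \<in> set js. \<exists>q. q \<in> set (positions {3} W) \<and> var_at W q = \<sigma> j"
      using \<sigma> V by fastforce
    then obtain p where p: "\<forall>j \<in> set js. p j \<in> set (positions {3} W) \<and> var_at W (p j) = \<sigma> j"
      by metis
    then have "y = H (deref W (?ps i p)) x"
      using deref[OF x(1) i(2), of p \<sigma>] x(2) by simp
    then show "y \<in> ?L"
      unfolding L using i(1) p x(1) by blast
  qed
qed

section \<open>Finite lists of templates and their instances\<close>

lemma fapps_iff: "x \<in> fapps Fs rs \<longleftrightarrow> fst x < length Fs \<and> snd x \<in> tuples rs (fst (Fs ! fst x))"
  by (cases x) (auto simp: fapps_def)

lemma app_of_cong:
  assumes "set_atom x \<subseteq> fapps Fs rs" "\<And>r. r \<in> rs \<Longrightarrow> d r = d' r"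
  shows "map_atom (app_of Fs d) x = map_atom (app_of Fs d') x"
proof (rule atom.map_cong0)
  fix z assume "z \<in> set_atom x"
  then have "z \<in> fapps Fs rs"
    using assms(1) by blast
  then have "set (snd z) \<subseteq> rs"
    by (simp add: fapps_iff tuples_def)
  then show "app_of Fs d z = app_of Fs d' z"
    using assms(2) by (auto simp: app_of_def)
qed

text \<open>The heads that range over variables are numbered from 3, after the input, the automaton
  state and the pointer to an atom. Heads beyond the tuple get an arbitrary variable.\<close>

lemma ex_assignment:
  assumes "vs \<in> tuples V k" "V \<noteq> {}"
  shows "\<exists>\<sigma>. (\<forall>j. \<sigma> j \<in> V) \<and> map \<sigma> [3..<3 + k] = vs"
proof -
  obtain v0 where "v0 \<in> V" using assms(2) by blast
  then have "\<forall>j. (if j - 3 < k then vs ! (j - 3) else v0) \<in> V"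
    using assms(1) by (auto simp: tuples_def)
  moreover have "map (\<lambda>j. if j - 3 < k then vs ! (j - 3) else v0) [3..<3 + k] = vs"
    using assms(1) by (intro nth_equalityI) (auto simp: tuples_def)
  ultimately show ?thesis
    by (intro exI[of _ "\<lambda>j. if j - 3 < k then vs ! (j - 3) else v0"] conjI)
qed

definition all_apps :: "('d, 'b) enc_map list \<Rightarrow> fapp list" where
  "all_apps Fs = map (\<lambda>j. (j, map Head [3..<3 + fst (Fs ! j)])) [0..<length Fs]"

text \<open>One template per encoding map is enough: its heads are pairwise different and run
  through \<open>V\<close> independently, so every tuple of variables arises.\<close>

lemma all_apps_eq:
  assumes "V \<noteq> {}" "\<And>kf. kf \<in> set Fs \<Longrightarrow> fst kf \<le> M"
  shows "{app_of Fs (context_of c \<sigma>) x | c \<sigma> x. c \<in> {[]} \<and>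
      (\<forall>j \<in> set [3..<3 + M]. \<sigma> j \<in> V) \<and> x \<in> set (all_apps Fs)} = applications V (set Fs)"
    (is "?L = ?R")
proof
  show "?L \<subseteq> ?R"
  proof
    fix \<alpha> assume "\<alpha> \<in> ?L"
    then obtain \<sigma> j where *: "\<forall>j \<in> set [3..<3 + M]. \<sigma> j \<in> V" "j < length Fs"
      "\<alpha> = (map \<sigma> [3..<3 + fst (Fs ! j)], Fs ! j)"
      by (auto simp: all_apps_def app_of_def comp_def)
    then show "\<alpha> \<in> ?R"
      using assms(2)[OF nth_mem[OF *(2)]] by (auto simp: tuples_def)
  qed
  show "?R \<subseteq> ?L"
  proof
    fix \<alpha> assume "\<alpha> \<in> ?R"
    then obtain vs kf where \<alpha>: "\<alpha> = (vs, kf)" "kf \<in> set Fs" "vs \<in> tuples V (fst kf)"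
      by (rule applicationsE)
    obtain j where j: "j < length Fs" "Fs ! j = kf"
      using \<alpha>(2) by (auto simp: in_set_conv_nth)
    obtain \<sigma> where \<sigma>: "\<forall>j. \<sigma> j \<in> V" "map \<sigma> [3..<3 + fst kf] = vs"
      using ex_assignment[OF \<alpha>(3) assms(1)] by blast
    have "\<alpha> = app_of Fs (context_of [] \<sigma>) (j, map Head [3..<3 + fst (Fs ! j)])"
      using \<sigma>(2) j \<alpha>(1) by (simp add: app_of_def comp_def)
    moreover have "(j, map Head [3..<3 + fst (Fs ! j)]) \<in> set (all_apps Fs)"
      using j(1) by (auto simp: all_apps_def)
    ultimately show "\<alpha> \<in> ?L" using \<sigma>(1) by blast
  qed
qed

text \<open>Head 2 stands at an equality, whose sides are \<open>Arg 0\<close> and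
  \<open>Arg 1\<close>. They replace the head in slot \<open>i\<close>; the other slots are filled
  by free heads.\<close>

definition swap_templates :: "('d, 'b) enc_map list \<Rightarrow> fapp atom list" where
  "swap_templates Fs = concat (map (\<lambda>j. map (\<lambda>i. let hs = map Head [3..<3 + fst (Fs ! j)] in
     Eq (j, hs[i := Arg 0]) (j, hs[i := Arg 1])) [0..<fst (Fs ! j)]) [0..<length Fs])"

lemma swap_templates_fapps:
  assumes "\<And>kf. kf \<in> set Fs \<Longrightarrow> fst kf \<le> M" "x \<in> set (swap_templates Fs)"
  shows "set_atom x \<subseteq> fapps Fs (Head ` set [3..<3 + M] \<union> Arg ` {..<2})"
proof -
  obtain j i where x: "j < length Fs"
    "x = Eq (j, (map Head [3..<3 + fst (Fs ! j)])[i := Arg 0]) (j, (map Head [3..<3 + fst (Fs ! j)])[i := Arg 1])"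
    using assms(2) by (auto simp: swap_templates_def Let_def)
  have "fst (Fs ! j) \<le> M"
    using assms(1) x(1) by simp
  then have "set ((map Head [3..<3 + fst (Fs ! j)])[i := Arg k]) \<subseteq> Head ` set [3..<3 + M] \<union> Arg ` {..<2}"
    if "k < 2" for k
    using that by (intro order_trans[OF set_update_subset_insert]) auto
  from this[of 0] this[of 1] show ?thesis
    using x by (simp add: fapps_def tuples_def)
qed

lemma swap_templates_eq:
  assumes "V \<noteq> {}" "\<And>kf. kf \<in> set Fs \<Longrightarrow> fst kf \<le> M"
  shows "{map_atom (app_of Fs (context_of c \<sigma>)) x | c \<sigma> x. c \<in> {[u, v] | u v. Eq u v \<in> set \<phi>} \<and>
      (\<forall>j \<in> set [3..<3 + M]. \<sigma> j \<in> V) \<and> x \<in> set (swap_templates Fs)} =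
    (\<Union>(u, v) \<in> {(u, v). Eq u v \<in> set \<phi>}. swap_atoms (set Fs) V u v)"
    (is "?L = ?R")
proof
  show "?L \<subseteq> ?R"
  proof
    fix y assume "y \<in> ?L"
    then obtain u v \<sigma> i j where *: "Eq u v \<in> set \<phi>" "\<forall>j \<in> set [3..<3 + M]. \<sigma> j \<in> V" "j < length Fs"
      "i < fst (Fs ! j)" "y = Eq ((map \<sigma> [3..<3 + fst (Fs ! j)])[i := u], Fs ! j)
        ((map \<sigma> [3..<3 + fst (Fs ! j)])[i := v], Fs ! j)"
      by (auto simp: swap_templates_def app_of_def Let_def map_update comp_def)
    have "map \<sigma> [3..<3 + fst (Fs ! j)] \<in> tuples V (fst (Fs ! j))"
      using assms(2)[OF nth_mem[OF *(3)]] *(2) by (auto simp: tuples_def)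
    then have "y \<in> swap_atoms (set Fs) V u v"
      unfolding swap_atoms_def using * nth_mem[OF *(3)] by blast
    then show "y \<in> ?R" using *(1) by blast
  qed
  show "?R \<subseteq> ?L"
  proof
    fix y assume "y \<in> ?R"
    then obtain u v where uv: "Eq u v \<in> set \<phi>" "y \<in> swap_atoms (set Fs) V u v" by blast
    then obtain vs i kf where y: "y = Eq (vs[i := u], kf) (vs[i := v], kf)" "kf \<in> set Fs"
      "vs \<in> tuples V (fst kf)" "i < fst kf"
      by (auto simp: swap_atoms_def)
    obtain j where j: "j < length Fs" "Fs ! j = kf"
      using y(2) by (auto simp: in_set_conv_nth)
    obtain \<sigma> where \<sigma>: "\<forall>j. \<sigma> j \<in> V" "map \<sigma> [3..<3 + fst kf] = vs"
      using ex_assignment[OF y(3) assms(1)] by blast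
    let ?hs = "map Head [3..<3 + fst (Fs ! j)]"
    let ?x = "Eq (j, ?hs[i := Arg 0]) (j, ?hs[i := Arg 1])"
    have "map_atom (app_of Fs (context_of [u, v] \<sigma>)) ?x = y"
      using y(1) j \<sigma>(2) by (simp add: app_of_def map_update comp_def)
    moreover have "?x \<in> set (swap_templates Fs)"
      using j y(4) by (auto simp: swap_templates_def Let_def intro!: bexI[of _ j] imageI)
    ultimately show "y \<in> ?L" using \<sigma>(1) uv(1) by blast
  qed
qed

text \<open>Validity is tested on the values of the heads, without any reference to
  \<open>V\<close>. The templates thus form a fixed finite set that can be built into the
  program.\<close>

definition valid_templates ::
    "'b rel_struct \<Rightarrow> 'd set \<Rightarrow> ('d, 'b) enc_map list \<Rightarrow> nat \<Rightarrow> fapp atom set" where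
  "valid_templates \<B> D Fs M = {a. atom_over \<B> a \<and> set_atom a \<subseteq> fapps Fs (Head ` set [3..<3 + M]) \<and>
     (\<forall>g. (\<forall>j \<in> set [3..<3 + M]. g (Head j) \<in> D) \<longrightarrow> sat_atom \<B> (fapp_value Fs g) a)}"

lemma finite_tuples: "finite A \<Longrightarrow> finite (tuples A k)"
  unfolding tuples_def by (rule finite_lists_length_eq)

lemma finite_valid_templates:
  assumes "finite (symbols \<B>)"
  shows "finite (valid_templates \<B> D Fs M)"
proof -
  let ?A = "fapps Fs (Head ` set [3..<3 + M])"
  have "?A \<subseteq> (\<Union>j \<in> {..<length Fs}. Pair j ` tuples (Head ` set [3..<3 + M]) (fst (Fs ! j)))"
    by (auto simp: fapps_def)
  then have A: "finite ?A"
    by (rule finite_subset) (simp add: finite_tuples)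
  have "valid_templates \<B> D Fs M \<subseteq>
      (\<Union>R \<in> symbols \<B>. Rel R ` tuples ?A (arity \<B> R)) \<union> case_prod Eq ` (?A \<times> ?A)"
  proof
    fix a assume "a \<in> valid_templates \<B> D Fs M"
    then show "a \<in> (\<Union>R \<in> symbols \<B>. Rel R ` tuples ?A (arity \<B> R)) \<union> case_prod Eq ` (?A \<times> ?A)"
      by (cases a) (auto simp: valid_templates_def tuples_def image_iff)
  qed
  then show ?thesis
    by (rule finite_subset) (intro finite_UnI finite_UN_I finite_imageI finite_SigmaI finite_tuples A assms)
qed

text \<open>An assignment of \<open>V\<close> composed with a substitution is an assignment of the
  heads, so instances of valid templates are valid. Conversely, the variables of a valid atom are
  renamed injectively to heads; an assignment of these heads comes from one of \<open>V\<close>, so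
  the resulting template is valid, and undoing the renaming gives back the atom.\<close>

lemma valid_templates_eq:
  assumes V: "finite V" "V \<noteq> {}" and D: "D \<noteq> {}"
    and M: "\<And>kf. kf \<in> set Fs \<Longrightarrow> fst kf \<le> K" "\<And>R. R \<in> symbols \<B> \<Longrightarrow> arity \<B> R * K \<le> M" "2 * K \<le> M"
  shows "{map_atom (app_of Fs (context_of c \<sigma>)) x | c \<sigma> x. c \<in> {[]} \<and>
      (\<forall>j \<in> set [3..<3 + M]. \<sigma> j \<in> V) \<and> x \<in> valid_templates \<B> D Fs M} = valid_atoms \<B> D (set Fs) V"
    (is "?L = ?R")
proof
  let ?J = "set [3..<3 + M]"
  show "?L \<subseteq> ?R"
  proof
    fix y assume "y \<in> ?L"
    then obtain \<sigma> x where \<sigma>: "\<forall>j \<in> ?J. \<sigma> j \<in> V" and x: "x \<in> valid_templates \<B> D Fs M"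
      and y: "y = map_atom (app_of Fs (context_of [] \<sigma>)) x" by blast
    let ?d = "context_of [] \<sigma>"
    have app: "app_of Fs ?d z \<in> applications V (set Fs)" if "z \<in> set_atom x" for z
    proof -
      have "fst z < length Fs" "snd z \<in> tuples (Head ` ?J) (fst (Fs ! fst z))"
        using x that by (auto simp: valid_templates_def fapps_def)
      then have "map ?d (snd z) \<in> tuples V (fst (Fs ! fst z))"
        using \<sigma> by (auto simp: tuples_def)
      then show ?thesis using \<open>fst z < length Fs\<close> by (simp add: app_of_def)
    qed
    have "sat_atom \<B> t y" if "t \<in> T_set D (set Fs) V" for t
    proof -
      obtain g where g: "g \<in> V \<rightarrow>\<^sub>E D" "t = t_map V (set Fs) g"
        using \<open>t \<in> _\<close> by (auto simp: T_set_def)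
      have "\<forall>j \<in> ?J. g (?d (Head j)) \<in> D"
        using \<sigma> g(1) by auto
      moreover have "sat_atom \<B> (fapp_value Fs g) x" if "\<forall>j \<in> ?J. g (Head j) \<in> D" for g
        using x that by (simp add: valid_templates_def)
      ultimately have "sat_atom \<B> (fapp_value Fs (\<lambda>r. g (?d r))) x"
        by simp
      moreover have "fapp_value Fs (\<lambda>r. g (?d r)) z = t (app_of Fs ?d z)" if "z \<in> set_atom x" for z
        using app[OF that] g(2) by (simp add: app_of_def t_map_app fapp_value_def comp_def)
      ultimately show ?thesis
        using sat_atom_cong[of x "fapp_value Fs (\<lambda>r. g (?d r))"] by (simp add: y sat_atom_map_atom)
    qed
    then show "y \<in> ?R"
      using x app by (auto simp: valid_atoms_def valid_templates_def y atom.set_map)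
  qed
  show "?R \<subseteq> ?L"
  proof
    fix y assume y: "y \<in> ?R"
    define X where "X = (\<Union>\<alpha> \<in> set_atom y. set (fst \<alpha>))"
    have fin: "finite (set_atom y)"
      by (cases y) auto
    have app: "snd \<alpha> \<in> set Fs" "fst \<alpha> \<in> tuples V (fst (snd \<alpha>))" if "\<alpha> \<in> set_atom y" for \<alpha>
      using y that by (auto simp: valid_atoms_def elim!: applicationsE dest!: subsetD)
    \<comment> \<open>The number of applications is at most the arity of the symbol, or 2 for an
      equality, and each application has at most \<open>K\<close> variables.\<close>
    have "card (set_atom y) * K \<le> M"
    proof (cases y)
      case (Rel R vs)
      then have R: "R \<in> symbols \<B>" "length vs = arity \<B> R"
        using y by (auto simp: valid_atoms_def)
      then have "card (set_atom y) * K \<le> arity \<B> R * K"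
        using Rel card_length[of vs] by simp
      then show ?thesis using M(2)[OF R(1)] by linarith
    next
      case (Eq \<alpha> \<beta>)
      then have "card (set_atom y) \<le> 2"
        by (simp add: card_insert_if)
      then show ?thesis using M(3) by (meson le_trans mult_le_mono1)
    qed
    moreover have "card X \<le> (\<Sum>\<alpha> \<in> set_atom y. card (set (fst \<alpha>)))"
      unfolding X_def using fin by (rule card_UN_le)
    moreover have "(\<Sum>\<alpha> \<in> set_atom y. card (set (fst \<alpha>))) \<le> of_nat (card (set_atom y)) * K"
    proof (rule sum_bounded_above)
      fix \<alpha> assume "\<alpha> \<in> set_atom y"
      then show "card (set (fst \<alpha>)) \<le> K"
        using app[of \<alpha>] M(1)[of "snd \<alpha>"] card_length[of "fst \<alpha>"] by (auto simp: tuples_def)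
    qed
    ultimately have "card X \<le> card ?J"
      by simp
    moreover have "finite X"
      using fin by (simp add: X_def)
    ultimately obtain \<rho> where \<rho>: "\<rho> ` X \<subseteq> ?J" "inj_on \<rho> X"
      using card_le_inj[of X ?J] by auto
    obtain v0 where v0: "v0 \<in> V" using V(2) by blast
    \<comment> \<open>This undoes the renaming on the heads in use; the other heads get the
      arbitrary variable \<open>v0\<close>.\<close>
    define \<sigma> where "\<sigma> j = (if j \<in> \<rho> ` X then inv_into X \<rho> j else v0)" for j
    have \<sigma>\<rho>: "\<sigma> (\<rho> v) = v" if "v \<in> X" for v
      using that \<rho>(2) by (simp add: \<sigma>_def)
    have "X \<subseteq> V"
      using app by (fastforce simp: X_def tuples_def)
    then have \<sigma>_V: "\<sigma> j \<in> V" for j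
      using v0 by (auto simp: \<sigma>_def inv_into_into)
    define idx where "idx kf = (SOME j. j < length Fs \<and> Fs ! j = kf)" for kf
    have idx: "idx kf < length Fs" "Fs ! idx kf = kf" if "kf \<in> set Fs" for kf
      using someI_ex[of "\<lambda>j. j < length Fs \<and> Fs ! j = kf"] that
      unfolding idx_def in_set_conv_nth by auto
    define fa where "fa \<alpha> = (idx (snd \<alpha>), map (\<lambda>v. Head (\<rho> v)) (fst \<alpha>))"
      for \<alpha> :: "('a, 'b) application"
    have X: "v \<in> X" if "\<alpha> \<in> set_atom y" "v \<in> set (fst \<alpha>)" for \<alpha> v
      using that by (auto simp: X_def)
    have "app_of Fs (context_of [] \<sigma>) (fa \<alpha>) = \<alpha>" if "\<alpha> \<in> set_atom y" for \<alpha>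
      using idx(2)[OF app(1)[OF that]] X[OF that] \<sigma>\<rho>
      by (cases \<alpha>) (auto simp: app_of_def fa_def intro!: map_idI)
    then have "map_atom (\<lambda>\<alpha>. app_of Fs (context_of [] \<sigma>) (fa \<alpha>)) y = map_atom (\<lambda>\<alpha>. \<alpha>) y"
      by (intro atom.map_cong0)
    then have "map_atom (app_of Fs (context_of [] \<sigma>)) (map_atom fa y) = y"
      by (simp add: atom.map_comp comp_def atom.map_ident)
    moreover have "map_atom fa y \<in> valid_templates \<B> D Fs M"
      unfolding valid_templates_def
    proof (intro CollectI conjI allI impI)
      show "atom_over \<B> (map_atom fa y)"
        using y by (simp add: valid_atoms_def)
      show "set_atom (map_atom fa y) \<subseteq> fapps Fs (Head ` ?J)"
      proof
        fix z assume "z \<in> set_atom (map_atom fa y)"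
        then obtain \<alpha> where \<alpha>: "\<alpha> \<in> set_atom y" "z = fa \<alpha>"
          by (auto simp: atom.set_map)
        have "set (map (\<lambda>v. Head (\<rho> v)) (fst \<alpha>)) \<subseteq> Head ` ?J"
          using X[OF \<alpha>(1)] \<rho>(1) by fastforce
        then show "z \<in> fapps Fs (Head ` ?J)"
          using app[OF \<alpha>(1)] idx \<alpha>(2) by (simp add: fa_def fapps_def tuples_def)
      qed
      fix g assume g: "\<forall>j \<in> ?J. g (Head j) \<in> D"
      obtain d0 where d0: "d0 \<in> D" using D by blast
      \<comment> \<open>Each variable of \<open>y\<close> gets the value of its head, so the atom
        under \<open>g'\<close> and the template under \<open>g\<close> have the same value.\<close>
      define g' where "g' = (\<lambda>v \<in> V. if v \<in> X then g (Head (\<rho> v)) else d0)"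
      have g': "g' \<in> V \<rightarrow>\<^sub>E D"
        using g \<rho>(1) d0 by (auto simp: g'_def image_subset_iff)
      then have "sat_atom \<B> (t_map V (set Fs) g') y"
        using y by (auto simp: valid_atoms_def T_set_def)
      moreover have "t_map V (set Fs) g' \<alpha> = fapp_value Fs g (fa \<alpha>)" if "\<alpha> \<in> set_atom y" for \<alpha>
      proof -
        have "map g' (fst \<alpha>) = map (\<lambda>v. g (Head (\<rho> v))) (fst \<alpha>)"
          using X[OF that] \<open>X \<subseteq> V\<close> by (auto simp: g'_def)
        then show ?thesis
          using app[OF that] idx(2)[OF app(1)[OF that]] t_map_app[of "snd \<alpha>" "set Fs" "fst \<alpha>" V g']
          by (simp add: fapp_value_def fa_def comp_def del: map_eq_conv)
      qed
      ultimately show "sat_atom \<B> (fapp_value Fs g) (map_atom fa y)"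
        using sat_atom_cong[of y "t_map V (set Fs) g'"] by (simp add: sat_atom_map_atom)
    qed
    ultimately show "y \<in> ?L"
      using \<sigma>_V by (auto intro!: exI[of _ \<sigma>] exI[of _ "map_atom fa y"])
  qed
qed


lemma app_refs_subset: "set_atom a \<subseteq> fapps Fs rs \<Longrightarrow> app_refs a \<subseteq> rs"
  by (force simp: app_refs_def fapps_iff tuples_def)

section \<open>Words as names of applications\<close>

lemma concat_enc_var_inj:
  assumes "length vs = length ws" "concat (map enc_var vs) = concat (map enc_var ws)"
  shows "vs = ws"
  using assms
proof (induction vs ws rule: list_induct2)
  case (Cons v vs w ws)
  have "enc_var v @ concat (map enc_var vs) = enc_var w @ concat (map enc_var ws)"
    using Cons.prems by simp
  then have "v = w" "concat (map enc_var vs) = concat (map enc_var ws)"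
    using self_delimiting_enc_var unfolding self_delimiting_def by blast+
  then show ?case using Cons.IH by simp
qed simp

definition app_var :: "('d, 'b) enc_map list \<Rightarrow> ('d, 'b) application \<Rightarrow> var" where
  "app_var Fs \<alpha> = app_name (THE j. j < length Fs \<and> Fs ! j = snd \<alpha>) (fst \<alpha>)"

lemma the_index:
  assumes "distinct Fs" "j < length Fs"
  shows "(THE i. i < length Fs \<and> Fs ! i = Fs ! j) = j"
  using assms by (intro the_equality) (auto simp: nth_eq_iff_index_eq)

lemma app_var_app_of:
  assumes "distinct Fs" "fst x < length Fs"
  shows "app_var Fs (app_of Fs (deref W ps) x) = instantiate W ps x"
  using the_index[OF assms] by (simp add: app_var_def app_of_def instantiate_def)

text \<open>The unary index, ended by the first \<open>False\<close>, determines the encoding map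
  and thereby the number of arguments. With this number known, the self-delimiting codes of the
  arguments can be separated.\<close>

lemma inj_on_app_var:
  assumes "distinct Fs"
  shows "inj_on (app_var Fs) (applications V (set Fs))"
proof (rule inj_onI)
  fix \<alpha> \<beta>
  assume "\<alpha> \<in> applications V (set Fs)" "\<beta> \<in> applications V (set Fs)"
    and eq: "app_var Fs \<alpha> = app_var Fs \<beta>"
  then obtain vs kf ws kf' where
    \<alpha>: "\<alpha> = (vs, kf)" "kf \<in> set Fs" "length vs = fst kf" and
    \<beta>: "\<beta> = (ws, kf')" "kf' \<in> set Fs" "length ws = fst kf'"
    by (auto elim!: applicationsE simp: tuples_def)
  then obtain i j where ij: "i < length Fs" "Fs ! i = kf" "j < length Fs" "Fs ! j = kf'"
    by (metis in_set_conv_nth)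
  have "app_name i vs = app_name j ws"
    using eq the_index[OF assms ij(1)] the_index[OF assms ij(3)] \<alpha>(1) \<beta>(1) ij
    by (simp add: app_var_def)
  then have "i = j \<and> concat (map enc_var vs) = concat (map enc_var ws)"
    unfolding app_name_def by (rule replicate_True_append_False_eq)
  then show "\<alpha> = \<beta>"
    using \<alpha> \<beta> ij concat_enc_var_inj by metis
qed

text \<open>Naming can be pulled out of the loops: the printed list is a renamed list of
  applications, to which \<open>COND_yes_image\<close> applies.\<close>

lemma inst_vars_eq:
  assumes "distinct Fs" "\<And>x. x \<in> set as \<Longrightarrow> fst x < length Fs"
  shows "inst_vars js as W =
    map (app_var Fs) (block {3} js W (\<lambda>ps. map (app_of Fs (deref W ps)) as))"
proof -
  have "(\<lambda>ps. map (instantiate W ps) as) =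
      (\<lambda>ps. map (app_var Fs) (map (app_of Fs (deref W ps)) as))"
    using assms by (intro ext) (simp add: app_var_app_of)
  then show ?thesis
    unfolding inst_vars_def map_block by (rule arg_cong)
qed

lemma inst_atoms_eq:
  assumes "distinct Fs"
    and "\<And>b a x. b \<in> set bs \<Longrightarrow> a \<in> set (snd b) \<Longrightarrow> x \<in> set_atom a \<Longrightarrow> fst x < length Fs"
  shows "inst_atoms js bs W = map (map_atom (app_var Fs)) (concat (map (\<lambda>b.
    block (fst b) js W (\<lambda>ps. map (map_atom (app_of Fs (deref W ps))) (snd b))) bs))"
proof -
  have "block (fst b) js W (\<lambda>ps. map (map_atom (instantiate W ps)) (snd b)) =
      map (map_atom (app_var Fs)) (block (fst b) js W (\<lambda>ps. map (map_atom (app_of Fs (deref W ps))) (snd b)))"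
    if b: "b \<in> set bs" for b
  proof -
    have "map_atom (instantiate W ps) a = map_atom (app_var Fs) (map_atom (app_of Fs (deref W ps)) a)"
      if "a \<in> set (snd b)" for a ps
      unfolding atom.map_comp comp_def
      using assms(2)[OF b that] assms(1) by (intro atom.map_cong0) (simp add: app_var_app_of)
    then have "(\<lambda>ps. map (map_atom (instantiate W ps)) (snd b)) =
        (\<lambda>ps. map (map_atom (app_var Fs)) (map (map_atom (app_of Fs (deref W ps))) (snd b)))"
      by auto
    then show ?thesis
      unfolding map_block by (rule arg_cong)
  qed
  then show ?thesis
    unfolding inst_atoms_def map_concat map_map comp_def by (intro arg_cong[of _ _ concat] map_cong) auto
qed

text \<open>These claims provide the conditions \<open>C1\<close> and \<open>C2\<close> of
  \<open>set_block_vars\<close> and the precondition for printing arguments. All rest on the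
  correspondence between positions of \<open>m\<close> and atoms with that marker.\<close>

lemma mark_contexts:
  assumes "3 < m" "\<And>a. a \<in> set \<phi> \<Longrightarrow> atom_mark a = m \<Longrightarrow> length (atom_args a) = n"
  shows "i \<in> set (positions {m} (word_of \<phi>)) \<Longrightarrow> k < n \<Longrightarrow> has_arg (word_of \<phi>) i k"
    and "i \<in> set (positions {m} (word_of \<phi>)) \<Longrightarrow> \<exists>c \<in> {atom_args a | a. a \<in> set \<phi> \<and> atom_mark a = m}.
      \<forall>k \<in> {..<n}. var_at (word_of \<phi>) (arg_pos (word_of \<phi>) i k) = c ! k"
    and "c \<in> {atom_args a | a. a \<in> set \<phi> \<and> atom_mark a = m} \<Longrightarrow>
      \<exists>i \<in> set (positions {m} (word_of \<phi>)).
        \<forall>k \<in> {..<n}. var_at (word_of \<phi>) (arg_pos (word_of \<phi>) i k) = c ! k"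
proof -
  assume "i \<in> set (positions {m} (word_of \<phi>))"
  then obtain \<phi>1 a \<phi>2 where a: "\<phi> = \<phi>1 @ a # \<phi>2" "atom_mark a = m"
    "i = length (3 # concat (map atom_tok \<phi>1))"
    unfolding word_of_marks[OF assms(1)] by blast
  then have n: "length (atom_args a) = n"
    using assms(2) by simp
  show "has_arg (word_of \<phi>) i k" if "k < n"
    using word_of_arg(1)[OF a(1)] n that a(3) by simp
  show "\<exists>c \<in> {atom_args a | a. a \<in> set \<phi> \<and> atom_mark a = m}.
      \<forall>k \<in> {..<n}. var_at (word_of \<phi>) (arg_pos (word_of \<phi>) i k) = c ! k"
    using word_of_arg(2)[OF a(1)] n a by (intro bexI[of _ "atom_args a"]) auto
next
  assume "c \<in> {atom_args a | a. a \<in> set \<phi> \<and> atom_mark a = m}"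
  then obtain a where a: "c = atom_args a" "a \<in> set \<phi>" "atom_mark a = m" by blast
  then obtain \<phi>1 \<phi>2 where \<phi>: "\<phi> = \<phi>1 @ a # \<phi>2"
    by (meson split_list)
  have "length (3 # concat (map atom_tok \<phi>1)) \<in> set (positions {m} (word_of \<phi>))"
    unfolding word_of_marks[OF assms(1)] using \<phi> a(3) by blast
  then show "\<exists>i \<in> set (positions {m} (word_of \<phi>)).
        \<forall>k \<in> {..<n}. var_at (word_of \<phi>) (arg_pos (word_of \<phi>) i k) = c ! k"
    using word_of_arg(2)[OF \<phi>] assms(2)[OF a(2,3)] a(1) by (intro bexI) auto
qed

lemma atom_mark_4: "atom_mark a = 4 \<longleftrightarrow> (\<exists>u v. a = Eq u v)"
  by (cases a) auto

lemma atom_mark_Rel: "atom_mark a = 5 + R \<longleftrightarrow> (\<exists>vs. a = Rel R vs)"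
  by (cases a) auto

lemma CSP_iff: "enc_formula \<phi> \<in> CSP \<D> \<longleftrightarrow> formula_over \<D> \<phi> \<and> CSP_yes \<D> \<phi>"
  using inj_enc_formula by (auto simp: CSP_def inj_def)

lemma COND_iff: "enc_cond_instance us \<phi> \<in> COND \<B> \<longleftrightarrow>
    formula_over \<B> \<phi> \<and> vars \<phi> \<subseteq> set us \<and> COND_yes \<B> (set us) \<phi>"
  by (auto simp: COND_def enc_cond_instance_inject)

text \<open>The empty word, printed for malformed inputs, is thus a no-instance.\<close>

lemma Nil_notin_COND: "[] \<notin> COND \<B>"
proof
  assume "[] \<in> COND \<B>"
  then obtain us \<phi> where "[] = enc_cond_instance us \<phi>"
    unfolding COND_def by auto
  then show False
    by (cases us) (auto simp: enc_cond_instance_def)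
qed

lemma vars_map_atom: "vars (map (map_atom \<nu>) \<psi>) = \<nu> ` vars \<psi>"
  by (auto simp: vars_def atom.set_map)

lemma formula_over_map_atom [simp]: "formula_over \<B> (map (map_atom \<nu>) \<psi>) \<longleftrightarrow> formula_over \<B> \<psi>"
  by (simp add: formula_over_def)

lemma enc_COND_image:
  assumes "inj_on \<nu> (set us)" "vars \<psi> \<subseteq> set us" "formula_over \<B> \<psi>"
  shows "enc_cond_instance (map \<nu> us) (map (map_atom \<nu>) \<psi>) \<in> COND \<B> \<longleftrightarrow> COND_yes \<B> (set us) \<psi>"
  using assms COND_yes_image[OF assms(1,2)] by (auto simp: COND_iff vars_map_atom)

lemma reduction_nonempty:
  fixes \<B> :: "'b rel_struct" and \<D> :: "'d rel_struct" and F :: "('d, 'b) enc_map set"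
  assumes wf: "wf_struct \<B>" and enc: "encoding F D (universe \<B>)"
    and const: "contains_constants F D (universe \<B>)" and stable: "stable \<B> D F"
    and ind: "induced_template \<B> D F \<D>" and D: "D \<noteq> {}"
  shows "CSP \<D> \<le>\<^sub>p COND \<B>"
proof -
  have "finite F"
    using enc by (simp add: encoding_def)
  then obtain Fs where Fs: "set Fs = F" "distinct Fs"
    using finite_distinct_list by blast
  have "finite (fst ` F)"
    using \<open>finite F\<close> by simp
  then obtain K where K: "\<And>kf. kf \<in> set Fs \<Longrightarrow> fst kf \<le> K"
    unfolding finite_nat_set_iff_bounded_le using Fs(1) by blast
  have fin: "finite (symbols \<B>)" "finite (symbols \<D>)" and univ: "universe \<D> = D"
    using wf ind by (auto simp: wf_struct_def induced_template_def)
  then have "finite (arity \<B> ` symbols \<B>)"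
    by simp
  then obtain m where m: "\<And>R. R \<in> symbols \<B> \<Longrightarrow> arity \<B> R \<le> m"
    unfolding finite_nat_set_iff_bounded_le by blast
  \<comment> \<open>\<open>m * K\<close> heads cover the variables of a relational atom,
    \<open>2 * K\<close> those of an equality; the sum bounds both and also \<open>K\<close>, the
    heads needed for one application.\<close>
  define M where "M = (m + 2) * K"
  have M: "\<And>R. R \<in> symbols \<B> \<Longrightarrow> arity \<B> R * K \<le> M" "2 * K \<le> M" "K \<le> M"
  proof -
    show "arity \<B> R * K \<le> M" if "R \<in> symbols \<B>" for R
      unfolding M_def using m[OF that] by (intro mult_le_mono1) simp
  qed (simp_all add: M_def)
  have KM: "\<And>kf. kf \<in> set Fs \<Longrightarrow> fst kf \<le> M"
    using K M(3) by (meson le_trans)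
  have "\<exists>a. represents \<B> Fs \<D> R a" if "R \<in> symbols \<D>" for R
    using ex_represents[OF wf, of Fs D \<D> R] enc ind that univ Fs(1) by (auto simp: induced_template_def)
  then obtain \<tau> where \<tau>: "\<And>R. R \<in> symbols \<D> \<Longrightarrow> represents \<B> Fs \<D> R (\<tau> R)"
    by metis
  obtain TL where TL: "set TL = valid_templates \<B> D Fs M"
    using finite_list[OF finite_valid_templates[OF fin(1)]] by blast
  obtain Rl where Rl: "set Rl = symbols \<D>"
    using finite_list[OF fin(2)] by blast
  define js where "js = [3..<3 + M]"
  have js: "distinct js" "set js \<subseteq> {3..<3 + M}" "2 \<notin> set js"
    by (auto simp: js_def)
  define as where "as = all_apps Fs"
  \<comment> \<open>Valid atoms are printed at the variable positions, equalities at marker 4, and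
    constraints with symbol \<open>R\<close> at marker \<open>5 + R\<close>.\<close>
  define bs where "bs = ({3}, TL) # ({4}, swap_templates Fs) # map (\<lambda>R. ({5 + R}, [\<tau> R])) Rl"
  have as: "fst x < length Fs \<and> set (snd x) \<subseteq> Head ` set js" if x: "x \<in> set as" for x
  proof -
    obtain j where "j < length Fs" "x = (j, map Head [3..<3 + fst (Fs ! j)])"
      using x by (auto simp: as_def all_apps_def)
    then show ?thesis
      using KM[of "Fs ! j"] by (auto simp: js_def)
  qed
  have TL_fapps: "set_atom a \<subseteq> fapps Fs (Head ` set js)" if "a \<in> set TL" for a
    using that unfolding TL js_def valid_templates_def by blast
  have swap_fapps: "set_atom a \<subseteq> fapps Fs (Head ` set js \<union> Arg ` {..<2})"
    if "a \<in> set (swap_templates Fs)" for a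
    using swap_templates_fapps[OF KM that] by (simp only: js_def)
  have \<tau>_fapps: "set_atom (\<tau> R) \<subseteq> fapps Fs (Arg ` {..<arity \<D> R})" if "R \<in> symbols \<D>" for R
    using \<tau>[OF that] by (simp add: represents_def)
  have bs_cases: "(b = ({3}, TL) \<and> a \<in> set TL) \<or>
      (b = ({4}, swap_templates Fs) \<and> a \<in> set (swap_templates Fs)) \<or>
      (\<exists>R \<in> symbols \<D>. b = ({5 + R}, [\<tau> R]) \<and> a = \<tau> R)"
    if "b \<in> set bs" "a \<in> set (snd b)" for b a
    using that Rl by (auto simp: bs_def)
  have bs_idx: "fst x < length Fs" if "b \<in> set bs" "a \<in> set (snd b)" "x \<in> set_atom a" for b a x
  proof -
    have "\<exists>rs. x \<in> fapps Fs rs"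
      using bs_cases[OF that(1,2)] TL_fapps[of a] swap_fapps[of a] \<tau>_fapps that(3) by blast
    then show ?thesis by (auto simp: fapps_iff)
  qed
  have bs_heads: "j \<in> set js" if "b \<in> set bs" "a \<in> set (snd b)" "Head j \<in> app_refs a" for b a j
    using bs_cases[OF that(1,2)] TL_fapps[of a, THEN app_refs_subset]
      swap_fapps[of a, THEN app_refs_subset] \<tau>_fapps[THEN app_refs_subset] that(3)
    by blast
  have Eq_args: "length (atom_args a) = 2" if "atom_mark a = 4" for a :: "var atom"
    using that by (auto simp: atom_mark_4)
  have Rel_args: "length (atom_args a) = arity \<D> R"
    if "formula_over \<D> \<phi>" "a \<in> set \<phi>" "atom_mark a = 5 + R" for a :: "var atom" and R \<phi>
    using that unfolding atom_mark_Rel by (auto simp: formula_over_def)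
  have bs_args: "block_args_ok (word_of \<phi>) b" if \<phi>: "formula_over \<D> \<phi>" and b: "b \<in> set bs" for \<phi> b
    unfolding block_args_ok_def
  proof (intro ballI allI impI)
    fix i a k
    assume i: "i \<in> set (positions (fst b) (word_of \<phi>))" and a: "a \<in> set (snd b)"
      and k: "Arg k \<in> app_refs a"
    consider "a \<in> set TL" | "b = ({4}, swap_templates Fs)" "a \<in> set (swap_templates Fs)"
      | R where "R \<in> symbols \<D>" "b = ({5 + R}, [\<tau> R])" "a = \<tau> R"
      using bs_cases[OF b a] by blast
    then show "has_arg (word_of \<phi>) i k"
    proof cases
      case 1
      then show ?thesis using TL_fapps[THEN app_refs_subset] k by blast
    next
      case 2
      then have "k < 2" using swap_fapps[THEN app_refs_subset] k by blast
      then show ?thesis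
        using mark_contexts(1)[of 4 \<phi> 2 i k] Eq_args i 2(1) by simp
    next
      case 3
      then have "k < arity \<D> R" using \<tau>_fapps[THEN app_refs_subset] k by blast
      then show ?thesis
        using mark_contexts(1)[of "5 + R" \<phi> "arity \<D> R" i k] Rel_args[OF \<phi>] i 3(2) by simp
    qed
  qed
  have "prints (3 + M) (\<lambda>W ps. start W ps \<and> (\<forall>b \<in> set bs. block_args_ok W b))
      (put_instance (3 + M) js as bs) (\<lambda>W ps. enc_cond_instance (inst_vars js as W) (inst_atoms js bs W))"
    using as by (intro prints_put_instance js bs_heads) auto
  moreover have "wf_com (Suc (3 + M)) S (put_instance (3 + M) js as bs)" if "4 \<le> S" for S
    using as that by (intro wf_put_instance js bs_heads) auto
  ultimately obtain h where h: "polytime_computable h"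
    "\<And>\<phi>. formula_over \<D> \<phi> \<Longrightarrow> h (enc_formula \<phi>) =
      enc_cond_instance (inst_vars js as (word_of \<phi>)) (inst_atoms js bs (word_of \<phi>))"
    "\<And>w. \<nexists>\<phi>. formula_over \<D> \<phi> \<and> w = enc_formula \<phi> \<Longrightarrow> h w = []"
    using polytime_computable_parse[OF fin(2), of "3 + M" "put_instance (3 + M) js as bs"
        "\<lambda>W. \<forall>b \<in> set bs. block_args_ok W b"
        "\<lambda>W. enc_cond_instance (inst_vars js as W) (inst_atoms js bs W)"] bs_args
    by auto
  have correct: "CSP_yes \<D> \<phi> \<longleftrightarrow> h (enc_formula \<phi>) \<in> COND \<B>" if \<phi>: "formula_over \<D> \<phi>" for \<phi>
  proof -
    define W where "W = word_of \<phi>"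
    define V where "V = insert [] (vars \<phi>)"
    have V: "finite V" "V \<noteq> {}" "vars \<phi> \<subseteq> V"
    proof -
      have "finite (set_atom a)" for a :: "var atom"
        by (cases a) auto
      then show "finite V"
        by (simp add: V_def vars_def)
    qed (auto simp: V_def)
    have W_V: "var_at W ` set (positions {3} W) = V"
      by (simp add: W_def V_def word_of_vars)
    define us where "us = block {3} js W (\<lambda>ps. map (app_of Fs (deref W ps)) as)"
    define \<psi> where "\<psi> = concat (map (\<lambda>b.
      block (fst b) js W (\<lambda>ps. map (map_atom (app_of Fs (deref W ps))) (snd b))) bs)"
    \<comment> \<open>For templates without arguments the context is the empty list, and the outer
      loop has to run at least once; it does because \<open>V\<close> is not empty.\<close>
    have nonempty: "\<exists>i \<in> set (positions {3} W). \<forall>k \<in> {}. var_at W (arg_pos W i k) = c ! k" for c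
      using W_V V(2) by auto
    have us: "set us = applications V (set Fs)"
    proof -
      have cong: "app_of Fs d x = app_of Fs d' x"
        if "x \<in> set as" "\<And>r. r \<in> Head ` set js \<union> Arg ` {} \<Longrightarrow> d r = d' r" for x and d d' :: "ref \<Rightarrow> var"
        using as[OF that(1)] that(2) by (auto simp: app_of_def)
      have "set us = {app_of Fs (context_of c \<sigma>) x | c \<sigma> x. c \<in> {[]} \<and> (\<forall>j \<in> set js. \<sigma> j \<in> V) \<and> x \<in> set as}"
        unfolding us_def
        by (rule set_block_vars[OF js(1,3) W_V _ nonempty cong]) simp_all
      also have "\<dots> = applications V (set Fs)"
        unfolding js_def as_def by (rule all_apps_eq[OF V(2) KM])
      finally show ?thesis .
    qed
    have TL_block: "set (block {3} js W (\<lambda>ps. map (map_atom (app_of Fs (deref W ps))) TL)) =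
        valid_atoms \<B> D (set Fs) V"
    proof -
      have "set (block {3} js W (\<lambda>ps. map (map_atom (app_of Fs (deref W ps))) TL)) =
        {map_atom (app_of Fs (context_of c \<sigma>)) x | c \<sigma> x. c \<in> {[]} \<and> (\<forall>j \<in> set js. \<sigma> j \<in> V) \<and> x \<in> set TL}"
        by (rule set_block_vars[OF js(1,3) W_V _ nonempty app_of_cong[OF TL_fapps]]) simp_all
      also have "\<dots> = valid_atoms \<B> D (set Fs) V"
        unfolding js_def TL by (rule valid_templates_eq[OF V(1,2) D K M(1,2)])
      finally show ?thesis .
    qed
    have swap_block: "set (block {4} js W (\<lambda>ps. map (map_atom (app_of Fs (deref W ps))) (swap_templates Fs))) =
        (\<Union>(u, v) \<in> {(u, v). Eq u v \<in> set \<phi>}. swap_atoms (set Fs) V u v)"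
    proof -
      have C: "{atom_args a | a. a \<in> set \<phi> \<and> atom_mark a = 4} = {[u, v] | u v. Eq u v \<in> set \<phi>}"
        unfolding atom_mark_4 by force
      have "set (block {4} js W (\<lambda>ps. map (map_atom (app_of Fs (deref W ps))) (swap_templates Fs))) =
        {map_atom (app_of Fs (context_of c \<sigma>)) x | c \<sigma> x. c \<in> {[u, v] | u v. Eq u v \<in> set \<phi>} \<and>
          (\<forall>j \<in> set js. \<sigma> j \<in> V) \<and> x \<in> set (swap_templates Fs)}"
      proof (rule set_block_vars[OF js(1,3) W_V, where K = "{..<2}"])
        show "\<exists>c \<in> {[u, v] | u v. Eq u v \<in> set \<phi>}. \<forall>k \<in> {..<2}. var_at W (arg_pos W i k) = c ! k"
          if "i \<in> set (positions {4} W)" for i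
          using mark_contexts(2)[of 4 \<phi> 2 i] Eq_args that unfolding W_def C by simp
        show "\<exists>i \<in> set (positions {4} W). \<forall>k \<in> {..<2}. var_at W (arg_pos W i k) = c ! k"
          if "c \<in> {[u, v] | u v. Eq u v \<in> set \<phi>}" for c
          using mark_contexts(3)[of 4 \<phi> 2 c] Eq_args that unfolding W_def C by simp
      qed (rule app_of_cong[OF swap_fapps])
      also have "\<dots> = (\<Union>(u, v) \<in> {(u, v). Eq u v \<in> set \<phi>}. swap_atoms (set Fs) V u v)"
        unfolding js_def by (rule swap_templates_eq[OF V(2) KM])
      finally show ?thesis .
    qed
    have Rel_block: "set (block {5 + R} js W (\<lambda>ps. map (map_atom (app_of Fs (deref W ps))) [\<tau> R])) =
        {map_atom (app_of Fs (context_of vs (\<lambda>_. []))) (\<tau> R) | vs. Rel R vs \<in> set \<phi>}"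
      if R: "R \<in> symbols \<D>" for R
    proof -
      let ?n = "arity \<D> R"
      have C: "{atom_args a | a. a \<in> set \<phi> \<and> atom_mark a = 5 + R} = {vs. Rel R vs \<in> set \<phi>}"
        unfolding atom_mark_Rel by force
      have "set (block {5 + R} js W (\<lambda>ps. map (map_atom (app_of Fs (deref W ps))) [\<tau> R])) =
        {map_atom (app_of Fs (context_of c \<sigma>)) x | c \<sigma> x. c \<in> {vs. Rel R vs \<in> set \<phi>} \<and>
          (\<forall>j \<in> set js. \<sigma> j \<in> V) \<and> x \<in> set [\<tau> R]}"
      proof (rule set_block_vars[OF js(1,3) W_V, where K = "{..<?n}"])
        show "\<exists>c \<in> {vs. Rel R vs \<in> set \<phi>}. \<forall>k \<in> {..<?n}. var_at W (arg_pos W i k) = c ! k"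
          if "i \<in> set (positions {5 + R} W)" for i
          using mark_contexts(2)[of "5 + R" \<phi> ?n i] Rel_args[OF \<phi>] that unfolding W_def C by simp
        show "\<exists>i \<in> set (positions {5 + R} W). \<forall>k \<in> {..<?n}. var_at W (arg_pos W i k) = c ! k"
          if "c \<in> {vs. Rel R vs \<in> set \<phi>}" for c
          using mark_contexts(3)[of "5 + R" \<phi> ?n c] Rel_args[OF \<phi>] that unfolding W_def C by simp
        show "map_atom (app_of Fs d) x = map_atom (app_of Fs d') x"
          if "x \<in> set [\<tau> R]" "\<And>r. r \<in> Head ` set js \<union> Arg ` {..<?n} \<Longrightarrow> d r = d' r" for x d d'
          using app_of_cong[OF \<tau>_fapps[OF R], of d d'] that by simp
      qed
      also have "\<dots> = {map_atom (app_of Fs (context_of vs (\<lambda>_. []))) (\<tau> R) | vs. Rel R vs \<in> set \<phi>}"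
        (is "?L = ?R")
      proof -
        \<comment> \<open>\<open>\<tau> R\<close> refers to arguments of the atom only, so all
          choices for the heads give the same atom. The constant choice \<open>[]\<close> represents
          them, as \<open>[]\<close> belongs to \<open>V\<close>.\<close>
        have const: "map_atom (app_of Fs (context_of c \<sigma>)) (\<tau> R) =
            map_atom (app_of Fs (context_of c (\<lambda>_. []))) (\<tau> R)" for c \<sigma>
          by (rule app_of_cong[OF \<tau>_fapps[OF R]]) auto
        have "y \<in> ?R" if "y \<in> ?L" for y
        proof -
          obtain c \<sigma> where "Rel R c \<in> set \<phi>" "y = map_atom (app_of Fs (context_of c \<sigma>)) (\<tau> R)"
            using \<open>y \<in> ?L\<close> by auto
          then show ?thesis using const[of c \<sigma>] by auto
        qed
        moreover have "y \<in> ?L" if "y \<in> ?R" for y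
        proof -
          obtain c where c: "Rel R c \<in> set \<phi>" "y = map_atom (app_of Fs (context_of c (\<lambda>_. []))) (\<tau> R)"
            using \<open>y \<in> ?R\<close> by auto
          have "\<forall>j \<in> set js. (\<lambda>_. []) j \<in> V"
            by (simp add: V_def)
          then show ?thesis using c by (intro CollectI exI[of _ c] exI[of _ "\<lambda>_. []"]) simp
        qed
        ultimately show ?thesis by blast
      qed
      finally show ?thesis .
    qed
    have \<psi>_set: "set \<psi> = valid_atoms \<B> D (set Fs) V \<union>
      {map_atom (app_of Fs (context_of vs (\<lambda>_. []))) (\<tau> R) | R vs. Rel R vs \<in> set \<phi>} \<union>
      (\<Union>(u, v) \<in> {(u, v). Eq u v \<in> set \<phi>}. swap_atoms (set Fs) V u v)"
    proof -
      define blk where "blk b = set (block (fst b) js W (\<lambda>ps. map (map_atom (app_of Fs (deref W ps))) (snd b)))"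
        for b
      have blk: "blk ({3}, TL) = valid_atoms \<B> D (set Fs) V"
        "blk ({4}, swap_templates Fs) = (\<Union>(u, v) \<in> {(u, v). Eq u v \<in> set \<phi>}. swap_atoms (set Fs) V u v)"
        "\<And>R. R \<in> symbols \<D> \<Longrightarrow> blk ({5 + R}, [\<tau> R]) =
          {map_atom (app_of Fs (context_of vs (\<lambda>_. []))) (\<tau> R) | vs. Rel R vs \<in> set \<phi>}"
        unfolding blk_def fst_conv snd_conv by (rule TL_block swap_block Rel_block, assumption?)+
      have "set \<psi> = (\<Union>b \<in> set bs. blk b)"
        by (simp add: \<psi>_def blk_def)
      also have "\<dots> = blk ({3}, TL) \<union> blk ({4}, swap_templates Fs) \<union>
          (\<Union>R \<in> symbols \<D>. blk ({5 + R}, [\<tau> R]))"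
        unfolding bs_def Rl[symmetric] by auto
      also have "(\<Union>R \<in> symbols \<D>. blk ({5 + R}, [\<tau> R])) = (\<Union>R \<in> symbols \<D>.
          {map_atom (app_of Fs (context_of vs (\<lambda>_. []))) (\<tau> R) | vs. Rel R vs \<in> set \<phi>})"
        by (rule SUP_cong[OF refl blk(3)])
      finally have "set \<psi> = valid_atoms \<B> D (set Fs) V \<union>
        (\<Union>(u, v) \<in> {(u, v). Eq u v \<in> set \<phi>}. swap_atoms (set Fs) V u v) \<union>
        (\<Union>R \<in> symbols \<D>. {map_atom (app_of Fs (context_of vs (\<lambda>_. []))) (\<tau> R) | vs. Rel R vs \<in> set \<phi>})"
        unfolding blk(1,2) .
      moreover have "R \<in> symbols \<D>" if "Rel R vs \<in> set \<phi>" for R vs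
        using \<phi> that by (auto simp: formula_over_def)
      ultimately show ?thesis by blast
    qed
    note \<psi> = COND_iff_CSP[OF wf _ _ _ univ D \<tau> \<phi> V \<psi>_set, unfolded Fs(1), OF enc const stable]
    have "h (enc_formula \<phi>) = enc_cond_instance (map (app_var Fs) us) (map (map_atom (app_var Fs)) \<psi>)"
      using h(2)[OF \<phi>] inst_vars_eq[OF Fs(2), of as js W] inst_atoms_eq[OF Fs(2), of bs js W, OF bs_idx] as
      by (simp add: us_def \<psi>_def W_def)
    moreover have "inj_on (app_var Fs) (set us)"
      unfolding us by (rule inj_on_app_var[OF Fs(2)])
    ultimately have "h (enc_formula \<phi>) \<in> COND \<B> \<longleftrightarrow> COND_yes \<B> (set us) \<psi>"
      using enc_COND_image[of "app_var Fs" us \<psi> \<B>] \<psi>(1,2) us Fs(1) by simp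
    then show ?thesis
      using \<psi>(3) us Fs(1) by simp
  qed
  have "w \<in> CSP \<D> \<longleftrightarrow> h w \<in> COND \<B>" for w
  proof (cases "\<exists>\<phi>. formula_over \<D> \<phi> \<and> w = enc_formula \<phi>")
    case True
    then show ?thesis using correct by (auto simp: CSP_iff)
  next
    case False
    then have "w \<notin> CSP \<D>"
      by (auto simp: CSP_def)
    then show ?thesis using h(3)[OF False] by (simp add: Nil_notin_COND)
  qed
  then show ?thesis
    unfolding polytime_reducible_def using h(1) by blast
qed

section \<open>The empty domain\<close>

lemma ex_COND:
  assumes "wf_struct \<B>"
  shows "\<exists>y. y \<in> COND \<B>"
proof -
  let ?B = "universe \<B>"
  have fin: "finite ?B" "finite (symbols \<B>)"
    and rel: "\<And>R. R \<in> symbols \<B> \<Longrightarrow> rel \<B> R \<subseteq> tuples ?B (arity \<B> R)"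
    using assms by (auto simp: wf_struct_def)
  have "finite (\<Union>R \<in> symbols \<B>. Rel R ` rel \<B> R)"
    using fin rel by (meson finite_UN_I finite_imageI finite_subset finite_tuples)
  from finite_list[OF this] obtain \<psi> where \<psi>: "set \<psi> = (\<Union>R \<in> symbols \<B>. Rel R ` rel \<B> R)"
    by (elim exE)
  obtain us where us: "set us = ?B"
    using finite_list[OF fin(1)] by blast
  \<comment> \<open>Elements of \<open>B\<close> are named by words of different lengths.\<close>
  from finite_imp_inj_to_nat_seg[OF fin(1)] obtain f :: "'a \<Rightarrow> nat" where f: "inj_on f ?B"
    by (elim exE conjE)
  \<comment> \<open>The elements of \<open>B\<close> are the variables, every tuple of every
    relation is an atom, and the identity is a solution.\<close>
  have "COND_yes \<B> ?B \<psi>"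
  proof (rule COND_yesI[of "\<lambda>x \<in> ?B. x"])
    have id: "map (\<lambda>x \<in> ?B. x) bs = bs" if "R \<in> symbols \<B>" "bs \<in> rel \<B> R" for R bs
      using rel[OF that(1)] that(2) by (intro map_idI) (auto simp: tuples_def)
    show "sat \<B> (\<lambda>x \<in> ?B. x) \<psi>"
      using id by (auto simp: sat_def \<psi>)
    show "\<exists>us. Rel R us \<in> set \<psi> \<and> map (\<lambda>x \<in> ?B. x) us = bs"
      if "R \<in> symbols \<B>" "bs \<in> rel \<B> R" for R bs
      using id[OF that] that \<psi> by blast
  qed auto
  moreover have "inj_on (\<lambda>x. replicate (f x) True) (set us)"
    using f us by (auto simp: inj_on_def dest: arg_cong[where f = length])
  moreover have "vars \<psi> \<subseteq> set us" "formula_over \<B> \<psi>"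
    using rel by (force simp: vars_def formula_over_def \<psi> us tuples_def)+
  ultimately show ?thesis
    using enc_COND_image us by metis
qed

text \<open>Over the empty universe only the empty formula, encoded by the word \<open>[False]\<close>, is satisfiable.\<close>

definition accept_empty :: "bool list \<Rightarrow> com" where
  "accept_empty y = Branch 0 {1} (Then (move_head 0 Move_Right) (Branch 0 {0} (put_word 2 y) skip)) skip"

lemma polytime_computable_accept_empty: "polytime_computable (\<lambda>w. if w = [False] then y else [])"
proof -
  obtain p where p: "\<forall>X W ps out. 0 \<notin> set W \<and> True \<longrightarrow> (\<exists>t \<le> poly p (length W).
      exec (put_word 2 y) (store 2 X W ps out) t (store 2 X W ps (out @ y)))"
    using prints_put_word[of 2 "\<lambda>_ _. True" y, unfolded runs_def] by auto
  define n where "n = poly p 0"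
  show ?thesis
  proof (rule polytime_computable_com[where N = 3 and S = 3 and c = "accept_empty y" and p = "[:n + 10:]"])
    show "wf_com 3 3 (accept_empty y)"
      by (simp add: accept_empty_def)
    fix w
    \<comment> \<open>With \<open>L = 2\<close> there are no pointer tapes: tape 0 holds the input
      and tape 2 is the output.\<close>
    define T where "T i out = store 2 (\<lambda>j. if j = 0 then (word_contents w, i) else (word_contents [], 0)) [] (\<lambda>_. 0) out"
      for i out
    have T: "init_tapes w = T 0 []"
      by (auto simp: T_def init_tapes_def store_def word_contents_def fun_eq_iff)
    have read: "read_tape (T i out 0) = word_contents w i" for i out
      by (simp add: T_def store_def)
    have out: "fst (T i out 2) = word_contents out" for i out
      by (simp add: T_def store_def)
    have move: "exec (move_head 0 Move_Right) (T 0 []) 1 (T 1 [])"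
    proof -
      have "act_all (\<lambda>i a _ _. (a, if i = 0 then Move_Right else Move_None)) (T 0 []) = T 1 []"
        by (auto simp: act_all_def T_def store_def fun_eq_iff)
      then show ?thesis
        unfolding move_head_def by (rule exec_Act_eq)
    qed
    have "\<exists>t i. t \<le> n + 10 \<and> exec (accept_empty y) (T 0 []) t (T i (if w = [False] then y else []))"
    proof (cases "word_contents w 0 = 1")
      case 0: True
      show ?thesis
      proof (cases "word_contents w 1 = 0")
        case True
        have "w = [False]"
          using 0 True by (cases w rule: remdups_adj.cases) (auto simp: word_contents_def split: if_splits)
        obtain t where t: "t \<le> n" "exec (put_word 2 y) (T 1 []) t (T 1 y)"
          using p[rule_format, of "[]" _ "\<lambda>_. 0" "[]"] unfolding T_def n_def by auto
        have "exec (accept_empty y) (T 0 []) ((1 + (t + 2)) + 2) (T 1 y)"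
          unfolding accept_empty_def
          by (intro exec.Branch_True exec.Then[OF move] t(2)) (simp_all add: read 0 True)
        then show ?thesis
          using t(1) \<open>w = [False]\<close> by (intro exI[of _ "(1 + (t + 2)) + 2"] exI[of _ 1]) simp
      next
        case False
        have "exec (accept_empty y) (T 0 []) ((1 + (1 + 1)) + 2) (T 1 [])"
          unfolding accept_empty_def
          by (rule exec.Branch_True, simp add: read 0,
              rule exec.Then[OF move], rule exec.Branch_False, simp add: read False, rule exec_skip)
        moreover have "w \<noteq> [False]"
          using False by (auto simp: word_contents_def)
        ultimately show ?thesis
          by (intro exI[of _ "(1 + (1 + 1)) + 2"] exI[of _ 1]) simp
      qed
    next
      case False
      have "read_tape (T 0 [] 0) \<notin> {1}"
        using False by (simp add: read)
      from exec.Branch_False[of "T 0 []" 0, OF this exec_skip]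
      have "exec (accept_empty y) (T 0 []) (1 + 1) (T 0 [])"
        unfolding accept_empty_def .
      moreover have "w \<noteq> [False]"
        using False by (auto simp: word_contents_def)
      ultimately show ?thesis
        by (intro exI[of _ "1 + 1"] exI[of _ 0]) simp
    qed
    then show "\<exists>t T'. t \<le> poly [:n + 10:] (length w) \<and> exec (accept_empty y) (init_tapes w) t T' \<and>
      fst (T' (3 - 1)) = word_contents (if w = [False] then y else [])"
      unfolding T using out by fastforce
  qed auto
qed

text \<open>Positive arities give every atom a variable, and no variable has a value in an empty
  universe; so \<open>[False]\<close>, the code of the empty formula, is the only
  yes-instance.\<close>

lemma reduction_empty:
  assumes "wf_struct \<B>" "universe \<D> = {}" "\<And>R. R \<in> symbols \<D> \<Longrightarrow> 1 \<le> arity \<D> R"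
  shows "CSP \<D> \<le>\<^sub>p COND \<B>"
proof -
  obtain y where y: "y \<in> COND \<B>"
    using ex_COND[OF assms(1)] by blast
  have "w \<in> CSP \<D> \<longleftrightarrow> w = [False]" for w
  proof
    assume "w \<in> CSP \<D>"
    then obtain \<phi> where \<phi>: "w = enc_formula \<phi>" "formula_over \<D> \<phi>" "CSP_yes \<D> \<phi>"
      by (auto simp: CSP_def)
    then have "vars \<phi> = {}"
      using assms(2) by (auto simp: CSP_yes_def PiE_eq_empty_iff)
    have "\<phi> = []"
    proof (rule ccontr)
      assume "\<phi> \<noteq> []"
      then have "set_atom (hd \<phi>) = {}" "atom_over \<D> (hd \<phi>)"
        using \<open>vars \<phi> = {}\<close> \<phi>(2) by (auto simp: vars_def formula_over_def)
      then show False
        using assms(3) by (cases "hd \<phi>") fastforce+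
    qed
    then show "w = [False]"
      using \<phi>(1) by (simp add: enc_formula_def)
  next
    assume "w = [False]"
    then have "w = enc_formula []"
      by (simp add: enc_formula_def)
    moreover have "CSP_yes \<D> ([] :: var formula)"
      by (simp add: CSP_yes_def sat_def vars_def)
    ultimately show "w \<in> CSP \<D>"
      by (simp add: CSP_iff formula_over_def)
  qed
  then have "w \<in> CSP \<D> \<longleftrightarrow> (if w = [False] then y else []) \<in> COND \<B>" for w
    using y by (simp add: Nil_notin_COND)
  then show ?thesis
    unfolding polytime_reducible_def using polytime_computable_accept_empty by blast
qed

theorem theorem4p1:
  fixes \<B> :: "'b rel_struct" and \<D> :: "'d rel_struct"
    and D :: "'d set" and F :: "('d, 'b) enc_map set"
  assumes "wf_struct \<B>"
    and "finite D"
    and "encoding F D (universe \<B>)"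
    and "contains_constants F D (universe \<B>)"
    and "stable \<B> D F"
    and "induced_template \<B> D F \<D>"
  shows "CSP \<D> \<le>\<^sub>p COND \<B>"
\<comment> \<open>The main construction needs an element of \<open>D\<close> as the value of
  variables that the formula does not mention.\<close>
proof (cases "D = {}")
  case True
  have "universe \<D> = {}" "\<And>R. R \<in> symbols \<D> \<Longrightarrow> 1 \<le> arity \<D> R"
    using assms(6) True by (auto simp: induced_template_def induced_relation_def)
  then show ?thesis by (rule reduction_empty[OF assms(1)])
next
  case False
  then show ?thesis by (rule reduction_nonempty[OF assms(1,3-6)])
qed

end
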